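(* Let $n\ge2$. Let $\varphi:\mathrm{End}(X_n^{\mathbb Z},\sigma_n)\to\widetilde{\mathcal{AL}}_n$ be the map sending $\sigma_n^i f$ (with $i\in\mathbb Z$, $f\in F_\infty(X_n)$) to $([P],\alpha)$, where $P\in\widetilde{\mathcal P}_n$ is such that $f_P=f$, $[P]$ is the minimal representative of $P$, and $\alpha$ is the annotation of $[P]$ defined by $(q)\kappa\mapsto i+|\Lambda(\varepsilon,q)|$ for $q\in Q_P$ (with $\alpha=\infty$ if $[P]=Z_a$, $a\in X_n$). Then $\varphi$ is an isomorphism of monoids. The restriction of $\varphi$ to the subgroup $\mathrm{Aut}(X_n^{\mathbb Z},\sigma_n)$ yields an isomorphism onto the group $\mathcal{AL}_n$.
   Context: Functions are written on the right of arguments and composed left to right. **Transducers.** $X_n=\{0,\dots,n-1\}$; $X_n^*$ is the set of finite words ($\varepsilon$ the empty word), $X_n^+=X_n^*\setminus\{\varepsilon\}$, $X_n^{\mathbb N}$ the set of right-infinite words, $|w|$ the length of $w$. A transducer is $T=(X_n,Q_T,\pi_T,\lambda_T)$ with $Q_T$ a finite nonempty set of states, $\pi_T:X_n\times Q_T\to Q_T$, $\lambda_T:X_n\times Q_T\to X_n^*$, extended to words by $\pi_T(\varepsilon,q)=q$, $\lambda_T(\varepsilon,q)=\varepsilon$, $\pi_T(wx,q)=\pi_T(x,\pi_T(w,q))$, $\lambda_T(wx,q)=\lambda_T(w,q)\lambda_T(x,\pi_T(w,q))$, and $\lambda_T$ extended to infinite words. Always assumed: if $w\in X_n^+$ and $\pi_T(w,q)=q$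 then $\lambda_T(w,q)\ne\varepsilon$. Each state $q$ induces a continuous map $h_q:X_n^{\mathbb N}\to X_n^{\mathbb N}$, $w\mapsto\lambda_T(w,q)$. States $p,q$ (possibly of different transducers) are $\omega$-equivalent if $h_p=h_q$; $T$ is weakly minimal if distinct states are never $\omega$-equivalent. $\Lambda(w,q)$ is the greatest common prefix of $\{\lambda_T(wx,q):x\in X_n^{\mathbb N}\}$; $|\Lambda(\varepsilon,q)|\in\mathbb N\cup\{\infty\}$ is the extent of incomplete response of $q$, and $q$ is a state of incomplete response if $\Lambda(\varepsilon,q)\neq\varepsilon$. $T$ is strongly synchronizing if for some $k\ge 0$ (a synchronizing level), for each $w\in X_n^k$ the state $\pi_T(w,q)$ is independent of $q$ (the state forced by $w$). The states forced by words of length $k$ form a subtransducer $\mathrm{core}(T)$; $T$ is core if $T=\mathrm{core}(T)$. $T$ is synchronous if all $|\lambda_T(x,q)|=1$ ($x\in X_n$). For $x\in X_n^+$, $Z_x$ is the one-state transducer with output $x$ on every letter. A transducer is called minimal if either it is weakly minimal, strongly connected and has no states of incomplete response, or it is $Z_x$ with $x$ a prime word (not a proper power of a shorter word) lexicographically least among its rotations. Transducers are considered equal if there is a bijection of state sets matching $\omega$-equivalent states. **Reduction.** For a strongly synchronizing core transducer $C$ define a minimal transducer $[C]$ and a map $\kappa:Q_C\to Q_{[C]}$: if some (equivalently every) state has infinite extent of incomplete response, each state of $C$ is $\omega$-equivalent to the state of some $Z_x$ with $x$ prime (unique up to rotation), $[C]:=Z_{\bar x}$ with $\bar x$ the lexicographically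 least rotation of $x$, and $\kappa$ is constant; otherwise keep states and transitions, replace the output $\lambda_C(x,q)$ ($x\in X_n$) by the word obtained by deleting the prefix $\Lambda(\varepsilon,q)$ from $\Lambda(x,q)$, and then identify $\omega$-equivalent states, $\kappa$ sending a state to its class. **Monoids.** $T*U$ has states $Q_T\times Q_U$, $\pi_{T*U}(x,(p,q))=(\pi_T(x,p),\pi_U(\lambda_T(x,p),q))$, $\lambda_{T*U}(x,(p,q))=\lambda_U(\lambda_T(x,p),q)$. $\mathcal M_n$ is the monoid of minimal, strongly synchronizing, core transducers with product $TU:=[\mathrm{core}(T*U)]$. $\widetilde{\mathcal O}_n\subseteq\mathcal M_n$ is the submonoid of those $T$ all of whose states $q$ have $h_q$ injective with clopen image; $\mathcal O_n$ is its group of units. $\widetilde{\mathcal L}_n\subseteq\mathcal M_n$ is the submonoid of those $T$ with $|\lambda_T(a,q)|=|a|$ whenever $\pi_T(a,q)=q$; $\mathcal L_n:=\mathcal O_n\cap\widetilde{\mathcal L}_n$. An element of $\widetilde{\mathcal L}_n$ either has no states of incomplete response or is $Z_a$ for some $a\in X_n$. **Annotations.** An annotation of $L\in\widetilde{\mathcal L}_n$ is a map $\alpha:Q_L\to\mathbb Z$ with $(\pi_L(w,q))\alpha=(q)\alpha+|\lambda_L(w,q)|-|w|$ for all $q\in Q_L$, $w\in X_n^*$. $\widetilde{\mathcal{AL}}_n$ is the set of pairs $(L,\alpha)$ where either $L\in\widetilde{\mathcal L}_n$ has no states of incomplete response and $\alpha$ is an annotation of $L$, or $L=Z_a$ ($a\in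 X_n$) and $\alpha$ is the symbol $\infty$ (regarded as assigning $\infty$ to the state; $\infty+i=i+\infty=\infty+\infty=\infty$). It is a monoid under $(L,\alpha)(M,\beta)=(LM,\overline{\alpha+\beta})$, where $\overline{\alpha+\beta}:Q_{LM}\to\mathbb Z$ is $((s,t))\kappa\mapsto(s)\alpha+(t)\beta+|\Lambda(\varepsilon,(s,t))|$ for states $(s,t)$ of $\mathrm{core}(L*M)$ (here $\Lambda$ is computed in, and $\kappa$ is the reduction map of, $\mathrm{core}(L*M)$), and $\overline{\alpha+\beta}=\infty$ if $LM=Z_a$. $\mathcal{AL}_n$ is the set of $(L,\alpha)\in\widetilde{\mathcal{AL}}_n$ with $L\in\mathcal L_n$, a subgroup. **Shift.** $X_n^{\mathbb Z}$ has the product topology; $(x)\sigma_n=y$ with $y_i=x_{i-1}$. $\mathrm{End}(X_n^{\mathbb Z},\sigma_n)$ is the monoid of continuous self-maps of $X_n^{\mathbb Z}$ commuting with $\sigma_n$, $\mathrm{Aut}(X_n^{\mathbb Z},\sigma_n)$ its group of invertible elements. $F_\infty(X_n)$ is the set of maps $f_\infty:X_n^{\mathbb Z}\to X_n^{\mathbb Z}$, $x\mapsto y$, $y_i=(x_{i-m+1}\cdots x_i)f$, where $m\ge0$ and $f:X_n^m\to X_n$. By Curtis–Hedlund–Lyndon every element of $\mathrm{End}(X_n^{\mathbb Z},\sigma_n)$ is $\sigma_n^if$ with $i\in\mathbb Z$, $f\in F_\infty(X_n)$. $\widetilde{\mathcal P}_n$ is the set of weakly minimal, synchronous, strongly synchronizing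 core transducers; for $P\in\widetilde{\mathcal P}_n$ with synchronizing level $k$, $f_P:X_n^{\mathbb Z}\to X_n^{\mathbb Z}$ sends $x$ to $y$ with $y_i=\lambda_P(x_i,q)$, $q$ the state forced by $x_{i-k}\cdots x_{i-1}$. It is known that $P\mapsto f_P$ is a bijection $\widetilde{\mathcal P}_n\to F_\infty(X_n)$. *)

theory Defs
  imports
    "HOL-Library.Omega_Words_Fun"
    "HOL-Library.Extended_Nat"
    "HOL-Algebra.Group"
    "HOL-Analysis.Analysis"
begin

text \<open>
  The alphabet is a type \<open>'a\<close>, which the theorem takes to be finite and linearly
  ordered with at least two elements: up to the unique order isomorphism this is
  \<open>{0, \<dots>, n - 1}\<close> with \<open>n = CARD('a)\<close>. Finite words are lists, right-infinite words are
  functions on \<open>nat\<close>, bi-infinite words are functions on \<open>int\<close>.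
\<close>

section \<open>Transducers\<close>

record ('a, 's) transducer =
  states :: "'s set"
  step :: "'a \<Rightarrow> 's \<Rightarrow> 's"
  outl :: "'a \<Rightarrow> 's \<Rightarrow> 'a list"

definition steps :: "('a, 's) transducer \<Rightarrow> 'a list \<Rightarrow> 's \<Rightarrow> 's" where
  "steps T w q = fold (step T) w q"

primrec outs :: "('a, 's) transducer \<Rightarrow> 'a list \<Rightarrow> 's \<Rightarrow> 'a list" where
  "outs T [] q = []"
| "outs T (x # w) q = outl T x q @ outs T w (step T x q)"

definition transducer :: "('a, 's) transducer \<Rightarrow> bool" where
  "transducer T \<longleftrightarrow>
     finite (states T) \<and> states T \<noteq> {} \<and>
     (\<forall>x. \<forall>q\<in>states T. step T x q \<in> states T) \<and>
     (\<forall>w. \<forall>q\<in>states T. w \<noteq> [] \<and> steps T w q = q \<longrightarrow> outs T w q \<noteq> [])"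

text \<open>
  The map \<open>h\<^sub>q\<close>. The outputs on the finite prefixes of \<open>x\<close> form an increasing chain of
  words of unbounded length, so they determine a unique infinite word.
\<close>

definition state_map :: "('a, 's) transducer \<Rightarrow> 's \<Rightarrow> (nat \<Rightarrow> 'a) \<Rightarrow> (nat \<Rightarrow> 'a)" where
  "state_map T q x =
     (THE y. \<forall>k. \<exists>z. y = outs T (map x [0..<k]) q \<frown> z)"

definition omega_equiv ::
  "('a, 's) transducer \<Rightarrow> 's \<Rightarrow> ('a, 't) transducer \<Rightarrow> 't \<Rightarrow> bool" where
  "omega_equiv T p U q \<longleftrightarrow> state_map T p = state_map U q"

definition weakly_minimal :: "('a, 's) transducer \<Rightarrow> bool" where
  "weakly_minimal T \<longleftrightarrow>
     (\<forall>p\<in>states T. \<forall>q\<in>states T. omega_equiv T p T q \<longrightarrow> p = q)"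

definition strongly_connected :: "('a, 's) transducer \<Rightarrow> bool" where
  "strongly_connected T \<longleftrightarrow> (\<forall>p\<in>states T. \<forall>q\<in>states T. \<exists>w. steps T w p = q)"

definition synchronous :: "('a, 's) transducer \<Rightarrow> bool" where
  "synchronous T \<longleftrightarrow> (\<forall>x. \<forall>q\<in>states T. length (outl T x q) = 1)"


subsection \<open>Incomplete response\<close>

definition common_prefixes :: "('a, 's) transducer \<Rightarrow> 'a list \<Rightarrow> 's \<Rightarrow> 'a list set" where
  "common_prefixes T w q = {u. \<forall>x. \<exists>z. state_map T q (w \<frown> x) = u \<frown> z}"

text \<open>
  \<open>Lambda T w q\<close> is \<open>\<Lambda>(w, q)\<close> when that word is finite, and is used only then;
  \<open>extent T q\<close> is \<open>|\<Lambda>(\<epsilon>, q)|\<close>, possibly infinite.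
\<close>

definition Lambda :: "('a, 's) transducer \<Rightarrow> 'a list \<Rightarrow> 's \<Rightarrow> 'a list" where
  "Lambda T w q = (ARG_MAX length u. u \<in> common_prefixes T w q)"

definition extent :: "('a, 's) transducer \<Rightarrow> 's \<Rightarrow> enat" where
  "extent T q = (SUP u\<in>common_prefixes T [] q. enat (length u))"

definition incomplete_response :: "('a, 's) transducer \<Rightarrow> 's \<Rightarrow> bool" where
  "incomplete_response T q \<longleftrightarrow> extent T q \<noteq> 0"


subsection \<open>Synchronization and the core\<close>

definition sync_level :: "('a, 's) transducer \<Rightarrow> nat \<Rightarrow> bool" where
  "sync_level T k \<longleftrightarrow>
     (\<forall>w. length w = k \<longrightarrow>
        (\<forall>p\<in>states T. \<forall>q\<in>states T. steps T w p = steps T w q))"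

definition strongly_synchronizing :: "('a, 's) transducer \<Rightarrow> bool" where
  "strongly_synchronizing T \<longleftrightarrow> (\<exists>k. sync_level T k)"

definition forced :: "('a, 's) transducer \<Rightarrow> 'a list \<Rightarrow> 's" where
  "forced T w = (THE s. \<forall>q\<in>states T. steps T w q = s)"

text \<open>
  Every synchronizing level gives the same set of forced states, as the state forced by a
  word is forced by each of its long enough suffixes; the union is taken over all levels.
\<close>

definition core :: "('a, 's) transducer \<Rightarrow> ('a, 's) transducer" where
  "core T = T\<lparr>states := {forced T w | w. sync_level T (length w)}\<rparr>"


subsection \<open>Minimal transducers\<close>

definition Z :: "'s \<Rightarrow> 'a list \<Rightarrow> ('a, 's) transducer" where
  "Z s x = \<lparr>states = {s}, step = (\<lambda>_ _. s), outl = (\<lambda>_ _. x)\<rparr>"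

definition is_Z :: "('a, 's) transducer \<Rightarrow> 'a list \<Rightarrow> bool" where
  "is_Z T x \<longleftrightarrow> (\<exists>s. states T = {s} \<and> (\<forall>a. step T a s = s \<and> outl T a s = x))"

definition prime_word :: "'a list \<Rightarrow> bool" where
  "prime_word x \<longleftrightarrow>
     x \<noteq> [] \<and> \<not> (\<exists>u k. length u < length x \<and> x = concat (replicate k u))"

definition least_rotation :: "'a::linorder list \<Rightarrow> bool" where
  "least_rotation x \<longleftrightarrow> (\<forall>m. ord_class.lexordp_eq x (rotate m x))"

definition minimal :: "('a::linorder, 's) transducer \<Rightarrow> bool" where
  "minimal T \<longleftrightarrow>
     weakly_minimal T \<and> strongly_connected T \<and> (\<forall>q\<in>states T. \<not> incomplete_response T q)
     \<or> (\<exists>x. prime_word x \<and> least_rotation x \<and> is_Z T x)"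

definition same_transducer ::
  "('a, 's) transducer \<Rightarrow> ('a, 't) transducer \<Rightarrow> bool" where
  "same_transducer T U \<longleftrightarrow>
     (\<exists>g. bij_betw g (states T) (states U) \<and> (\<forall>q\<in>states T. omega_equiv T q U (g q)))"


section \<open>Reduction\<close>

definition infinite_case :: "('a, 's) transducer \<Rightarrow> bool" where
  "infinite_case C \<longleftrightarrow> (\<exists>q\<in>states C. extent C q = \<infinity>)"

definition root_word :: "('a::linorder, 's) transducer \<Rightarrow> 'a list" where
  "root_word C =
     (THE x. prime_word x \<and> least_rotation x \<and>
        (\<forall>q\<in>states C. \<exists>m. omega_equiv C q (Z () (rotate m x)) ()))"

definition complete_response :: "('a, 's) transducer \<Rightarrow> ('a, 's) transducer" where
  "complete_response C =
     C\<lparr>outl := (\<lambda>x q. drop (length (Lambda C [] q)) (Lambda C [x] q))\<rparr>"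

text \<open>
  The states of the reduced transducer are sets of states of \<open>C\<close>: the
  \<open>\<omega>\<close>-equivalence classes or, in the infinite case, the whole state set as the single state.
\<close>

definition kappa :: "('a, 's) transducer \<Rightarrow> 's \<Rightarrow> 's set" where
  "kappa C q =
     (if infinite_case C then states C
      else {p \<in> states C. omega_equiv (complete_response C) p (complete_response C) q})"

definition reduct :: "('a::linorder, 's) transducer \<Rightarrow> ('a, 's set) transducer" where
  "reduct C =
     (if infinite_case C then Z (states C) (root_word C)
      else \<lparr>states = kappa C ` states C,
            step = (\<lambda>x c. kappa C (step C x (SOME q. q \<in> c))),
            outl = (\<lambda>x c. outl (complete_response C) x (SOME q. q \<in> c))\<rparr>)"

text \<open>The function on the states of \<open>reduct C\<close> given by \<open>kappa C q \<mapsto> v q\<close>.\<close>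

definition descend :: "('a, 's) transducer \<Rightarrow> ('s \<Rightarrow> int) \<Rightarrow> 's set \<Rightarrow> int" where
  "descend C v c = (THE i. \<forall>q\<in>states C. kappa C q = c \<longrightarrow> v q = i)"


section \<open>Monoids of transducers\<close>

definition prod_transducer ::
  "('a, 's) transducer \<Rightarrow> ('a, 't) transducer \<Rightarrow> ('a, 's \<times> 't) transducer" where
  "prod_transducer T U =
     \<lparr>states = states T \<times> states U,
      step = (\<lambda>x (p, q). (step T x p, steps U (outl T x p) q)),
      outl = (\<lambda>x (p, q). outs U (outl T x p) q)\<rparr>"

definition mult_transducer ::
  "('a::linorder, 's) transducer \<Rightarrow> ('a, 't) transducer \<Rightarrow> ('a, ('s \<times> 't) set) transducer"
  where
  "mult_transducer T U = reduct (core (prod_transducer T U))"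

definition is_M :: "('a::linorder, 's) transducer \<Rightarrow> bool" where
  "is_M T \<longleftrightarrow> transducer T \<and> minimal T \<and> strongly_synchronizing T \<and> core T = T"

text \<open>
  Elements of the monoids are transducers up to equality. As state sets are finite, every
  transducer has a representative whose states are natural numbers, so an element is
  represented by the set of all such representatives.
\<close>

definition transducer_class ::
  "('a::linorder, 's) transducer \<Rightarrow> ('a, nat) transducer set" where
  "transducer_class T = {U. is_M U \<and> same_transducer T U}"

definition identity_transducer :: "('a, nat) transducer" where
  "identity_transducer = \<lparr>states = {0}, step = (\<lambda>_ _. 0), outl = (\<lambda>x _. [x])\<rparr>"

definition M_monoid :: "('a::linorder, nat) transducer set monoid" where
  "M_monoid =
     \<lparr>carrier = {transducer_class T | T :: ('a, nat) transducer. is_M T},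
      monoid.mult = (\<lambda>A B. \<Union>T\<in>A. \<Union>U\<in>B. transducer_class (mult_transducer T U)),
      monoid.one = transducer_class identity_transducer\<rparr>"

abbreviation discrete_power :: "('i \<Rightarrow> 'a) topology" where
  "discrete_power \<equiv> product_topology (\<lambda>_. discrete_topology UNIV) UNIV"

definition is_O :: "('a::linorder, 's) transducer \<Rightarrow> bool" where
  "is_O T \<longleftrightarrow> is_M T \<and>
     (\<forall>q\<in>states T. inj (state_map T q) \<and>
        openin discrete_power (range (state_map T q)) \<and>
        closedin discrete_power (range (state_map T q)))"

definition O_tilde :: "('a::linorder, nat) transducer set monoid" where
  "O_tilde =
     M_monoid\<lparr>carrier := {transducer_class T | T :: ('a, nat) transducer. is_O T}\<rparr>"

definition is_L :: "('a::linorder, 's) transducer \<Rightarrow> bool" where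
  "is_L T \<longleftrightarrow> is_M T \<and>
     (\<forall>w. \<forall>q\<in>states T. steps T w q = q \<longrightarrow> length (outs T w q) = length w)"

definition L_tilde :: "('a::linorder, nat) transducer set monoid" where
  "L_tilde =
     M_monoid\<lparr>carrier := {transducer_class T | T :: ('a, nat) transducer. is_L T}\<rparr>"

definition L_set :: "('a::linorder, nat) transducer set set" where
  "L_set = Units O_tilde \<inter> carrier L_tilde"


section \<open>Annotated transducers\<close>

definition annotation :: "('a, 's) transducer \<Rightarrow> ('s \<Rightarrow> int) \<Rightarrow> bool" where
  "annotation T a \<longleftrightarrow>
     (\<forall>w. \<forall>q\<in>states T. a (steps T w q) = a q + int (length (outs T w q)) - int (length w))"

text \<open>The annotation symbol \<open>\<infinity>\<close> is represented by \<^term>\<open>None\<close>.\<close>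

type_synonym ('a, 's) annotated = "('a, 's) transducer \<times> ('s \<Rightarrow> int) option"

fun is_AL :: "('a::linorder, 's) annotated \<Rightarrow> bool" where
  "is_AL (T, Some a) \<longleftrightarrow>
     is_L T \<and> (\<forall>q\<in>states T. \<not> incomplete_response T q) \<and> annotation T a"
| "is_AL (T, None) \<longleftrightarrow> transducer T \<and> (\<exists>b. is_Z T [b])"

fun same_annotated :: "('a, 's) annotated \<Rightarrow> ('a, 't) annotated \<Rightarrow> bool" where
  "same_annotated (T, \<alpha>) (U, \<beta>) \<longleftrightarrow>
     (\<exists>g. bij_betw g (states T) (states U) \<and>
          (\<forall>q\<in>states T. omega_equiv T q U (g q)) \<and>
          (case (\<alpha>, \<beta>) of
             (Some a, Some b) \<Rightarrow> (\<forall>q\<in>states T. a q = b (g q))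
           | (None, None) \<Rightarrow> True
           | _ \<Rightarrow> False))"

definition annotated_class ::
  "('a::linorder, 's) annotated \<Rightarrow> ('a, nat) annotated set" where
  "annotated_class A = {B. is_AL B \<and> same_annotated A B}"

text \<open>
  If \<open>LM\<close> is not of the form \<open>Z\<^sub>a\<close>, then neither is \<open>L\<close> nor \<open>M\<close>, so the last case
  below arises only for \<open>LM = Z\<^sub>a\<close>.
\<close>

fun mult_annotated ::
  "('a::linorder, 's) annotated \<Rightarrow> ('a, 't) annotated \<Rightarrow> ('a, ('s \<times> 't) set) annotated"
  where
  "mult_annotated (T, \<alpha>) (U, \<beta>) =
     (let C = core (prod_transducer T U) in
      (mult_transducer T U,
       if \<exists>b. is_Z (mult_transducer T U) [b] then None
       else (case (\<alpha>, \<beta>) of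
          (Some a, Some b) \<Rightarrow>
            Some (descend C (\<lambda>(s, t). a s + b t + int (length (Lambda C [] (s, t)))))
        | _ \<Rightarrow> None)))"

definition AL_tilde :: "('a::linorder, nat) annotated set monoid" where
  "AL_tilde =
     \<lparr>carrier = {annotated_class A | A :: ('a, nat) annotated. is_AL A},
      monoid.mult = (\<lambda>X Y. \<Union>A\<in>X. \<Union>B\<in>Y. annotated_class (mult_annotated A B)),
      monoid.one = annotated_class (identity_transducer, Some (\<lambda>_. 0))\<rparr>"

definition AL :: "('a::linorder, nat) annotated set monoid" where
  "AL = AL_tilde\<lparr>carrier :=
     {annotated_class (T, \<alpha>) | (T :: ('a, nat) transducer) \<alpha>.
        is_AL (T, \<alpha>) \<and> transducer_class T \<in> L_set}\<rparr>"


section \<open>The full shift\<close>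

definition shift :: "(int \<Rightarrow> 'a) \<Rightarrow> (int \<Rightarrow> 'a)" where
  "shift x = (\<lambda>i. x (i - 1))"

text \<open>Maps act on the right, so the product of \<open>f\<close> and \<open>g\<close> is ``first \<open>f\<close>, then \<open>g\<close>''.\<close>

definition End_shift :: "((int \<Rightarrow> 'a) \<Rightarrow> (int \<Rightarrow> 'a)) monoid" where
  "End_shift =
     \<lparr>carrier = {f. continuous_map discrete_power discrete_power f \<and> f \<circ> shift = shift \<circ> f},
      monoid.mult = (\<lambda>f g. g \<circ> f),
      monoid.one = id\<rparr>"

definition Aut_shift :: "((int \<Rightarrow> 'a) \<Rightarrow> (int \<Rightarrow> 'a)) monoid" where
  "Aut_shift = units_of End_shift"

definition sliding :: "nat \<Rightarrow> ('a list \<Rightarrow> 'a) \<Rightarrow> (int \<Rightarrow> 'a) \<Rightarrow> (int \<Rightarrow> 'a)" where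
  "sliding m f x = (\<lambda>i. f (map x [i - int m + 1..i]))"

definition F_infinity :: "((int \<Rightarrow> 'a) \<Rightarrow> (int \<Rightarrow> 'a)) set" where
  "F_infinity = {sliding m f | m f. True}"

definition is_P :: "('a, 's) transducer \<Rightarrow> bool" where
  "is_P P \<longleftrightarrow> transducer P \<and> weakly_minimal P \<and> synchronous P \<and>
     strongly_synchronizing P \<and> core P = P"

text \<open>The map does not depend on the synchronizing level; the least one is used.\<close>

definition P_map :: "('a, 's) transducer \<Rightarrow> (int \<Rightarrow> 'a) \<Rightarrow> (int \<Rightarrow> 'a)" where
  "P_map P x =
     (let k = (LEAST k. sync_level P k) in
      (\<lambda>i. hd (outl P (x i) (forced P (map x [i - int k..i - 1])))))"

definition annotated_of :: "int \<Rightarrow> ('a::linorder, 's) transducer \<Rightarrow> ('a, 's set) annotated"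
  where
  "annotated_of i P =
     (reduct P,
      if \<exists>b. is_Z (reduct P) [b] then None
      else Some (descend P (\<lambda>q. i + int (length (Lambda P [] q)))))"

text \<open>
  The union collects the images given by all ways of writing \<open>g\<close> as \<open>\<sigma>\<^sup>i f\<close>; that they
  all agree is part of the theorem.
\<close>

definition phi ::
  "((int \<Rightarrow> 'a::linorder) \<Rightarrow> (int \<Rightarrow> 'a)) \<Rightarrow> ('a, nat) annotated set" where
  "phi g = \<Union>{annotated_class (annotated_of i P) | i f (P :: ('a, nat) transducer).
     f \<in> F_infinity \<and> is_P P \<and> P_map P = f \<and>
     g = (shift [^]\<^bsub>End_shift\<^esub> i) \<otimes>\<^bsub>End_shift\<^esub> f}"

end

theory Submission
  imports Defs
begin

text \<open>
  Every annotated transducer \<open>(T, v)\<close> realizes an endomorphism \<open>g\<close> of the full shift: on a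
  bi-infinite word \<open>x\<close> it reads the letters from position \<open>i\<close> on in the state \<open>q\<close> forced by the
  letters before \<open>i\<close> and writes its output from position \<open>i + v q\<close> on; the annotation
  equation says that these outputs fit together. Reduction does not change the endomorphism,
  because adding \<open>|\<Lambda>(\<epsilon>, q)|\<close> to \<open>v q\<close> accounts for the deleted prefixes, and the product of
  transducers realizes the composition. Conversely, \<open>g\<close> determines its annotated transducer
  without incomplete response: \<open>i + v q\<close> is the first position of \<open>g x\<close> that depends on the letters
  of \<open>x\<close> from position \<open>i\<close> on, and the state map of \<open>q\<close> is this dependence. Hence \<open>phi g\<close> is the set
  of all annotated transducers realizing \<open>g\<close>, and both monoids are identified.

  For the units, the image of a state map of an invertible \<open>g\<close> is clopen because the inverse has
  a finite window. If conversely \<open>T\<close> is inverted by \<open>U\<close> among the transducers, comparing output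
  lengths on loops shows that \<open>U\<close> has an annotation, and its endomorphism inverts that of \<open>T\<close> up
  to a power of the shift.
\<close>

section \<open>Transducers and their state maps\<close>

text \<open>The definitions are full of choices: an element is a set of representatives, a product
  is a union over all pairs of them, and \<open>phi\<close> is a union over all decompositions.
  Realization removes these choices at once: when each such set consists of all annotated
  transducers realizing one endomorphism, well-definedness, the homomorphism property and the monoid
  laws of \<open>AL_tilde\<close> follow from composition of maps. The constant endomorphisms are
  split off throughout: no position of their image depends on the input, so nothing fixes an integer
  annotation, and the symbol for infinity takes its place. For the units the obstacle is that
  \<open>L_set\<close> speaks of bare transducers. An inverse in \<open>O_tilde\<close> comes
  without an annotation and is not known to lie in \<open>L_tilde\<close>; and a product equal to
  the identity transducer still leaves its displacement open.\<close>

lemma steps_simps [simp]: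
  "steps T [] q = q" "steps T (x # w) q = steps T w (step T x q)"
  by (simp_all add: steps_def)

lemma steps_append [simp]: "steps T (u @ v) q = steps T v (steps T u q)"
  by (simp add: steps_def)

lemma outs_append [simp]: "outs T (u @ v) q = outs T u q @ outs T v (steps T u q)"
  by (induction u arbitrary: q) auto

lemma transducerD:
  assumes "transducer T"
  shows "finite (states T)" "states T \<noteq> {}"
    "q \<in> states T \<Longrightarrow> step T x q \<in> states T"
    "q \<in> states T \<Longrightarrow> w \<noteq> [] \<Longrightarrow> steps T w q = q \<Longrightarrow> outs T w q \<noteq> []"
  using assms unfolding transducer_def by blast+

lemma steps_closed: "transducer T \<Longrightarrow> q \<in> states T \<Longrightarrow> steps T w q \<in> states T"
  by (induction w arbitrary: q) (auto dest: transducerD)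

text \<open>By pigeonhole two prefixes of \<open>w\<close> lead to the same state; the word between
  them labels a loop, whose output is nonempty by the standing assumption.\<close>

lemma outs_nonempty:
  assumes T: "transducer T" and q: "q \<in> states T" and len: "card (states T) \<le> length w"
  shows "outs T w q \<noteq> []"
proof -
  let ?f = "\<lambda>i. steps T (take i w) q"
  have "?f ` {0..length w} \<subseteq> states T"
    using steps_closed[OF T q] by auto
  moreover have "card (states T) < card {0..length w}" using len by simp
  ultimately have "\<not> inj_on ?f {0..length w}"
    using transducerD(1)[OF T] card_inj_on_le[of ?f "{0..length w}" "states T"] by auto
  then obtain i j where ij: "i < j" "j \<le> length w" "?f i = ?f j"
    unfolding inj_on_def by (metis atLeastAtMost_iff linorder_neqE_nat)
  define u where "u = drop i (take j w)"
  have w: "take j w = take i w @ u"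
    unfolding u_def using ij by (metis append_take_drop_id less_imp_le_nat min.absorb1 take_take)
  have "u \<noteq> []" using ij by (auto simp: u_def)
  moreover have "steps T u (?f i) = ?f i" using ij w by (metis steps_append)
  ultimately have "outs T u (?f i) \<noteq> []"
    using transducerD(4)[OF T] steps_closed[OF T q] by blast
  moreover have "outs T w q = outs T (take i w) q @ outs T u (?f i) @ outs T (drop j w) (?f j)"
    by (metis append.assoc append_take_drop_id outs_append w)
  ultimately show ?thesis by simp
qed

text \<open>Each block of \<open>card (states T)\<close> letters writes at least one letter. This
  linear bound gives infinite images, a modulus of continuity for state maps and, later, a
  synchronizing level for products.\<close>

lemma outs_length:
  assumes T: "transducer T"
  shows "q \<in> states T \<Longrightarrow> n * card (states T) \<le> length w \<Longrightarrow> n \<le> length (outs T w q)"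
proof (induction n arbitrary: q w)
  case (Suc n)
  let ?c = "card (states T)"
  have w: "w = take ?c w @ drop ?c w" by simp
  have len: "length w \<ge> ?c" using Suc.prems by simp
  have "outs T (take ?c w) q \<noteq> []"
    using Suc.prems len by (intro outs_nonempty[OF T]) auto
  then have 1: "1 \<le> length (outs T (take ?c w) q)" by (cases "outs T (take ?c w) q") auto
  have "n \<le> length (outs T (drop ?c w) (steps T (take ?c w) q))"
    using Suc.prems len by (intro Suc.IH steps_closed[OF T]) (auto simp: algebra_simps)
  then have "Suc n \<le> length (outs T (take ?c w @ drop ?c w) q)"
    using 1 unfolding outs_append by (simp only: length_append)
  then show ?case by simp
qed simp

lemma conc_eq_nth: "y = w \<frown> z \<Longrightarrow> n < length w \<Longrightarrow> y n = w ! n"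
  by simp

lemma conc_exI: "(\<And>n. n < length w \<Longrightarrow> y n = w ! n) \<Longrightarrow> \<exists>z. y = w \<frown> z"
  by (rule exI[of _ "suffix (length w) y"]) (auto simp: conc_def)

lemma outs_prefix_mono:
  assumes "k \<le> k'"
  shows "\<exists>v. outs T (prefix k' x) q = outs T (prefix k x) q @ v"
proof -
  have "prefix k' x = prefix k x @ subsequence x k k'"
    using subsequence_append[where i = k and j = "k' - k" and w = x] assms by simp
  then show ?thesis by simp
qed

lemma outs_prefix_nth:
  assumes "n < length (outs T (prefix k x) q)" "n < length (outs T (prefix k' x) q)"
  shows "outs T (prefix k x) q ! n = outs T (prefix k' x) q ! n"
  using assms
proof (induction k k' rule: linorder_wlog)
  case (le k k')
  then show ?case using outs_prefix_mono[of k k' T x q] by (auto simp: nth_append)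
qed simp

lemma
  assumes T: "transducer T" and q: "q \<in> states T"
  shows state_map_prefix_ex: "\<exists>z. state_map T q x = outs T (prefix k x) q \<frown> z"
    and state_map_eqI:
      "(\<And>k. \<exists>z. y = outs T (prefix k x) q \<frown> z) \<Longrightarrow> state_map T q x = y"
proof -
  let ?K = "\<lambda>n. Suc n * card (states T)"
  let ?P = "\<lambda>y. \<forall>k. \<exists>z. y = outs T (prefix k x) q \<frown> z"
  have long: "n < length (outs T (prefix (?K n) x) q)" for n
    using outs_length[OF T q, of "Suc n" "prefix (?K n) x"] by auto
  define y0 where "y0 = (\<lambda>n. outs T (prefix (?K n) x) q ! n)"
  have 1: "?P y0"
  proof (intro allI conc_exI)
    fix k n assume "n < length (outs T (prefix k x) q)"
    from outs_prefix_nth[OF long this] show "y0 n = outs T (prefix k x) q ! n"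
      by (simp only: y0_def)
  qed
  have uniq: "y = y0" if P: "?P y" for y
  proof
    fix n
    obtain z where "y = outs T (prefix (?K n) x) q \<frown> z" using P by blast
    from conc_eq_nth[OF this long] show "y n = y0 n" by (simp add: y0_def)
  qed
  have eq: "state_map T q x = (THE y. ?P y)"
    unfolding state_map_def subsequence_def ..
  have sm: "state_map T q x = y0" unfolding eq using 1 uniq by (intro the_equality)
  show "\<exists>z. state_map T q x = outs T (prefix k x) q \<frown> z" using 1 sm by blast
  show "state_map T q x = y" if "\<And>k. \<exists>z. y = outs T (prefix k x) q \<frown> z"
    using uniq[of y] that sm by blast
qed

lemma state_map_conc:
  assumes T: "transducer T" and q: "q \<in> states T"
  shows "state_map T q (w \<frown> x) = outs T w q \<frown> state_map T (steps T w q) x"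
proof (rule state_map_eqI[OF T q])
  fix k
  show "\<exists>z. outs T w q \<frown> state_map T (steps T w q) x = outs T (prefix k (w \<frown> x)) q \<frown> z"
  proof (cases "k \<le> length w")
    case True
    then have "outs T w q = outs T (prefix k (w \<frown> x)) q @ outs T (drop k w) (steps T (take k w) q)"
      by (metis append_take_drop_id outs_append prefix_conc_fst)
    then show ?thesis by (metis conc_conc)
  next
    case False
    obtain z where "state_map T (steps T w q) x =
        outs T (prefix (k - length w) x) (steps T w q) \<frown> z"
      using state_map_prefix_ex[OF T steps_closed[OF T q]] by blast
    with False show ?thesis by auto
  qed
qed

lemma state_map_local:
  assumes T: "transducer T" and q: "q \<in> states T"
    and eq: "prefix k x = prefix k x'" and k: "Suc n * card (states T) \<le> k"
  shows "state_map T q x n = state_map T q x' n"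
proof -
  have "n < length (outs T (prefix k x) q)"
    using outs_length[OF T q, of "Suc n" "prefix k x"] k by auto
  then show ?thesis
    using state_map_prefix_ex[OF T q, of x k] state_map_prefix_ex[OF T q, of x' k] eq conc_eq_nth
    by metis
qed

text \<open>A nonempty common prefix exists iff one of length 1 does. This form about first letters
  replaces the supremum in \<open>extent\<close> in the arguments about complete response.\<close>

lemma incomplete_response_iff:
  "incomplete_response T q \<longleftrightarrow> (\<exists>c. \<forall>x. state_map T q x 0 = c)"
proof -
  have "incomplete_response T q \<longleftrightarrow> (\<exists>u \<in> common_prefixes T [] q. u \<noteq> [])"
  proof -
    have "extent T q = 0 \<longleftrightarrow> (\<forall>u \<in> common_prefixes T [] q. enat (length u) = 0)"
      unfolding extent_def by (auto simp: bot_enat_def[symmetric] SUP_bot_conv)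
    then show ?thesis by (auto simp: incomplete_response_def zero_enat_def)
  qed
  also have "\<dots> \<longleftrightarrow> (\<exists>c. \<forall>x. state_map T q x 0 = c)"
  proof
    assume "\<exists>u \<in> common_prefixes T [] q. u \<noteq> []"
    then obtain u where u: "\<forall>x. \<exists>z. state_map T q x = u \<frown> z" "u \<noteq> []"
      by (auto simp: common_prefixes_def)
    then have "\<forall>x. state_map T q x 0 = u ! 0" using conc_eq_nth by (metis length_greater_0_conv)
    then show "\<exists>c. \<forall>x. state_map T q x 0 = c" by blast
  next
    assume "\<exists>c. \<forall>x. state_map T q x 0 = c"
    then obtain c where "\<forall>x. state_map T q x 0 = c" by blast
    then have "[c] \<in> common_prefixes T [] q"
      by (auto simp: common_prefixes_def simp del: build_cons intro: conc_exI)
    then show "\<exists>u \<in> common_prefixes T [] q. u \<noteq> []" by blast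
  qed
  finally show ?thesis .
qed

definition full_response :: "('a, 's) transducer \<Rightarrow> bool" where
  "full_response T \<longleftrightarrow> (\<forall>q\<in>states T. \<not> incomplete_response T q)"

text \<open>If \<open>v\<close> were longer than \<open>u\<close>, its letter at index
  \<open>length u\<close> would be the first letter of every \<open>f x\<close>.\<close>

lemma full_response_outs_aux:
  assumes "\<And>x. u \<frown> f x = v \<frown> h x" and "\<nexists>c. \<forall>x. f x (0::nat) = c"
  shows "length v \<le> length u"
proof (rule ccontr)
  assume "\<not> ?thesis"
  then have "f x 0 = v ! length u" for x
    using fun_cong[OF assms(1)[of x], of "length u"] by simp
  with assms(2) show False by blast
qed

text \<open>
  In the absence of incomplete response, the output on \<open>w\<close> is the longest common prefix of
  the images of \<open>w \<frown> x\<close>, hence determined by the state map.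
\<close>

lemma full_response_outs_eq:
  assumes T: "transducer T" "full_response T" and U: "transducer U" "full_response U"
    and p: "p \<in> states T" and q: "q \<in> states U" and eq: "omega_equiv T p U q"
  shows "outs T w p = outs U w q" "omega_equiv T (steps T w p) U (steps U w q)"
proof -
  let ?f = "state_map T (steps T w p)" and ?h = "state_map U (steps U w q)"
  have eq': "outs T w p \<frown> ?f x = outs U w q \<frown> ?h x" for x
    using state_map_conc[OF T(1) p, of w x] state_map_conc[OF U(1) q, of w x] eq
    by (simp add: omega_equiv_def)
  have "\<nexists>c. \<forall>x. ?f x 0 = c" "\<nexists>c. \<forall>x. ?h x 0 = c"
    using T(2) U(2) steps_closed[OF T(1) p] steps_closed[OF U(1) q]
    unfolding full_response_def incomplete_response_iff by blast+
  then have "length (outs T w p) = length (outs U w q)"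
    using full_response_outs_aux[of "outs T w p" ?f "outs U w q" ?h]
      full_response_outs_aux[of "outs U w q" ?h "outs T w p" ?f] eq' by (metis le_antisym)
  from eq'[unfolded concat_eq[OF this]]
  show "outs T w p = outs U w q" "omega_equiv T (steps T w p) U (steps U w q)"
    unfolding omega_equiv_def by blast+
qed

section \<open>Synchronization along bi-infinite words\<close>

lemma sync_level_mono:
  assumes T: "transducer T" and k: "sync_level T k" "k \<le> m"
  shows "sync_level T m"
  unfolding sync_level_def
proof (intro allI impI ballI)
  fix w :: "'a list" and p q
  assume w: "length w = m" and pq: "p \<in> states T" "q \<in> states T"
  have "length (drop (m - k) w) = k" using w k by simp
  then have "steps T (drop (m - k) w) (steps T (take (m - k) w) p) =
      steps T (drop (m - k) w) (steps T (take (m - k) w) q)"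
    using k(1) pq steps_closed[OF T] unfolding sync_level_def by blast
  then show "steps T w p = steps T w q" by (metis append_take_drop_id steps_append)
qed

lemma forced_eq: "sync_level T (length w) \<Longrightarrow> q \<in> states T \<Longrightarrow> forced T w = steps T w q"
  unfolding forced_def sync_level_def by (rule the_equality) metis+

lemma core_eq_iff: "core T = T \<longleftrightarrow> states T = {forced T w | w. sync_level T (length w)}"
  unfolding core_def by (cases T) auto

text \<open>The part of \<open>is_M\<close> that does not mention minimality; it already holds for
  products and block transducers before any reduction.\<close>

definition sync_core :: "('a, 's) transducer \<Rightarrow> bool" where
  "sync_core T \<longleftrightarrow> transducer T \<and> strongly_synchronizing T \<and> core T = T"

lemma sync_coreD:
  assumes "sync_core T"
  shows "transducer T" "\<exists>k. sync_level T k"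
    "q \<in> states T \<Longrightarrow> \<exists>w. sync_level T (length w) \<and> q = forced T w"
  using assms unfolding sync_core_def strongly_synchronizing_def core_eq_iff by auto

lemma sync_coreI:
  assumes "transducer T" "sync_level T k"
    and "\<And>q. q \<in> states T \<Longrightarrow> \<exists>w. sync_level T (length w) \<and> q = forced T w"
  shows "sync_core T"
proof -
  obtain q where "q \<in> states T" using transducerD(2)[OF assms(1)] by blast
  then have "states T = {forced T w | w. sync_level T (length w)}"
    using assms(3) forced_eq[of T _ q] steps_closed[OF assms(1)] by auto
  then show ?thesis
    using assms unfolding sync_core_def strongly_synchronizing_def core_eq_iff by blast
qed

lemma strongly_connected_sync_core: "sync_core T \<Longrightarrow> strongly_connected T"
  unfolding strongly_connected_def by (metis forced_eq sync_coreD(3))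

section \<open>Bi-infinite words and the states forced by their pasts\<close>

definition segment :: "(int \<Rightarrow> 'a) \<Rightarrow> int \<Rightarrow> int \<Rightarrow> 'a list" where
  "segment x i j = map x [i..j - 1]"

definition future :: "(int \<Rightarrow> 'a) \<Rightarrow> int \<Rightarrow> nat \<Rightarrow> 'a" where
  "future x i = (\<lambda>n. x (i + int n))"

text \<open>Splicing a new future onto a past keeps the state forced at position \<open>i\<close>,
  so varying \<open>y\<close> probes the state map of that state.\<close>

definition glue :: "int \<Rightarrow> (int \<Rightarrow> 'a) \<Rightarrow> (nat \<Rightarrow> 'a) \<Rightarrow> int \<Rightarrow> 'a" where
  "glue i x y = (\<lambda>j. if j < i then x j else y (nat (j - i)))"

definition past_state :: "('a, 's) transducer \<Rightarrow> (int \<Rightarrow> 'a) \<Rightarrow> int \<Rightarrow> 's" where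
  "past_state T x i = forced T (segment x (i - int (LEAST k. sync_level T k)) i)"

lemma length_segment [simp]: "length (segment x i j) = nat (j - i)"
  by (simp add: segment_def)

lemma nth_segment [simp]: "n < nat (j - i) \<Longrightarrow> segment x i j ! n = x (i + int n)"
  by (simp add: segment_def)

lemma segment_append: "i \<le> j \<Longrightarrow> j \<le> k \<Longrightarrow> segment x i k = segment x i j @ segment x j k"
  by (rule nth_equalityI) (auto simp: nth_append intro!: arg_cong[of _ _ x])

lemma segment_cong: "(\<And>l. i \<le> l \<Longrightarrow> l < j \<Longrightarrow> x l = y l) \<Longrightarrow> segment x i j = segment y i j"
  by (auto simp: segment_def)

lemma segment_prefix: "segment x i j = prefix (nat (j - i)) (future x i)"
  by (rule nth_equalityI) (auto simp: future_def)

lemma segment_empty [simp]: "segment x i i = []"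
  by (simp add: segment_def)

lemma segment_single [simp]: "segment x i (i + 1) = [x i]"
  by (simp add: segment_def)

lemma future_segment: "i \<le> j \<Longrightarrow> future x i = segment x i j \<frown> future x j"
  by (rule ext) (auto simp: conc_def future_def intro!: arg_cong[of _ _ x])

lemma future_glue [simp]: "future (glue i x y) i = y"
  by (auto simp: future_def glue_def)

lemma glue_past [simp]: "j < i \<Longrightarrow> glue i x y j = x j"
  by (simp add: glue_def)

lemma glue_id: "(\<And>j. j < i \<Longrightarrow> x j = z j) \<Longrightarrow> glue i x (future z i) = z"
  by (auto simp: glue_def future_def)

lemma segment_word: "segment (glue i x (w \<frown> z)) i (i + int (length w)) = w"
  by (rule nth_equalityI) (auto simp: glue_def)

text \<open>In a window longer than the least level, the additional letters on the left only change
  the state from which the last letters start, and these force the same state from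
  everywhere.\<close>

lemma past_state_eq:
  assumes T: "transducer T" and k: "sync_level T k" and q: "q \<in> states T"
  shows "past_state T x i = steps T (segment x (i - int k) i) q"
proof -
  let ?l = "LEAST k. sync_level T k"
  have l: "sync_level T ?l" "?l \<le> k" using k by (auto intro: LeastI Least_le)
  have "segment x (i - int k) i = segment x (i - int k) (i - int ?l) @ segment x (i - int ?l) i"
    using l by (intro segment_append) auto
  moreover have "past_state T x i =
      steps T (segment x (i - int ?l) i) (steps T (segment x (i - int k) (i - int ?l)) q)"
    unfolding past_state_def using l steps_closed[OF T q] by (intro forced_eq) auto
  ultimately show ?thesis by simp
qed

lemma sync_coreE:
  assumes "sync_core T"
  obtains q k where "q \<in> states T" "sync_level T k"
  using assms transducerD(2) sync_coreD by (metis ex_in_conv)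

lemma past_state_closed:
  assumes "sync_core T"
  shows "past_state T x i \<in> states T"
proof (rule sync_coreE[OF assms])
  fix q k assume "q \<in> states T" "sync_level T k"
  with past_state_eq[OF sync_coreD(1)[OF assms] this(2,1)] show ?thesis
    using steps_closed[OF sync_coreD(1)[OF assms]] by simp
qed

lemma past_state_steps:
  assumes T: "sync_core T" and "i \<le> j"
  shows "past_state T x j = steps T (segment x i j) (past_state T x i)"
proof -
  obtain q k where q: "q \<in> states T" "sync_level T k"
    using sync_coreE[OF T] by blast
  \<comment> \<open>Counted back from \<open>j\<close>, this window starts at \<open>i - k\<close>,
    exactly where the window of length \<open>k\<close> for position \<open>i\<close>
    starts.\<close>
  let ?m = "k + nat (j - i)"
  have "sync_level T ?m" using sync_level_mono q sync_coreD(1)[OF T] by (metis le_add1)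
  then have "past_state T x j = steps T (segment x (j - int ?m) j) q"
    by (intro past_state_eq q sync_coreD T)
  also have "segment x (j - int ?m) j = segment x (i - int k) i @ segment x i j"
    using segment_append[of "i - int k" i j x] assms(2) by (auto simp: algebra_simps)
  also have "steps T \<dots> q = steps T (segment x i j) (past_state T x i)"
    using past_state_eq[OF sync_coreD(1)[OF T] q(2,1)] by simp
  finally show ?thesis .
qed

lemma past_state_cong: "(\<And>j. j < i \<Longrightarrow> x j = y j) \<Longrightarrow> past_state T x i = past_state T y i"
  unfolding past_state_def by (metis segment_cong)

lemma past_state_glue [simp]: "past_state T (glue i x y) i = past_state T x i"
  by (rule past_state_cong) simp

text \<open>In a core transducer \<open>q\<close> is forced by some word; that word is written
  directly before position \<open>i\<close>.\<close>

lemma past_state_ex: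
  assumes T: "sync_core T" and q: "q \<in> states T"
  shows "\<exists>x. past_state T x i = q"
proof -
  obtain w where w: "sync_level T (length w)" "q = forced T w"
    using sync_coreD(3)[OF T q] by blast
  define x where "x = glue (i - int (length w)) undefined (w \<frown> undefined)"
  have "segment x (i - int (length w)) i = w"
    using segment_word[of "i - int (length w)" undefined w undefined] unfolding x_def by simp
  then have "past_state T x i = steps T w q"
    using past_state_eq[OF sync_coreD(1)[OF T] w(1) q] by simp
  also have "\<dots> = q" using w(2) forced_eq[OF w(1) q] by metis
  finally show ?thesis by blast
qed

lemma past_state_shift:
  "past_state T (\<lambda>j. x (j - d)) i = past_state T x (i - d)"
proof -
  have "segment (\<lambda>j. x (j - d)) (i - k) i = segment x (i - d - k) (i - d)" for k
    by (rule nth_equalityI) (auto intro!: arg_cong[of _ _ x])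
  then show ?thesis by (simp add: past_state_def)
qed


section \<open>Endomorphisms of the full shift\<close>

definition finitary :: "(('i \<Rightarrow> 'a) \<Rightarrow> 'b) \<Rightarrow> bool" where
  "finitary F \<longleftrightarrow> (\<exists>J. finite J \<and> (\<forall>x y. (\<forall>i\<in>J. x i = y i) \<longrightarrow> F x = F y))"

lemma finitary_continuous_map:
  assumes "finitary F"
  shows "continuous_map discrete_power (discrete_topology UNIV) F"
proof -
  obtain J where J: "finite J" "\<And>x y. (\<forall>i\<in>J. x i = y i) \<Longrightarrow> F x = F y"
    using assms unfolding finitary_def by blast
  have "openin discrete_power {x. F x \<in> U}" for U
    unfolding openin_product_topology_alt
  proof (intro ballI)
    fix x assume x: "x \<in> {x. F x \<in> U}"
    let ?V = "\<lambda>i. if i \<in> J then {x i} else UNIV"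
    have "{i \<in> UNIV. ?V i \<noteq> topspace (discrete_topology UNIV)} \<subseteq> J" by auto
    then have "finite {i \<in> UNIV. ?V i \<noteq> topspace (discrete_topology UNIV)}"
      using J(1) finite_subset by blast
    moreover have "Pi\<^sub>E UNIV ?V \<subseteq> {x. F x \<in> U}"
    proof
      fix y assume "y \<in> Pi\<^sub>E UNIV ?V"
      then have "\<forall>i\<in>J. y i = x i" by (auto simp: PiE_iff split: if_splits)
      then show "y \<in> {x. F x \<in> U}" using J(2)[of y x] x by simp
    qed
    moreover have "x \<in> Pi\<^sub>E UNIV ?V" by auto
    ultimately show "\<exists>V. finite {i \<in> UNIV. V i \<noteq> topspace (discrete_topology UNIV)} \<and>
        (\<forall>i\<in>UNIV. openin (discrete_topology UNIV) (V i)) \<and> x \<in> Pi\<^sub>E UNIV V \<and>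
        Pi\<^sub>E UNIV V \<subseteq> {x. F x \<in> U}"
      by (intro exI[of _ ?V]) simp
  qed
  then show ?thesis by (simp add: continuous_map_def)
qed

text \<open>Compactness, and with it the finite alphabet, enters here. Around each word there is a
  cylinder on which \<open>F\<close> is constant; finitely many of them cover the space, and the
  coordinates that these restrict form the required finite set.\<close>

lemma continuous_map_finitary:
  fixes F :: "('i \<Rightarrow> 'a::finite) \<Rightarrow> 'b"
  assumes "continuous_map discrete_power (discrete_topology UNIV) F"
  shows "finitary F"
proof -
  have "\<exists>V. finite {i. V i \<noteq> UNIV} \<and> x \<in> Pi\<^sub>E UNIV V \<and> Pi\<^sub>E UNIV V \<subseteq> {y. F y = F x}" for x
  proof -
    have "\<forall>U. openin discrete_power {y. F y \<in> U}"
      using assms unfolding continuous_map_def by simp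
    then have "openin discrete_power {y. F y \<in> {F x}}" by blast
    then show ?thesis
      unfolding openin_product_topology_alt by simp
    qed
  then obtain V where V: "\<And>x. finite {i. V x i \<noteq> UNIV}" "\<And>x. x \<in> Pi\<^sub>E UNIV (V x)"
    "\<And>x. Pi\<^sub>E UNIV (V x) \<subseteq> {y. F y = F x}" by metis
  have comp: "compact_space (discrete_power :: ('i \<Rightarrow> 'a) topology)"
    by (simp add: compact_space_product_topology compact_space_discrete_topology)
  have "openin (discrete_power :: ('i \<Rightarrow> 'a) topology) (Pi\<^sub>E UNIV (V x))" for x
    using V(1)[of x] by (subst openin_PiE_gen) simp
  then have "\<forall>U \<in> range (\<lambda>x. Pi\<^sub>E UNIV (V x)). openin discrete_power U" by blast
  moreover have "topspace (discrete_power :: ('i \<Rightarrow> 'a) topology) \<subseteq> \<Union> (range (\<lambda>x. Pi\<^sub>E UNIV (V x)))"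
    using V(2) by blast
  ultimately obtain \<F> where F: "finite \<F>" "\<F> \<subseteq> range (\<lambda>x. Pi\<^sub>E UNIV (V x))"
      "topspace (discrete_power :: ('i \<Rightarrow> 'a) topology) \<subseteq> \<Union> \<F>"
    using comp[unfolded compact_space_alt] by meson
  obtain K where K: "finite K" "\<F> = (\<lambda>x. Pi\<^sub>E UNIV (V x)) ` K"
    using finite_subset_image[OF F(1,2)] by blast
  let ?J = "\<Union>x\<in>K. {i. V x i \<noteq> UNIV}"
  have "F y = F z" if eq: "\<forall>i\<in>?J. y i = z i" for y z
  proof -
    have "y \<in> topspace (discrete_power :: ('i \<Rightarrow> 'a) topology)" by simp
    then obtain x where x: "x \<in> K" "y \<in> Pi\<^sub>E UNIV (V x)"
      using F(3) K(2) by blast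
    have "z i \<in> V x i" for i
    proof (cases "V x i = UNIV")
      case False
      then have "y i = z i" using eq x(1) by blast
      with x(2) show ?thesis by (metis PiE_mem UNIV_I)
    qed simp
    then have "z \<in> Pi\<^sub>E UNIV (V x)" by auto
    with x(2) V(3)[of x] have "F y = F x" "F z = F x" by blast+
    then show ?thesis by simp
  qed
  moreover have "finite ?J" using K(1) V(1) by blast
  ultimately show ?thesis unfolding finitary_def by blast
qed

lemma End_shift_iff:
  fixes g :: "(int \<Rightarrow> 'a::finite) \<Rightarrow> (int \<Rightarrow> 'a)"
  shows "g \<in> carrier End_shift \<longleftrightarrow> (\<forall>j. finitary (\<lambda>x. g x j)) \<and> g \<circ> shift = shift \<circ> g"
proof -
  have "continuous_map discrete_power discrete_power g \<longleftrightarrow> (\<forall>j. finitary (\<lambda>x. g x j))"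
    unfolding continuous_map_componentwise_UNIV
    using finitary_continuous_map continuous_map_finitary by blast
  then show ?thesis by (simp add: End_shift_def)
qed

definition shift_by :: "int \<Rightarrow> (int \<Rightarrow> 'a) \<Rightarrow> int \<Rightarrow> 'a" where
  "shift_by d x = (\<lambda>j. x (j - d))"

lemma shift_by_0 [simp]: "shift_by 0 = id"
  by (simp add: shift_by_def fun_eq_iff)

lemma shift_by_add: "shift_by d \<circ> shift_by e = shift_by (d + e)"
  by (auto simp: shift_by_def fun_eq_iff algebra_simps)

lemma shift_eq_shift_by: "shift = shift_by 1"
  by (simp add: shift_by_def shift_def fun_eq_iff)

lemma End_shift_commute:
  assumes "g \<in> carrier End_shift"
  shows "g (shift_by d x) = shift_by d (g x)"
proof -
  have 1: "g (shift_by 1 y) = shift_by 1 (g y)" for y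
    using assms by (simp add: End_shift_def shift_eq_shift_by fun_eq_iff)
  have add: "shift_by d (shift_by e y) = shift_by (d + e) y" for d e and y :: "int \<Rightarrow> 'a"
    using shift_by_add[of d e] by (metis comp_apply)
  have m1: "g (shift_by (-1) y) = shift_by (-1) (g y)" for y
    using 1[of "shift_by (-1) y"] by (metis add add.left_inverse add.right_inverse id_apply shift_by_0)
  show ?thesis
  proof (induction d arbitrary: x rule: int_induct[where k = 0])
    case (step1 d)
    then show ?case using 1 by (metis add)
  next
    case (step2 d)
    then show ?case using m1 by (metis add diff_conv_add_uminus)
  qed simp
qed

text \<open>The Curtis-Hedlund-Lyndon argument: the letter at 0 depends on finitely many positions,
  which lie in a symmetric window, and commutation with the shift carries this window to every
  \<open>j\<close>.\<close>

lemma End_shift_window: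
  fixes g :: "(int \<Rightarrow> 'a::finite) \<Rightarrow> (int \<Rightarrow> 'a)"
  assumes g: "g \<in> carrier End_shift"
  obtains m :: nat where "\<And>x y j. (\<And>i. \<bar>i - j\<bar> \<le> int m \<Longrightarrow> x i = y i) \<Longrightarrow> g x j = g y j"
proof -
  obtain J where J: "finite J" "\<And>x y. (\<forall>i\<in>J. x i = y i) \<Longrightarrow> g x 0 = g y 0"
    using g unfolding End_shift_iff finitary_def by blast
  obtain m where m: "\<And>i. i \<in> J \<Longrightarrow> nat \<bar>i\<bar> \<le> m"
    using finite_nat_set_iff_bounded_le[of "(\<lambda>i. nat \<bar>i\<bar>) ` J"] J(1) by auto
  show thesis
  proof (rule that[of m])
    fix x y :: "int \<Rightarrow> 'a" and j assume eq: "\<And>i. \<bar>i - j\<bar> \<le> int m \<Longrightarrow> x i = y i"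
    have "g (shift_by (-j) x) 0 = g (shift_by (-j) y) 0"
    proof (rule J(2), rule ballI)
      fix i assume "i \<in> J"
      from m[OF this] have "\<bar>(i + j) - j\<bar> \<le> int m" by linarith
      from eq[OF this] show "shift_by (- j) x i = shift_by (- j) y i" by (simp add: shift_by_def)
    qed
    then show "g x j = g y j"
      unfolding End_shift_commute[OF g] by (simp add: shift_by_def)
  qed
qed

section \<open>Realization of endomorphisms by annotated transducers\<close>

text \<open>
  An annotation \<open>v\<close> tells where the output goes: reading the letter \<open>x\<^sub>i\<close> from the state \<open>q\<close>
  forced by the letters before position \<open>i\<close>, the transducer writes from position \<open>i + v q\<close> on.
\<close>

definition realizes ::
  "('a, 's) transducer \<Rightarrow> ('s \<Rightarrow> int) \<Rightarrow> ((int \<Rightarrow> 'a) \<Rightarrow> (int \<Rightarrow> 'a)) \<Rightarrow> bool" where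
  "realizes T v g \<longleftrightarrow> (\<forall>x i. future (g x) (i + v (past_state T x i)) =
     state_map T (past_state T x i) (future x i))"

lemma realizes_at:
  assumes "realizes T v g" "i + v (past_state T x i) \<le> j"
  shows "g x j = state_map T (past_state T x i) (future x i) (nat (j - (i + v (past_state T x i))))"
proof -
  have "future (g x) (i + v (past_state T x i)) (nat (j - (i + v (past_state T x i)))) = g x j"
    using assms(2) by (simp add: future_def)
  then show ?thesis using assms(1) unfolding realizes_def by metis
qed

lemma annotation_bound:
  assumes "transducer T"
  obtains M :: nat where "\<And>q. q \<in> states T \<Longrightarrow> \<bar>v q :: int\<bar> \<le> int M"
proof -
  obtain m where m: "\<And>q. q \<in> states T \<Longrightarrow> nat \<bar>v q\<bar> \<le> m"
    using finite_nat_set_iff_bounded_le[of "(\<lambda>i. nat \<bar>v i\<bar>) ` states T"] transducerD(1)[OF assms]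
    by auto
  have "\<bar>v q\<bar> \<le> int m" if "q \<in> states T" for q using m[OF that] by linarith
  then show thesis by (rule that)
qed

text \<open>The annotation equation read along a word: the output written between \<open>i\<close>
  and \<open>j\<close> exactly fills the gap between the two starting positions, so consecutive
  outputs neither overlap nor leave holes.\<close>

lemma annotation_past_state:
  assumes "sync_core T" "annotation T v" "i \<le> j"
  shows "int (length (outs T (segment x i j) (past_state T x i))) =
    j + v (past_state T x j) - (i + v (past_state T x i))"
proof -
  have "v (past_state T x j) = v (past_state T x i) +
      int (length (outs T (segment x i j) (past_state T x i))) - int (length (segment x i j))"
    using assms(2) past_state_closed[OF assms(1)] past_state_steps[OF assms(1,3)]
    unfolding annotation_def by metis
  then show ?thesis using assms(3) by simp
qed

lemma state_map_future:
  assumes "sync_core T" "i \<le> j"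
  shows "state_map T (past_state T x i) (future x i) =
    outs T (segment x i j) (past_state T x i) \<frown> state_map T (past_state T x j) (future x j)"
  using state_map_conc[OF sync_coreD(1)[OF assms(1)] past_state_closed[OF assms(1)],
      where w = "segment x i j" and x = "future x j"]
  by (simp add: future_segment[OF assms(2), symmetric] past_state_steps[OF assms])

lemma realizes_segment:
  assumes T: "sync_core T" "annotation T v" and r: "realizes T v g" and ij: "i \<le> j"
  shows "segment (g x) (i + v (past_state T x i)) (j + v (past_state T x j)) =
    outs T (segment x i j) (past_state T x i)"
proof -
  have "segment (g x) (i + v (past_state T x i)) (j + v (past_state T x j)) =
      prefix (length (outs T (segment x i j) (past_state T x i)))
        (state_map T (past_state T x i) (future x i))"
    using r unfolding segment_prefix annotation_past_state[OF T ij, symmetric] realizes_def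
    by (metis annotation_past_state[OF T ij] nat_int segment_prefix)
  then show ?thesis unfolding state_map_future[OF T(1) ij] by simp
qed

text \<open>Letters of the image before the starting position for \<open>i\<close> are written while
  letters before \<open>i\<close> are read.\<close>

lemma realizes_past:
  assumes T: "sync_core T" "annotation T v" and r: "realizes T v g"
    and eq: "\<And>l. l < i \<Longrightarrow> x l = y l" and j: "j < i + v (past_state T x i)"
  shows "g x j = g y j"
proof -
  obtain M :: nat where M: "\<And>q. q \<in> states T \<Longrightarrow> \<bar>v q\<bar> \<le> int M"
    using annotation_bound[OF sync_coreD(1)[OF T(1)]] by blast
  \<comment> \<open>As displacements are at most \<open>M\<close>, the output that starts when
    reading at \<open>k\<close> begins no later than \<open>j\<close>.\<close>
  define k where "k = min i (j - int M)"
  let ?a = "k + v (past_state T x k)" and ?b = "i + v (past_state T x i)"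
  have k: "k \<le> i" "?a \<le> j"
    using M[OF past_state_closed[OF T(1)], of x k] by (auto simp: k_def)
  have "past_state T x i = past_state T y i" "past_state T x k = past_state T y k"
    using eq k(1) by (auto intro!: past_state_cong)
  moreover have "segment x k i = segment y k i" using eq by (intro segment_cong) auto
  ultimately have "segment (g x) ?a ?b = segment (g y) ?a ?b"
    using realizes_segment[OF T r k(1), of x] realizes_segment[OF T r k(1), of y] by simp
  then have "segment (g x) ?a ?b ! nat (j - ?a) = segment (g y) ?a ?b ! nat (j - ?a)" by simp
  then show ?thesis using k j by simp
qed

text \<open>Every position \<open>j\<close> of the image is covered by the output begun at
  \<open>j - M\<close>, so the state maps leave no letter open.\<close>

lemma realizes_unique:
  assumes T: "sync_core T" and r: "realizes T v g" "realizes T v h"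
  shows "g = h"
proof (intro ext)
  fix x j
  obtain M :: nat where M: "\<And>q. q \<in> states T \<Longrightarrow> \<bar>v q\<bar> \<le> int M"
    using annotation_bound[OF sync_coreD(1)[OF T(1)]] by blast
  have "(j - int M) + v (past_state T x (j - int M)) \<le> j"
    using M[OF past_state_closed[OF T], of x "j - int M"] by linarith
  then show "g x j = h x j" using realizes_at[OF r(1)] realizes_at[OF r(2)] by metis
qed

lemma realizes_ex:
  fixes T :: "('a::finite, 's) transducer"
  assumes T: "sync_core T" "annotation T v"
  shows "\<exists>g\<in>carrier End_shift. realizes T v g"
proof -
  note tr = sync_coreD(1)[OF T(1)]
  obtain M :: nat where M: "\<And>q. q \<in> states T \<Longrightarrow> \<bar>v q\<bar> \<le> int M"
    using annotation_bound[OF tr] by blast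
  \<comment> \<open>\<open>P x i j\<close> is the letter that lands at position \<open>j\<close>
    when reading starts at \<open>i\<close>. By the annotation equation it is the same for all
    \<open>i\<close> whose output reaches \<open>j\<close>; \<open>j - M\<close> is one such
    \<open>i\<close> for every word.\<close>
  define P where "P = (\<lambda>x i j. state_map T (past_state T x i) (future x i)
    (nat (j - (i + v (past_state T x i)))))"
  define g where "g = (\<lambda>x j. P x (j - int M) j)"
  have le: "i + v (past_state T x i) \<le> j" if "i \<le> j - int M" for x i j
    using M[OF past_state_closed[OF T(1)], of x i] that by linarith
  have P_le: "P x i j = P x i' j" if "i \<le> i'" "i' + v (past_state T x i') \<le> j" for x i i' j
    using annotation_past_state[OF T that(1), of x] that(2)
    unfolding P_def state_map_future[OF T(1) that(1)] conc_def
    by (auto intro!: arg_cong[of _ _ "state_map T (past_state T x i') (future x i')"])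
  have P_eq: "P x i j = P x i' j" if "i + v (past_state T x i) \<le> j" "i' + v (past_state T x i') \<le> j"
    for x i i' j
    using P_le that by (metis linear)
  have "realizes T v g"
    unfolding realizes_def
  proof (intro allI ext)
    fix x i n
    let ?j = "i + v (past_state T x i) + int n"
    have "g x ?j = P x i ?j"
      unfolding g_def by (rule P_eq[OF le]) simp_all
    then show "future (g x) (i + v (past_state T x i)) n =
        state_map T (past_state T x i) (future x i) n"
      by (simp add: P_def future_def)
  qed
  moreover have "finitary (\<lambda>x. g x j)" for j
  proof -
    obtain q k where qk: "q \<in> states T" "sync_level T k" using sync_coreE[OF T(1)] by blast
    let ?i = "j - int M"
    \<comment> \<open>Started at \<open>j - M\<close>, the output reaches position \<open>j\<close>
      at an index of at most \<open>2 * M\<close>, and by \<open>state_map_local\<close> this many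
      input letters determine that letter.\<close>
    define K where "K = Suc (2 * M) * card (states T)"
    have "g x j = g y j" if eq: "\<forall>l\<in>{?i - int k..?i + int K}. x l = y l" for x y
    proof -
      have "segment x (?i - int k) ?i = segment y (?i - int k) ?i"
        using eq by (intro segment_cong) auto
      then have p: "past_state T x ?i = past_state T y ?i"
        using past_state_eq[OF tr qk(2,1)] by metis
      have pre: "prefix K (future x ?i) = prefix K (future y ?i)"
        using eq by (auto simp: subsequence_def future_def)
      let ?n = "nat (j - (?i + v (past_state T y ?i)))"
      have "?n \<le> 2 * M" using M[OF past_state_closed[OF T(1)], of y ?i] by linarith
      then have "Suc ?n * card (states T) \<le> K" unfolding K_def by (intro mult_le_mono1) simp
      from state_map_local[OF tr past_state_closed[OF T(1)] pre this]
      show ?thesis unfolding g_def P_def p .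
    qed
    then show ?thesis unfolding finitary_def by (intro exI[of _ "{?i - int k..?i + int K}"]) blast
  qed
  moreover have "g \<circ> shift = shift \<circ> g"
  proof (intro ext)
    fix x :: "int \<Rightarrow> 'a" and j
    have "future (shift x) i = future x (i - 1)" for i
      by (auto simp: future_def shift_def algebra_simps)
    moreover have "past_state T (shift x) i = past_state T x (i - 1)" for i
      unfolding shift_def by (rule past_state_shift)
    ultimately show "(g \<circ> shift) x j = (shift \<circ> g) x j"
      by (simp add: g_def P_def shift_def algebra_simps)
  qed
  ultimately show ?thesis by (auto simp: End_shift_iff intro!: bexI[of _ g])
qed

section \<open>Homomorphisms of transducers\<close>

text \<open>Surjectivity is included so that the properties of \<open>T\<close> pass to all of
  \<open>U\<close>. It covers the quotient by omega-equivalence, the renaming of states by natural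
  numbers and the bijections that witness equality of transducers.\<close>

definition trans_hom ::
  "('s \<Rightarrow> 't) \<Rightarrow> ('a, 's) transducer \<Rightarrow> ('a, 't) transducer \<Rightarrow> bool" where
  "trans_hom G T U \<longleftrightarrow> G ` states T = states U \<and>
     (\<forall>q\<in>states T. \<forall>x. step U x (G q) = G (step T x q) \<and> outl U x (G q) = outl T x q)"

lemma trans_hom_steps:
  assumes "trans_hom G T U" "transducer T"
  shows "q \<in> states T \<Longrightarrow> steps U w (G q) = G (steps T w q)"
    and "q \<in> states T \<Longrightarrow> outs U w (G q) = outs T w q"
  by (induction w arbitrary: q) (use assms in \<open>auto simp: trans_hom_def dest: transducerD(3)\<close>)

lemma trans_hom_state_map:
  assumes "trans_hom G T U" "transducer T" "q \<in> states T"
  shows "state_map U (G q) = state_map T q"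
  unfolding state_map_def trans_hom_steps(2)[OF assms] ..

context
  fixes G :: "'s \<Rightarrow> 't" and T :: "('a, 's) transducer" and U :: "('a, 't) transducer"
  assumes hom: "trans_hom G T U"
begin

lemma trans_hom_states:
  assumes "p \<in> states U"
  obtains q where "q \<in> states T" "p = G q"
  using hom assms unfolding trans_hom_def by blast

lemma trans_hom_in: "q \<in> states T \<Longrightarrow> G q \<in> states U"
  using hom unfolding trans_hom_def by blast

text \<open>
  A loop of \<open>U\<close> need not lift to a loop of \<open>T\<close>, but a high power of it cannot have empty output.
\<close>

lemma trans_hom_transducer:
  assumes T: "transducer T"
  shows "transducer U"
  unfolding transducer_def
proof (intro conjI allI ballI impI)
  have "states U = G ` states T" using hom by (simp add: trans_hom_def)
  then show "finite (states U)" "states U \<noteq> {}" using transducerD(1,2)[OF T] by simp_all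
next
  fix x p assume "p \<in> states U"
  then obtain q where q: "q \<in> states T" "p = G q" by (rule trans_hom_states)
  then have "step U x p = G (step T x q)" using hom by (auto simp: trans_hom_def)
  then show "step U x p \<in> states U" using trans_hom_in transducerD(3)[OF T q(1)] by metis
next
  fix w p assume "p \<in> states U" and w: "w \<noteq> [] \<and> steps U w p = p"
  then obtain q where q: "q \<in> states T" "p = G q" by (auto elim: trans_hom_states)
  let ?w = "\<lambda>n. concat (replicate n w)"
  show "outs U w p \<noteq> []"
  proof
    assume e: "outs U w p = []"
    have "outs U (?w n) p = []" for n
      by (induction n) (use w e in auto)
    then have "outs T (?w (card (states T))) q = []"
      using trans_hom_steps(2)[OF hom T q(1)] q(2) by metis
    moreover have "card (states T) \<le> length (?w (card (states T)))"
      using w by (cases w) (simp_all add: length_concat sum_list_replicate)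
    ultimately show False using outs_nonempty[OF T q(1)] by blast
  qed
qed

lemma trans_hom_sync_level:
  assumes T: "transducer T" and k: "sync_level T k"
  shows "sync_level U k"
  unfolding sync_level_def
proof (intro allI impI ballI)
  fix w :: "'a list" and p p'
  assume "length w = k" "p \<in> states U" "p' \<in> states U"
  moreover from this obtain q q' where "q \<in> states T" "p = G q" "q' \<in> states T" "p' = G q'"
    by (metis trans_hom_states)
  ultimately show "steps U w p = steps U w p'"
    using trans_hom_steps(1)[OF hom T] k unfolding sync_level_def by metis
qed

lemma trans_hom_sync_core:
  assumes T: "sync_core T"
  shows "sync_core U"
proof -
  note tr = sync_coreD(1)[OF T]
  obtain q k where "q \<in> states T" "sync_level T k" by (rule sync_coreE[OF T])
  show ?thesis
  proof (rule sync_coreI)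
    show "transducer U" "sync_level U k"
      by (rule trans_hom_transducer[OF tr], rule trans_hom_sync_level) fact+
  next
    fix p assume p: "p \<in> states U"
    then obtain q where q: "q \<in> states T" "p = G q" by (rule trans_hom_states)
    obtain w where w: "sync_level T (length w)" "q = forced T w"
      using sync_coreD(3)[OF T q(1)] by blast
    have "sync_level U (length w)" using trans_hom_sync_level[OF tr w(1)] .
    moreover from this have "forced U w = G (steps T w q)"
      using forced_eq[OF _ p] trans_hom_steps(1)[OF hom tr q(1)] q(2) by metis
    then have "p = forced U w" using forced_eq[OF w(1) q(1)] w(2) q(2) by metis
    ultimately show "\<exists>w. sync_level U (length w) \<and> p = forced U w" by blast
  qed
qed

lemma trans_hom_past_state:
  assumes T: "sync_core T"
  shows "past_state U x i = G (past_state T x i)"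
proof -
  note tr = sync_coreD(1)[OF T]
  obtain q k where qk: "q \<in> states T" "sync_level T k" by (rule sync_coreE[OF T])
  show ?thesis
    using past_state_eq[OF tr qk(2,1), of x i] trans_hom_steps(1)[OF hom tr qk(1)]
      past_state_eq[OF trans_hom_transducer[OF tr] trans_hom_sync_level[OF tr qk(2)]
        trans_hom_in[OF qk(1)], of x i] by simp
qed

lemma trans_hom_realizes:
  assumes T: "sync_core T" and r: "realizes T v g"
    and v: "\<And>q. q \<in> states T \<Longrightarrow> u (G q) = v q"
  shows "realizes U u g"
  using r trans_hom_state_map[OF hom sync_coreD(1)[OF T] past_state_closed[OF T]]
    v[OF past_state_closed[OF T]]
  unfolding realizes_def trans_hom_past_state[OF T] by simp

lemma trans_hom_annotation:
  assumes T: "transducer T" and a: "annotation T v"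
    and v: "\<And>q. q \<in> states T \<Longrightarrow> u (G q) = v q"
  shows "annotation U u"
  unfolding annotation_def
proof (intro allI ballI)
  fix w p assume "p \<in> states U"
  then obtain q where q: "q \<in> states T" "p = G q" by (rule trans_hom_states)
  with a have "v (steps T w q) = v q + int (length (outs T w q)) - int (length w)"
    unfolding annotation_def by blast
  then show "u (steps U w p) = u p + int (length (outs U w p)) - int (length w)"
    unfolding q(2) trans_hom_steps[OF hom T q(1)] v[OF q(1)] v[OF steps_closed[OF T q(1)]] .
qed

lemma trans_hom_full_response:
  assumes T: "transducer T" and f: "full_response T"
  shows "full_response U"
  unfolding full_response_def
proof
  fix p assume "p \<in> states U"
  then obtain q where q: "q \<in> states T" "p = G q" by (rule trans_hom_states)
  then show "\<not> incomplete_response U p"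
    using f trans_hom_state_map[OF hom T q(1)]
    unfolding full_response_def incomplete_response_iff by simp
qed

end

text \<open>Without incomplete response a state map determines the output on each letter and the
  state map of the next state; weak minimality of \<open>U\<close> turns the latter into a single
  state.\<close>

lemma trans_hom_omega_equiv:
  assumes T: "transducer T" "full_response T" and U: "transducer U" "full_response U"
    "weakly_minimal U"
    and G: "G ` states T = states U" "\<And>q. q \<in> states T \<Longrightarrow> omega_equiv T q U (G q)"
  shows "trans_hom G T U"
  unfolding trans_hom_def
proof (intro conjI ballI allI)
  fix q x assume q: "q \<in> states T"
  then have Gq: "G q \<in> states U" using G(1) by blast
  note eq = full_response_outs_eq[OF T U(1,2) q Gq G(2)[OF q], where w = "[x]"]
  show "outl U x (G q) = outl T x q" using eq(1) by simp
  have "omega_equiv U (G (step T x q)) U (step U x (G q))"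
    using eq(2) G(2)[OF transducerD(3)[OF T(1) q]] by (simp add: omega_equiv_def)
  then show "step U x (G q) = G (step T x q)"
    using U(3) transducerD(3)[OF U(1) Gq] transducerD(3)[OF T(1) q] G(1)
    unfolding weakly_minimal_def by (metis image_eqI)
qed (fact G(1))


section \<open>Annotated transducers and the endomorphisms they realize\<close>

text \<open>The infinite annotation occurs only for a transducer with constant output, where every
  displacement realizes the same constant map; 0 is as good as any.\<close>

definition annotation_fun :: "('s \<Rightarrow> int) option \<Rightarrow> 's \<Rightarrow> int" where
  "annotation_fun \<alpha> = (case \<alpha> of Some a \<Rightarrow> a | None \<Rightarrow> (\<lambda>_. 0))"

definition realizes_annotated ::
  "('a, 's) annotated \<Rightarrow> ((int \<Rightarrow> 'a) \<Rightarrow> (int \<Rightarrow> 'a)) \<Rightarrow> bool" where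
  "realizes_annotated A g \<longleftrightarrow> realizes (fst A) (annotation_fun (snd A)) g"

lemma annotation_fun_simps [simp]:
  "annotation_fun None = (\<lambda>_. 0)" "annotation_fun (Some a) = a"
  by (simp_all add: annotation_fun_def)

lemma realizes_annotated_simps [simp]:
  "realizes_annotated (T, \<alpha>) g \<longleftrightarrow> realizes T (annotation_fun \<alpha>) g"
  by (simp add: realizes_annotated_def)

lemma is_Z_letter:
  assumes Z: "is_Z T [b]"
  shows "sync_core T" "annotation T (\<lambda>_. 0)" "realizes T (\<lambda>_. 0) (\<lambda>_ _. b)"
    and "q \<in> states T \<Longrightarrow> state_map T q x = (\<lambda>_. b)"
proof -
  obtain s where s: "states T = {s}" "\<And>a. step T a s = s" "\<And>a. outl T a s = [b]"
    using Z unfolding is_Z_def by blast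
  have st: "steps T w s = s" for w by (induction w) (auto simp: s)
  have ou: "outs T w s = replicate (length w) b" for w by (induction w) (auto simp: s)
  have T: "transducer T"
    unfolding transducer_def by (simp add: s ou)
  have sync: "sync_level T 0" unfolding sync_level_def by (simp add: s)
  have "forced T [] = s" using forced_eq[of T "[]" s] sync s(1) by simp
  then show core: "sync_core T"
    using sync s(1) by (intro sync_coreI[OF T sync]) (auto intro: exI[of _ "[]"])
  show "annotation T (\<lambda>_. 0)" unfolding annotation_def by (simp add: s ou)
  have sm: "state_map T s x = (\<lambda>_. b)" for x
  proof (rule state_map_eqI[OF T])
    show "\<exists>z. (\<lambda>_. b) = outs T (prefix k x) s \<frown> z" for k
      by (rule conc_exI) (simp add: ou)
  qed (simp add: s)
  have "past_state T x i = s" for x i using past_state_closed[OF core, of x i] s(1) by simp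
  then show "realizes T (\<lambda>_. 0) (\<lambda>_ _. b)"
    unfolding realizes_def by (simp add: sm) (simp add: future_def)
  show "state_map T q x = (\<lambda>_. b)" if "q \<in> states T" using that sm s(1) by simp
qed

text \<open>A loop returns to the same annotation value, so its output has the length of its label;
  strong connectedness comes from the core property. In the converse direction the alternative
  \<open>is_Z\<close> has a single state and is therefore weakly minimal as well.\<close>

lemma is_AL_Some_iff:
  "is_AL (T, Some a) \<longleftrightarrow> sync_core T \<and> weakly_minimal T \<and> full_response T \<and> annotation T a"
proof
  assume A: "is_AL (T, Some a)"
  then have M: "is_M T" and rest: "full_response T" "annotation T a"
    by (auto simp: is_L_def full_response_def)
  have "weakly_minimal T"
    using M unfolding is_M_def minimal_def is_Z_def weakly_minimal_def by fastforce
  then show "sync_core T \<and> weakly_minimal T \<and> full_response T \<and> annotation T a"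
    using M rest unfolding is_M_def sync_core_def by blast
next
  assume A: "sync_core T \<and> weakly_minimal T \<and> full_response T \<and> annotation T a"
  then have "is_M T"
    using strongly_connected_sync_core
    unfolding is_M_def minimal_def sync_core_def full_response_def by blast
  moreover have "length (outs T w q) = length w" if "q \<in> states T" "steps T w q = q" for w q
  proof -
    have "a q = a q + int (length (outs T w q)) - int (length w)"
      using A that unfolding annotation_def by metis
    then show ?thesis by linarith
  qed
  ultimately show "is_AL (T, Some a)" using A by (auto simp: is_L_def full_response_def)
qed

lemma is_AL_realizable:
  assumes "is_AL (T, \<alpha>)"
  shows "sync_core T" "annotation T (annotation_fun \<alpha>)"
proof -
  have "sync_core T \<and> annotation T (annotation_fun \<alpha>)"
  proof (cases \<alpha>)
    case None
    then show ?thesis using assms is_Z_letter(1,2) by auto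
  next
    case (Some a)
    with assms[unfolded Some is_AL_Some_iff] show ?thesis by simp
  qed
  then show "sync_core T" "annotation T (annotation_fun \<alpha>)" by blast+
qed

lemma is_AL_realizes_ex:
  fixes A :: "('a::{finite, linorder}, 's) annotated"
  assumes "is_AL A"
  shows "\<exists>g\<in>carrier End_shift. realizes_annotated A g"
  using assms realizes_ex[OF is_AL_realizable] by (cases A) auto

lemma realizes_annotated_unique:
  assumes "is_AL A" "realizes_annotated A g" "realizes_annotated A h"
  shows "g = h"
  using assms realizes_unique[OF is_AL_realizable(1)] by (cases A) auto

lemma realizes_glue:
  assumes "realizes T v g" "past_state T x i = q"
  shows "future (g (glue i x y)) (i + v q) = state_map T q y"
  using assms unfolding realizes_def by (metis past_state_glue future_glue)

lemma full_responseE: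
  assumes "full_response T" "q \<in> states T"
  obtains y z where "state_map T q y 0 \<noteq> state_map T q z 0"
  using assms unfolding full_response_def incomplete_response_iff by metis

text \<open>After one and the same past, two futures yield images that differ at the first position
  the state writes to.\<close>

lemma full_response_not_constant:
  assumes T: "sync_core T" "full_response T" and r: "realizes T v g"
  shows "g \<noteq> (\<lambda>_ _. b)"
proof
  assume g: "g = (\<lambda>_ _. b)"
  obtain q k where q: "q \<in> states T" using sync_coreE[OF T(1)] by blast
  obtain x where x: "past_state T x 0 = q" using past_state_ex[OF T(1) q] by blast
  obtain y z where "state_map T q y 0 \<noteq> state_map T q z 0" by (rule full_responseE[OF T(2) q])
  then show False
    using realizes_glue[OF r x, of y] realizes_glue[OF r x, of z] unfolding g future_def by metis
qed

text \<open>
  Without incomplete response, \<open>i + v q\<close> is the first position of the image that depends on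
  the letters from position \<open>i\<close> on, so the endomorphism determines the annotation.
\<close>

lemma realizes_annotation_le:
  assumes T: "sync_core T" "full_response T" and U: "sync_core U" "annotation U u"
    and r: "realizes T v g" "realizes U u g"
  shows "u (past_state U x i) \<le> v (past_state T x i)"
proof (rule ccontr)
  let ?q = "past_state T x i"
  assume "\<not> ?thesis"
  then have lt: "i + v ?q < i + u (past_state U (glue i x y) i)" for y by simp
  obtain y z where yz: "state_map T ?q y 0 \<noteq> state_map T ?q z 0"
    using full_responseE[OF T(2) past_state_closed[OF T(1)]] by metis
  have "g (glue i x y) (i + v ?q) = g (glue i x z) (i + v ?q)"
    by (rule realizes_past[OF U r(2) _ lt]) simp
  moreover have "g (glue i x y) (i + v ?q) = state_map T ?q y 0" for y
    using fun_cong[OF realizes_glue[OF r(1) refl], of i x y 0] by (simp add: future_def)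
  ultimately show False using yz by simp
qed

text \<open>With equal displacements, both state maps send \<open>y\<close> to the same right half
  of \<open>g (glue i x y)\<close>.\<close>

lemma realizes_omega_equiv:
  assumes T: "sync_core T" "full_response T" "annotation T v"
    and U: "sync_core U" "full_response U" "annotation U u"
    and r: "realizes T v g" "realizes U u g"
  shows "v (past_state T x i) = u (past_state U x i)"
    and "omega_equiv T (past_state T x i) U (past_state U x i)"
proof -
  show eq: "v (past_state T x i) = u (past_state U x i)"
    using realizes_annotation_le[OF T(1,2) U(1,3) r] realizes_annotation_le[OF U(1,2) T(1,3) r(2,1)]
    by (metis order_antisym)
  show "omega_equiv T (past_state T x i) U (past_state U x i)"
    unfolding omega_equiv_def
  proof
    fix y
    show "state_map T (past_state T x i) y = state_map U (past_state U x i) y"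
      using realizes_glue[OF r(1) refl, of i x y] realizes_glue[OF r(2) refl, of i x y] eq by simp
  qed
qed

lemma same_annotated_realizes:
  assumes A: "is_AL A" and B: "is_AL B" and same: "same_annotated A B"
    and r: "realizes_annotated A g"
  shows "realizes_annotated B g"
proof -
  obtain T \<alpha> U \<beta> where AB: "A = (T, \<alpha>)" "B = (U, \<beta>)" by (metis surj_pair)
  obtain G where G: "bij_betw G (states T) (states U)"
    "\<And>q. q \<in> states T \<Longrightarrow> omega_equiv T q U (G q)"
    and c: "(\<exists>a b. \<alpha> = Some a \<and> \<beta> = Some b \<and> (\<forall>q\<in>states T. a q = b (G q))) \<or> \<alpha> = None \<and> \<beta> = None"
    using same unfolding AB by (auto split: option.splits)
  from c show ?thesis
  proof (elim disjE exE conjE)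
    fix a b assume ab: "\<alpha> = Some a" "\<beta> = Some b" "\<forall>q\<in>states T. a q = b (G q)"
    then have T: "sync_core T" "full_response T" and U: "sync_core U" "weakly_minimal U" "full_response U"
      using A B unfolding AB ab is_AL_Some_iff by blast+
    have "trans_hom G T U"
      using G by (intro trans_hom_omega_equiv sync_coreD(1) T U) (auto simp: bij_betw_def)
    then show ?thesis
      using trans_hom_realizes[OF _ T(1), of G U a g b] r ab by (simp add: AB)
  next
    assume None: "\<alpha> = None" "\<beta> = None"
    then obtain b c where Z: "is_Z T [b]" "is_Z U [c]" using A B by (auto simp: AB)
    have "g = (\<lambda>_ _. b)"
      using realizes_unique[OF is_Z_letter(1)[OF Z(1)]] is_Z_letter(3)[OF Z(1)] r None
      by (simp add: AB)
    moreover obtain q k where q: "q \<in> states T" using sync_coreE[OF is_Z_letter(1)[OF Z(1)]] .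
    have "b = c"
      using G(2)[OF q] is_Z_letter(4)[OF Z(1) q] is_Z_letter(4)[OF Z(2), of "G q"] q G(1)
      unfolding omega_equiv_def bij_betw_def by (metis imageI)
    ultimately show ?thesis using is_Z_letter(3)[OF Z(2)] None by (simp add: AB)
  qed
qed

lemma realizes_same_annotated_Some:
  assumes A: "is_AL (T, Some a)" and B: "is_AL (U, Some b)"
    and r: "realizes T a g" "realizes U b g"
  shows "same_annotated (T, Some a) (U, Some b)"
proof -
  note A' = A[unfolded is_AL_Some_iff] and B' = B[unfolded is_AL_Some_iff]
  have T: "sync_core T" "full_response T" "annotation T a" "weakly_minimal T"
    and U: "sync_core U" "full_response U" "annotation U b" "weakly_minimal U"
    using A' B' by blast+
  \<comment> \<open>\<open>G\<close> sends \<open>q\<close> to the state of \<open>U\<close> after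
    some past that forces \<open>q\<close> in \<open>T\<close>. Another past would give an
    omega-equivalent state of \<open>U\<close>, hence the same one; weak minimality of
    \<open>T\<close> makes \<open>G\<close> injective.\<close>
  define P where "P = (\<lambda>q. SOME x. past_state T x 0 = q)"
  define G where "G = (\<lambda>q. past_state U (P q) 0)"
  have P: "past_state T (P q) 0 = q" if "q \<in> states T" for q
    unfolding P_def using past_state_ex[OF T(1) that] by (rule someI_ex)
  have G: "a q = b (G q)" "omega_equiv T q U (G q)" if "q \<in> states T" for q
    using realizes_omega_equiv[OF T(1-3) U(1-3) r, of "P q" 0] P[OF that] by (simp_all add: G_def)
  have Gin: "G q \<in> states U" for q unfolding G_def by (rule past_state_closed[OF U(1)])
  have "bij_betw G (states T) (states U)"
    unfolding bij_betw_def
  proof (intro conjI inj_onI equalityI subsetI)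
    fix p q assume pq: "p \<in> states T" "q \<in> states T" "G p = G q"
    then have "omega_equiv T p T q" using G(2)[of p] G(2)[of q] by (simp add: omega_equiv_def)
    then show "p = q" using T(4) pq unfolding weakly_minimal_def by blast
  next
    fix p assume p: "p \<in> states U"
    obtain x where x: "past_state U x 0 = p" using past_state_ex[OF U(1) p] by blast
    let ?q = "past_state T x 0"
    have q: "?q \<in> states T" by (rule past_state_closed[OF T(1)])
    have "omega_equiv U p U (G ?q)"
      using realizes_omega_equiv(2)[OF T(1-3) U(1-3) r, of x 0] G(2)[OF q] x
      by (simp add: omega_equiv_def)
    then have "p = G ?q" using U(4) p Gin unfolding weakly_minimal_def by blast
    then show "p \<in> G ` states T" using q by blast
  qed (use Gin in blast)
  then show ?thesis using G by auto
qed

lemma realizes_annotated_Some: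
  assumes A: "is_AL (T, \<alpha>)" and r: "realizes_annotated (T, \<alpha>) g" and g: "\<nexists>b. g = (\<lambda>_ _. b)"
  shows "\<exists>a. \<alpha> = Some a"
proof (rule ccontr)
  assume "\<nexists>a. \<alpha> = Some a"
  then have None: "\<alpha> = None" by auto
  with A obtain b where "is_Z T [b]" by auto
  from is_Z_letter(1,3)[OF this] have "g = (\<lambda>_ _. b)"
    using realizes_unique r None by fastforce
  with g show False by blast
qed

lemma realizes_annotated_None:
  assumes A: "is_AL (T, \<alpha>)" and r: "realizes_annotated (T, \<alpha>) (\<lambda>_ _. b)"
  shows "\<alpha> = None" "is_Z T [b]"
proof -
  show None: "\<alpha> = None"
  proof (cases \<alpha>)
    case (Some a)
    with A r show ?thesis
      using full_response_not_constant[of T a "\<lambda>_ _. b" b] unfolding Some is_AL_Some_iff by simp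
  qed
  then obtain c where c: "is_Z T [c]" using A by auto
  have "(\<lambda>_ _. b) = (\<lambda>(_::int \<Rightarrow> 'a) (_::int). c)"
    using realizes_unique[OF is_Z_letter(1)[OF c]] is_Z_letter(3)[OF c] r None by auto
  then show "is_Z T [b]" using c by (metis)
qed

lemma realizes_same_annotated:
  assumes A: "is_AL A" and B: "is_AL B" and r: "realizes_annotated A g" "realizes_annotated B g"
  shows "same_annotated A B"
proof -
  obtain T \<alpha> U \<beta> where AB: "A = (T, \<alpha>)" "B = (U, \<beta>)" by (metis surj_pair)
  show ?thesis
  proof (cases "\<exists>b. g = (\<lambda>_ _. b)")
    case True
    then obtain b where g: "g = (\<lambda>_ _. b)" by blast
    have None: "\<alpha> = None" "\<beta> = None" and Z: "is_Z T [b]" "is_Z U [b]"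
      using realizes_annotated_None A B r unfolding AB g by blast+
    obtain s t where st: "states T = {s}" "states U = {t}" using Z unfolding is_Z_def by blast
    have "omega_equiv T s U t"
      using is_Z_letter(4)[OF Z(1), of s] is_Z_letter(4)[OF Z(2), of t] st
      by (auto simp: omega_equiv_def)
    then show ?thesis
      unfolding AB None by (auto simp: st intro!: exI[of _ "\<lambda>_. t"])
  next
    case False
    obtain a where "\<alpha> = Some a"
      using realizes_annotated_Some[OF A[unfolded AB] r(1)[unfolded AB] False] by blast
    moreover obtain b where "\<beta> = Some b"
      using realizes_annotated_Some[OF B[unfolded AB] r(2)[unfolded AB] False] by blast
    ultimately show ?thesis
      using realizes_same_annotated_Some[of T a U b g] A B r
      by (simp only: AB realizes_annotated_simps annotation_fun_simps)
  qed
qed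

text \<open>The pivot between the two sides: equality of annotated transducers means realizing the
  same endomorphism.\<close>

lemma annotated_class_eq:
  assumes "is_AL A" "realizes_annotated A g"
  shows "annotated_class A = {B. is_AL B \<and> realizes_annotated B g}"
  using same_annotated_realizes realizes_same_annotated assms unfolding annotated_class_def by blast


section \<open>Reduction\<close>

lemma prefix_of_conc:
  assumes "u \<frown> y = v \<frown> z" "length u \<le> length v"
  shows "u @ drop (length u) v = v"
proof -
  have "u ! n = v ! n" if "n < length u" for n
    using fun_cong[OF assms(1), of n] that assms(2) by simp
  then have "take (length u) v = u" using assms(2) by (intro nth_equalityI) auto
  then show ?thesis by (metis append_take_drop_id)
qed

lemma common_prefixes_unique:
  assumes "u \<in> common_prefixes T w q" "v \<in> common_prefixes T w q" "length u = length v"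
  shows "u = v"
proof -
  obtain y z where "state_map T q (w \<frown> undefined) = u \<frown> y" "state_map T q (w \<frown> undefined) = v \<frown> z"
    using assms(1,2) unfolding common_prefixes_def by blast
  then show ?thesis using assms(3) by simp
qed

lemma Lambda_eqI:
  assumes "u \<in> common_prefixes T w q" "\<And>v. v \<in> common_prefixes T w q \<Longrightarrow> length v \<le> length u"
  shows "Lambda T w q = u"
proof -
  have "Lambda T w q \<in> common_prefixes T w q \<and>
      (\<forall>v. v \<in> common_prefixes T w q \<longrightarrow> length v \<le> length (Lambda T w q))"
    unfolding Lambda_def
    by (rule arg_max_nat_lemma[where k = u and b = "Suc (length u)"])
      (use assms in \<open>auto simp: less_Suc_eq_le\<close>)
  then show ?thesis using assms common_prefixes_unique by (metis le_antisym)
qed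

text \<open>Finite extent bounds the lengths of common prefixes, so the maximum that defines
  \<open>Lambda\<close> is attained.\<close>

lemma
  assumes "extent T q \<noteq> \<infinity>"
  shows Lambda_in: "Lambda T [] q \<in> common_prefixes T [] q"
    and Lambda_max: "u \<in> common_prefixes T [] q \<Longrightarrow> length u \<le> length (Lambda T [] q)"
proof -
  obtain n where n: "extent T q = enat n" using assms by auto
  have le: "length u \<le> n" if "u \<in> common_prefixes T [] q" for u
  proof -
    have "enat (length u) \<le> extent T q" unfolding extent_def using that by (rule SUP_upper)
    then show ?thesis by (simp add: n)
  qed
  have "[] \<in> common_prefixes T [] q" by (simp add: common_prefixes_def)
  then have "Lambda T [] q \<in> common_prefixes T [] q \<and>
      (\<forall>u. u \<in> common_prefixes T [] q \<longrightarrow> length u \<le> length (Lambda T [] q))"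
    unfolding Lambda_def
    by (rule arg_max_nat_lemma[where b = "Suc n"]) (use le in \<open>auto simp: less_Suc_eq_le\<close>)
  then show "Lambda T [] q \<in> common_prefixes T [] q"
    "u \<in> common_prefixes T [] q \<Longrightarrow> length u \<le> length (Lambda T [] q)" by blast+
qed

text \<open>A common prefix longer than the output on \<open>x\<close> becomes, after removal of
  that output, a common prefix for the next state.\<close>

lemma Lambda_letter:
  assumes T: "transducer T" and q: "q \<in> states T" and fin: "extent T (step T x q) \<noteq> \<infinity>"
  shows "Lambda T [x] q = outl T x q @ Lambda T [] (step T x q)"
proof (rule Lambda_eqI)
  let ?p = "step T x q"
  have sm: "state_map T q ([x] \<frown> y) = outl T x q \<frown> state_map T ?p y" for y
    using state_map_conc[OF T q, of "[x]" y] by simp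
  show "outl T x q @ Lambda T [] ?p \<in> common_prefixes T [x] q"
    using Lambda_in[OF fin] unfolding common_prefixes_def mem_Collect_eq sm conc_empty
    by (metis conc_conc)
  fix v assume v: "v \<in> common_prefixes T [x] q"
  show "length v \<le> length (outl T x q @ Lambda T [] ?p)"
  proof (cases "length (outl T x q) \<le> length v")
    case True
    have "\<exists>z. state_map T ?p y = drop (length (outl T x q)) v \<frown> z" for y
    proof -
      obtain z where "outl T x q \<frown> state_map T ?p y = v \<frown> z"
        using v unfolding common_prefixes_def mem_Collect_eq sm by blast
      then have "suffix (length (outl T x q)) (outl T x q \<frown> state_map T ?p y) =
          suffix (length (outl T x q)) (v \<frown> z)" by simp
      then show ?thesis using True by auto
    qed
    then have "drop (length (outl T x q)) v \<in> common_prefixes T [] ?p"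
      by (simp add: common_prefixes_def)
    from Lambda_max[OF fin this] show ?thesis by simp
  qed simp
qed

section \<open>Deleting the incomplete response\<close>

context
  fixes C :: "('a, 's) transducer"
  assumes C: "transducer C" and fin: "\<not> infinite_case C"
begin

private abbreviation (input) "L q \<equiv> Lambda C [] q"

private abbreviation (input) "R \<equiv> complete_response C"

lemma finite_extent: "q \<in> states C \<Longrightarrow> extent C q \<noteq> \<infinity>"
  using fin by (auto simp: infinite_case_def)

lemma complete_response_simps:
  "states R = states C" "step R = step C"
  "outl R = (\<lambda>x q. drop (length (L q)) (Lambda C [x] q))"
  by (simp_all add: complete_response_def)

lemma complete_response_steps: "steps R w q = steps C w q"
  by (simp add: steps_def complete_response_simps)

text \<open>The form in which the new outputs telescope along a word. The \<open>drop\<close>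
  removes exactly \<open>Lambda C [] q\<close>: both words begin the same image, and a longer
  \<open>Lambda C [] q\<close> would leave the next state a common prefix longer than its greatest
  one.\<close>

lemma Lambda_outl_complete_response:
  assumes q: "q \<in> states C"
  shows "L q @ outl R x q = outl C x q @ L (step C x q)"
proof -
  let ?p = "step C x q" and ?y = "undefined :: nat \<Rightarrow> 'a"
  have p: "?p \<in> states C" by (rule transducerD(3)[OF C q])
  have eq: "Lambda C [x] q = outl C x q @ L ?p"
    by (rule Lambda_letter[OF C q finite_extent[OF p]])
  have sm: "state_map C q ([x] \<frown> y) = outl C x q \<frown> state_map C ?p y" for y
    using state_map_conc[OF C q, of "[x]" y] by simp
  obtain z where 1: "state_map C q ([x] \<frown> ?y) = L q \<frown> z"
    using Lambda_in[OF finite_extent[OF q]] unfolding common_prefixes_def by auto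
  obtain z' where 2: "state_map C ?p ?y = L ?p \<frown> z'"
    using Lambda_in[OF finite_extent[OF p]] unfolding common_prefixes_def by auto
  have "length (L q) \<le> length (outl C x q @ L ?p)"
  proof (rule ccontr)
    assume less: "\<not> ?thesis"
    have "\<exists>z. state_map C ?p y = drop (length (outl C x q)) (L q) \<frown> z" for y
    proof -
      obtain z where "state_map C q ([x] \<frown> y) = L q \<frown> z"
        using Lambda_in[OF finite_extent[OF q]] unfolding common_prefixes_def by auto
      then have "suffix (length (outl C x q)) (outl C x q \<frown> state_map C ?p y) =
          suffix (length (outl C x q)) (L q \<frown> z)" unfolding sm by simp
      then show ?thesis using less by auto
    qed
    then have "drop (length (outl C x q)) (L q) \<in> common_prefixes C [] ?p"
      by (simp add: common_prefixes_def)
    from Lambda_max[OF finite_extent[OF p] this] less show False by simp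
  qed
  moreover have "L q \<frown> z = (outl C x q @ L ?p) \<frown> z'" using 1 2 sm[of ?y] by (metis conc_conc)
  ultimately show ?thesis using prefix_of_conc by (metis complete_response_simps(3) eq)
qed

lemma Lambda_outs_complete_response:
  "q \<in> states C \<Longrightarrow> L q @ outs R w q = outs C w q @ L (steps C w q)"
proof (induction w arbitrary: q)
  case (Cons x w)
  let ?p = "step C x q"
  have "L q @ outs R (x # w) q = outl C x q @ L ?p @ outs R w ?p"
    using Lambda_outl_complete_response[OF Cons.prems, of x]
    by (simp add: complete_response_simps(2))
  then show ?case using Cons.IH[OF transducerD(3)[OF C Cons.prems]] by simp
qed simp

lemma length_outs_complete_response:
  "q \<in> states C \<Longrightarrow> length (L q) + length (outs R w q) = length (outs C w q) + length (L (steps C w q))"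
  by (metis Lambda_outs_complete_response length_append)

text \<open>On a loop the prefixes deleted at both ends are the same word, so the output keeps its
  positive length.\<close>

lemma transducer_complete_response: "transducer R"
  unfolding transducer_def complete_response_simps complete_response_steps
proof (intro conjI allI ballI impI)
  fix w q assume q: "q \<in> states C" and w: "w \<noteq> [] \<and> steps C w q = q"
  then have "outs C w q \<noteq> []" using transducerD(4)[OF C] by blast
  then show "outs R w q \<noteq> []"
    using length_outs_complete_response[OF q, of w] w by auto
qed (use transducerD[OF C] in auto)

lemma state_map_complete_response:
  assumes q: "q \<in> states C"
  shows "state_map C q x = L q \<frown> state_map R q x"
proof -
  obtain z where z: "state_map C q x = L q \<frown> z"
    using Lambda_in[OF finite_extent[OF q]] unfolding common_prefixes_def by auto
  have "\<exists>y. z = outs R (prefix k x) q \<frown> y" for k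
  proof -
    let ?p = "steps C (prefix k x) q"
    have "state_map C q x = outs C (prefix k x) q \<frown> state_map C ?p (suffix k x)"
      using state_map_conc[OF C q, of "prefix k x" "suffix k x"] by simp
    moreover obtain y where "state_map C ?p (suffix k x) = L ?p \<frown> y"
      using Lambda_in[OF finite_extent[OF steps_closed[OF C q]]]
      unfolding common_prefixes_def by auto
    ultimately have "L q \<frown> z = (L q @ outs R (prefix k x) q) \<frown> y"
      unfolding Lambda_outs_complete_response[OF q] by (simp add: z)
    then have "L q \<frown> z = L q \<frown> (outs R (prefix k x) q \<frown> y)" by simp
    then show ?thesis unfolding same_concat_eq by blast
  qed
  then have "state_map R q x = z"
    by (intro state_map_eqI[OF transducer_complete_response])
      (simp_all add: complete_response_simps q)
  with z show ?thesis by simp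
qed

lemma full_response_complete_response: "full_response R"
  unfolding full_response_def incomplete_response_iff
proof (intro ballI notI)
  fix q assume "q \<in> states R" and "\<exists>c. \<forall>x. state_map R q x 0 = c"
  then obtain c where q: "q \<in> states C" and c: "\<And>x. state_map R q x 0 = c"
    by (auto simp: complete_response_simps)
  have "state_map R q x = [c] \<frown> suffix 1 (state_map R q x)" for x
    using c[of x] by (simp add: fun_eq_iff conc_def)
  then have "\<exists>z. state_map C q x = (L q @ [c]) \<frown> z" for x
    unfolding state_map_complete_response[OF q] by (metis conc_conc)
  then have "L q @ [c] \<in> common_prefixes C [] q" by (simp add: common_prefixes_def)
  from Lambda_max[OF finite_extent[OF q] this] show False by simp
qed

lemma sync_level_complete_response: "sync_level R = sync_level C"
  by (simp add: sync_level_def complete_response_simps complete_response_steps fun_eq_iff)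

lemma forced_complete_response: "forced R = forced C"
  by (simp add: forced_def complete_response_simps complete_response_steps fun_eq_iff)

lemma past_state_complete_response: "past_state R = past_state C"
  by (simp add: past_state_def sync_level_complete_response forced_complete_response fun_eq_iff)

lemma sync_core_complete_response: "sync_core C \<Longrightarrow> sync_core R"
  using transducer_complete_response
  by (simp add: sync_core_def strongly_synchronizing_def sync_level_complete_response
      core_eq_iff forced_complete_response complete_response_simps)

lemma annotation_complete_response:
  assumes "annotation C v"
  shows "annotation R (\<lambda>q. v q + int (length (L q)))"
  unfolding annotation_def complete_response_simps complete_response_steps
proof (intro allI ballI)
  fix w q assume q: "q \<in> states C"
  then have "v (steps C w q) = v q + int (length (outs C w q)) - int (length w)"
    using assms unfolding annotation_def by blast
  then show "v (steps C w q) + int (length (L (steps C w q))) =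
      v q + int (length (L q)) + int (length (outs R w q)) - int (length w)"
    using length_outs_complete_response[OF q, of w] by simp
qed

lemma realizes_complete_response:
  assumes core: "sync_core C" and r: "realizes C v g"
  shows "realizes R (\<lambda>q. v q + int (length (L q))) g"
  unfolding realizes_def past_state_complete_response
proof (intro allI ext)
  fix x i n
  let ?q = "past_state C x i"
  have "future (g x) (i + v ?q) (length (L ?q) + n) =
      (L ?q \<frown> state_map R ?q (future x i)) (length (L ?q) + n)"
    using r state_map_complete_response[OF past_state_closed[OF core]]
    unfolding realizes_def by simp
  then show "future (g x) (i + (v ?q + int (length (L ?q)))) n = state_map R ?q (future x i) n"
    by (simp add: future_def algebra_simps)
qed

end

section \<open>Identification of omega-equivalent states\<close>

definition omega_class :: "('a, 's) transducer \<Rightarrow> 's \<Rightarrow> 's set" where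
  "omega_class T q = {p \<in> states T. omega_equiv T p T q}"

text \<open>Kept apart from \<open>reduct\<close> because it serves twice: after the deletion of
  incomplete response, and to make block transducers weakly minimal.\<close>

definition omega_quotient :: "('a, 's) transducer \<Rightarrow> ('a, 's set) transducer" where
  "omega_quotient T =
     \<lparr>states = omega_class T ` states T,
      step = (\<lambda>x c. omega_class T (step T x (SOME q. q \<in> c))),
      outl = (\<lambda>x c. outl T x (SOME q. q \<in> c))\<rparr>"

lemma omega_class_eq_iff:
  "p \<in> states T \<Longrightarrow> omega_class T p = omega_class T q \<longleftrightarrow> omega_equiv T p T q"
  unfolding omega_class_def omega_equiv_def by auto

text \<open>With equal outputs on a letter, cancelling them shows that the successors of equivalent
  states are equivalent. The hypothesis \<open>out\<close> holds in both uses, by complete response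
  or because all outputs have length 1.\<close>

lemma
  assumes T: "transducer T"
    and out: "\<And>p q x. p \<in> states T \<Longrightarrow> q \<in> states T \<Longrightarrow> omega_equiv T p T q \<Longrightarrow> outl T x p = outl T x q"
  shows trans_hom_omega_quotient: "trans_hom (omega_class T) T (omega_quotient T)"
    and weakly_minimal_omega_quotient: "weakly_minimal (omega_quotient T)"
proof -
  show hom: "trans_hom (omega_class T) T (omega_quotient T)"
    unfolding trans_hom_def
  proof (intro conjI ballI allI)
    fix q x assume q: "q \<in> states T"
    define p where "p = (SOME p. p \<in> omega_class T q)"
    have "\<exists>p. p \<in> omega_class T q" using q by (auto simp: omega_class_def omega_equiv_def)
    then have "p \<in> omega_class T q" unfolding p_def by (rule someI_ex)
    then have p: "p \<in> states T" "omega_equiv T p T q" by (auto simp: omega_class_def)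
    have o: "outl T x p = outl T x q" by (rule out[OF p(1) q p(2)])
    then show "outl (omega_quotient T) x (omega_class T q) = outl T x q"
      by (simp add: omega_quotient_def p_def)
    have "outl T x p \<frown> state_map T (step T x p) y = outl T x q \<frown> state_map T (step T x q) y" for y
      using state_map_conc[OF T p(1), of "[x]" y] state_map_conc[OF T q, of "[x]" y] p(2)
      by (simp add: omega_equiv_def)
    then have "omega_equiv T (step T x p) T (step T x q)"
      unfolding omega_equiv_def o same_concat_eq by blast
    then show "step (omega_quotient T) x (omega_class T q) = omega_class T (step T x q)"
      using omega_class_eq_iff[OF transducerD(3)[OF T p(1)]]
      by (simp add: omega_quotient_def p_def)
  qed (simp add: omega_quotient_def)
  show "weakly_minimal (omega_quotient T)"
    unfolding weakly_minimal_def
  proof (intro ballI impI)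
    fix c d assume "c \<in> states (omega_quotient T)" "d \<in> states (omega_quotient T)"
      and eq: "omega_equiv (omega_quotient T) c (omega_quotient T) d"
    then obtain p q where pq: "p \<in> states T" "q \<in> states T" "c = omega_class T p" "d = omega_class T q"
      by (auto simp: omega_quotient_def)
    then have "omega_equiv T p T q"
      using eq trans_hom_state_map[OF hom T] by (simp add: omega_equiv_def)
    then show "c = d" using omega_class_eq_iff[OF pq(1)] pq by blast
  qed
qed

text \<open>A word of synchronizing length leads both states to the same state with the same output;
  solving the annotation equation backwards gives equal values. Hence \<open>descend\<close> is well
  defined on the reduct.\<close>

lemma annotation_omega_equiv:
  assumes T: "sync_core T" "full_response T" "annotation T a"
    and pq: "p \<in> states T" "q \<in> states T" "omega_equiv T p T q"
  shows "a p = a q"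
proof -
  note tr = sync_coreD(1)[OF T(1)]
  obtain k where k: "sync_level T k" using sync_coreD(2)[OF T(1)] by blast
  let ?w = "replicate k (undefined :: 'a)"
  have "steps T ?w p = steps T ?w q"
    using k pq(1,2) unfolding sync_level_def by (metis length_replicate)
  moreover have "outs T ?w p = outs T ?w q" by (rule full_response_outs_eq[OF tr T(2) tr T(2) pq])
  ultimately have *: "a (steps T ?w p) = a (steps T ?w q)"
    "length (outs T ?w p) = length (outs T ?w q)" by simp_all
  have "a (steps T ?w r) = a r + int (length (outs T ?w r)) - int (length ?w)"
    if "r \<in> states T" for r
    using that T(3) unfolding annotation_def by blast
  from this[OF pq(1)] this[OF pq(2)] * show ?thesis by linarith
qed

lemma
  fixes C :: "('a::linorder, 's) transducer"
  assumes C: "transducer C" and fin: "\<not> infinite_case C"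
  shows kappa_eq: "kappa C = omega_class (complete_response C)"
    and trans_hom_reduct: "trans_hom (kappa C) (complete_response C) (reduct C)"
    and weakly_minimal_reduct: "weakly_minimal (reduct C)"
proof -
  let ?R = "complete_response C"
  note R = transducer_complete_response[OF C fin] full_response_complete_response[OF C fin]
  have st: "states ?R = states C" "step ?R = step C" by (simp_all add: complete_response_def)
  show kappa: "kappa C = omega_class ?R"
    using fin by (simp add: kappa_def omega_class_def st fun_eq_iff)
  have red: "reduct C = omega_quotient ?R"
    using fin by (simp add: reduct_def omega_quotient_def kappa st)
  have out: "outl ?R x p = outl ?R x q"
    if "p \<in> states ?R" "q \<in> states ?R" "omega_equiv ?R p ?R q" for p q x
    using full_response_outs_eq(1)[OF R R that, of "[x]"] by simp
  show "trans_hom (kappa C) ?R (reduct C)"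
    unfolding kappa red by (rule trans_hom_omega_quotient[OF R(1) out])
  show "weakly_minimal (reduct C)"
    unfolding red by (rule weakly_minimal_omega_quotient[OF R(1) out])
qed

lemma reduct_finite_case:
  fixes C :: "('a::linorder, 's) transducer"
  assumes C: "sync_core C" "annotation C v" "realizes C v g" and fin: "\<not> infinite_case C"
  shows "is_AL (reduct C, Some (descend C (\<lambda>q. v q + int (length (Lambda C [] q)))))"
    and "realizes (reduct C) (descend C (\<lambda>q. v q + int (length (Lambda C [] q)))) g"
proof -
  note tr = sync_coreD(1)[OF C(1)]
  let ?R = "complete_response C" and ?v = "\<lambda>q. v q + int (length (Lambda C [] q))"
  have R: "transducer ?R" "full_response ?R" "sync_core ?R" "annotation ?R ?v" "realizes ?R ?v g"
    using transducer_complete_response[OF tr fin] full_response_complete_response[OF tr fin]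
      sync_core_complete_response[OF tr fin C(1)] annotation_complete_response[OF tr fin C(2)]
      realizes_complete_response[OF tr fin C(1,3)] by blast+
  note hom = trans_hom_reduct[OF tr fin]
  have st: "states ?R = states C" by (simp add: complete_response_def)
  have desc: "descend C ?v (kappa C q) = ?v q" if "q \<in> states ?R" for q
    unfolding descend_def kappa_eq[OF tr fin]
  proof (rule the_equality)
    show "\<forall>p\<in>states C. omega_class ?R p = omega_class ?R q \<longrightarrow> ?v p = ?v q"
      using annotation_omega_equiv[OF R(3,2,4) _ that] omega_class_eq_iff[of _ ?R q]
      by (simp add: st)
  qed (use that st in auto)
  show "realizes (reduct C) (descend C ?v) g"
    by (rule trans_hom_realizes[OF hom R(3,5) desc])
  show "is_AL (reduct C, Some (descend C ?v))"
    unfolding is_AL_Some_iff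
    using trans_hom_sync_core[OF hom R(3)] weakly_minimal_reduct[OF tr fin]
      trans_hom_full_response[OF hom R(1,2)] trans_hom_annotation[OF hom R(1,4) desc] by blast
qed

section \<open>Infinite extent and constant endomorphisms\<close>

lemma infinite_case_constant:
  fixes C :: "('a::finite, 's) transducer"
  assumes C: "sync_core C" and r: "realizes C v g" and g: "g \<in> carrier End_shift"
    and inf: "infinite_case C"
  shows "\<exists>d. g = (\<lambda>_ _. d)"
proof -
  obtain q where q: "q \<in> states C" "extent C q = \<infinity>" using inf unfolding infinite_case_def by blast
  have const: "state_map C q y = state_map C q z" for y z
  proof
    fix n
    have "enat n < extent C q" using q(2) by simp
    then obtain u where "u \<in> common_prefixes C [] q" "n < length u"
      unfolding extent_def less_SUP_iff by auto
    then obtain y' z' where "state_map C q y = u \<frown> y'" "state_map C q z = u \<frown> z'"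
      unfolding common_prefixes_def mem_Collect_eq conc_empty by blast
    with \<open>n < length u\<close> show "state_map C q y n = state_map C q z n" by simp
  qed
  obtain x0 where x0: "past_state C x0 0 = q" using past_state_ex[OF C q(1)] by blast
  obtain m :: nat where m: "\<And>x y j. (\<And>i. \<bar>i - j\<bar> \<le> int m \<Longrightarrow> x i = y i) \<Longrightarrow> g x j = g y j"
    using End_shift_window[OF g] by metis
  \<comment> \<open>Position \<open>J\<close> lies in the part written from state \<open>q\<close>,
    whose state map is constant, and its window lies at nonnegative positions, where replacing the
    past of \<open>x\<close> by that of \<open>x0\<close> changes nothing. So the letter at
    \<open>J\<close> is the same for all \<open>x\<close>.\<close>
  define J where "J = \<bar>v q\<bar> + int m"
  have "v q \<le> J" unfolding J_def by linarith
  have J: "g x J = state_map C q undefined (nat (J - v q))" for x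
  proof -
    have "g x J = g (glue 0 x0 (future x 0)) J"
      by (rule m) (auto simp: J_def glue_def future_def)
    also have "\<dots> = future (g (glue 0 x0 (future x 0))) (0 + v q) (nat (J - v q))"
      using \<open>v q \<le> J\<close> by (simp add: future_def)
    also have "\<dots> = state_map C q undefined (nat (J - v q))"
      unfolding realizes_glue[OF r x0] using const by metis
    finally show ?thesis .
  qed
  have "g x j = state_map C q undefined (nat (J - v q))" for x j
    using J[of "shift_by (J - j) x"] unfolding End_shift_commute[OF g] by (simp add: shift_by_def)
  then show ?thesis by blast
qed

text \<open>The constant image begins with the rotated word, so all letters of \<open>x\<close> are
  \<open>d\<close>; a prime word of this kind has length 1.\<close>

lemma root_word_constant:
  assumes q: "q \<in> states C" and const: "\<And>q x. q \<in> states C \<Longrightarrow> state_map C q x = (\<lambda>_. d)"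
  shows "root_word C = [d]"
  unfolding root_word_def
proof (rule the_equality)
  have eq: "state_map (Z () [d]) () = (\<lambda>_ _. d)"
    using is_Z_letter(4)[of "Z () [d]" d "()"] by (auto simp: is_Z_def Z_def)
  have "prime_word [d]" by (auto simp: prime_word_def)
  moreover have "least_rotation [d]" by (simp add: least_rotation_def)
  moreover have "omega_equiv C p (Z () (rotate 0 [d])) ()" if "p \<in> states C" for p
    using const[OF that] eq by (simp add: omega_equiv_def fun_eq_iff)
  ultimately show "prime_word [d] \<and> least_rotation [d] \<and>
      (\<forall>q\<in>states C. \<exists>m. omega_equiv C q (Z () (rotate m [d])) ())" by blast
next
  fix x assume x: "prime_word x \<and> least_rotation x \<and>
      (\<forall>q\<in>states C. \<exists>m. omega_equiv C q (Z () (rotate m x)) ())"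
  then obtain m where m: "omega_equiv C q (Z () (rotate m x)) ()" using q by blast
  let ?Z = "Z () (rotate m x)"
  have ne: "x \<noteq> []" using x by (simp add: prime_word_def)
  have "outs ?Z w () \<noteq> []" if "w \<noteq> []" for w
    using that ne by (cases w) (auto simp: Z_def)
  then have T: "transducer ?Z" unfolding transducer_def by (auto simp: Z_def)
  have "\<exists>z. (\<lambda>_. d) = outs ?Z (prefix 1 undefined) () \<frown> z"
    using state_map_prefix_ex[OF T, of "()" undefined 1] m const[OF q]
    by (simp add: omega_equiv_def Z_def)
  moreover have "outs ?Z (prefix 1 undefined) () = rotate m x"
    by (simp add: subsequence_def Z_def)
  ultimately have "\<forall>n<length x. rotate m x ! n = d"
    using conc_eq_nth[of "\<lambda>_. d" "rotate m x"] by (metis length_rotate)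
  then have "set (rotate m x) \<subseteq> {d}" by (auto simp: in_set_conv_nth simp del: set_rotate)
  then have repl: "x = replicate (length x) d"
    using replicate_eqI[of x "length x" d] by auto
  have "concat (replicate n [d]) = replicate n d" for n by (induction n) auto
  then have rep: "x = concat (replicate (length x) [d])" using repl by (rule ssubst)
  have "\<not> length [d] < length x"
    using x rep unfolding prime_word_def by blast
  then have "length x = 1" using ne by (cases x) auto
  from subst[where P = "\<lambda>n. x = replicate n d", OF this repl]
  show "x = [d]" by simp
qed

text \<open>The test for \<open>is_Z (reduct C) [b]\<close> detects exactly the infinite case: in
  the finite case the reduct has complete response, and such a transducer realizes no constant
  map.\<close>

lemma reduct_realizes:
  fixes C :: "('a::{finite, linorder}, 's) transducer"
  assumes C: "sync_core C" "annotation C v" and r: "realizes C v g" and g: "g \<in> carrier End_shift"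
  defines "\<alpha> \<equiv> if \<exists>b. is_Z (reduct C) [b] then None
    else Some (descend C (\<lambda>q. v q + int (length (Lambda C [] q))))"
  shows "is_AL (reduct C, \<alpha>)" "realizes_annotated (reduct C, \<alpha>) g"
proof -
  have "is_AL (reduct C, \<alpha>) \<and> realizes_annotated (reduct C, \<alpha>) g"
  proof (cases "infinite_case C")
    case True
    then obtain d where d: "g = (\<lambda>_ _. d)" using infinite_case_constant[OF C(1) r g] by blast
    have "state_map C q x = (\<lambda>_. d)" if "q \<in> states C" for q x
    proof -
      obtain y where y: "past_state C y 0 = q" using past_state_ex[OF C(1) \<open>q \<in> states C\<close>] by blast
      from realizes_glue[OF r y] show ?thesis by (simp add: d future_def)
    qed
    moreover obtain q where "q \<in> states C" using sync_coreE[OF C(1)] by blast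
    ultimately have "root_word C = [d]" using root_word_constant by metis
    then have Z: "is_Z (reduct C) [d]" using True by (auto simp: reduct_def Z_def is_Z_def)
    then have "\<alpha> = None" by (auto simp: \<alpha>_def)
    then show ?thesis using is_Z_letter(1,3)[OF Z] Z by (auto simp: d sync_core_def)
  next
    case False
    note red = reduct_finite_case[OF C r False]
    have "\<not> is_Z (reduct C) [b]" for b
    proof
      assume Z: "is_Z (reduct C) [b]"
      have "sync_core (reduct C)" "full_response (reduct C)" using red(1)[unfolded is_AL_Some_iff] by auto
      from full_response_not_constant[OF this is_Z_letter(3)[OF Z]] show False by blast
    qed
    then show ?thesis using red by (simp add: \<alpha>_def del: is_AL.simps)
  qed
  then show "is_AL (reduct C, \<alpha>)" "realizes_annotated (reduct C, \<alpha>) g" by blast+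
qed


section \<open>Products\<close>

lemma core_simps [simp]: "step (core T) = step T" "outl (core T) = outl T"
  by (simp_all add: core_def)

lemma steps_core [simp]: "steps (core T) w q = steps T w q"
  by (simp add: steps_def)

lemma outs_core [simp]: "outs (core T) w q = outs T w q"
  by (induction w arbitrary: q) auto

lemma state_map_core [simp]: "state_map (core T) q = state_map T q"
  by (simp add: state_map_def fun_eq_iff)

lemma sync_level_core:
  assumes T: "transducer T" and k: "sync_level T k"
  shows "states (core T) \<subseteq> states T" "sync_level (core T) k" "sync_core (core T)"
proof -
  obtain q0 where q0: "q0 \<in> states T" using transducerD(2)[OF T] by blast
  have st: "q \<in> states (core T) \<longleftrightarrow> (\<exists>w. sync_level T (length w) \<and> q = steps T w q0)" for q
  proof -
    have "q \<in> states (core T) \<longleftrightarrow> (\<exists>w. sync_level T (length w) \<and> q = forced T w)"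
      by (auto simp: core_def)
    then show ?thesis using forced_eq[OF _ q0] by metis
  qed
  show sub: "states (core T) \<subseteq> states T" using st steps_closed[OF T q0] by auto
  then have lvl: "sync_level (core T) m" if "sync_level T m" for m
    using that unfolding sync_level_def by simp blast
  show "sync_level (core T) k" by (rule lvl[OF k])
  have "transducer (core T)"
    unfolding transducer_def
  proof (intro conjI allI ballI impI)
    show "finite (states (core T))" using sub transducerD(1)[OF T] finite_subset by blast
    have "steps T (replicate k undefined) q0 \<in> states (core T)"
      using k st by (metis length_replicate)
    then show "states (core T) \<noteq> {}" by blast
  next
    fix x q assume "q \<in> states (core T)"
    then obtain w where "sync_level T (length w)" "q = steps T w q0" using st by blast
    then show "step (core T) x q \<in> states (core T)"
      using st sync_level_mono[OF T, of "length w" "length (w @ [x])"]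
      by (auto intro!: exI[of _ "w @ [x]"])
  next
    fix w q assume "q \<in> states (core T)" "w \<noteq> [] \<and> steps (core T) w q = q"
    then show "outs (core T) w q \<noteq> []" using transducerD(4)[OF T] sub by auto
  qed
  then show "sync_core (core T)"
  proof (rule sync_coreI[OF _ lvl[OF k]])
    fix q assume q: "q \<in> states (core T)"
    then obtain w where w: "sync_level T (length w)" "q = steps T w q0" using st by blast
    have "steps T w q = steps T w q0" using w(1) sub q q0 unfolding sync_level_def by blast
    then have "q = forced (core T) w" using forced_eq[OF lvl[OF w(1)] q] w(2) by simp
    with lvl[OF w(1)] show "\<exists>w. sync_level (core T) (length w) \<and> q = forced (core T) w" by blast
  qed
qed

lemma steps_prod [simp]:
  "steps (prod_transducer T U) w (s, t) = (steps T w s, steps U (outs T w s) t)"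
  by (induction w arbitrary: s t) (auto simp: prod_transducer_def)

lemma outs_prod [simp]: "outs (prod_transducer T U) w (s, t) = outs U (outs T w s) t"
  by (induction w arbitrary: s t) (auto simp: prod_transducer_def)

lemma states_prod [simp]: "states (prod_transducer T U) = states T \<times> states U"
  by (simp add: prod_transducer_def)

lemma transducer_prod:
  assumes T: "transducer T" and U: "transducer U"
  shows "transducer (prod_transducer T U)"
  unfolding transducer_def
proof (intro conjI allI ballI impI)
  fix x q assume "q \<in> states (prod_transducer T U)"
  then show "step (prod_transducer T U) x q \<in> states (prod_transducer T U)"
    using transducerD(3)[OF T] steps_closed[OF U] by (auto simp: prod_transducer_def)
next
  fix w q assume q: "q \<in> states (prod_transducer T U)"
    and w: "w \<noteq> [] \<and> steps (prod_transducer T U) w q = q"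
  obtain s t where st: "q = (s, t)" "s \<in> states T" "t \<in> states U" using q by auto
  have "outs T w s \<noteq> []" using transducerD(4)[OF T st(2)] w st(1) by simp
  then show "outs (prod_transducer T U) w q \<noteq> []"
    using transducerD(4)[OF U st(3)] w st(1) by simp
qed (use transducerD[OF T] transducerD[OF U] in auto)

text \<open>The first \<open>k\<close> letters bring \<open>T\<close> to a common state. From there
  both runs feed \<open>U\<close> the same word, and by \<open>outs_length\<close> another
  \<open>m * card (states T)\<close> letters of input make it at least \<open>m\<close> letters
  long.\<close>

lemma sync_level_prod:
  assumes T: "transducer T" "sync_level T k" and U: "transducer U" "sync_level U m"
  shows "sync_level (prod_transducer T U) (k + m * card (states T))"
  unfolding sync_level_def
proof (intro allI impI ballI)
  fix w :: "'a list" and p q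
  assume len: "length w = k + m * card (states T)"
    and "p \<in> states (prod_transducer T U)" "q \<in> states (prod_transducer T U)"
  then obtain s t s' t' where st: "p = (s, t)" "q = (s', t')" "s \<in> states T" "t \<in> states U"
    "s' \<in> states T" "t' \<in> states U" by auto
  define u v where "u = take k w" and "v = drop k w"
  have w: "w = u @ v" "length u = k" "length v = m * card (states T)"
    using len by (auto simp: u_def v_def)
  define r where "r = steps T u s"
  have r: "steps T u s' = r" "r \<in> states T"
    using T(2) w(2) st steps_closed[OF T(1)] unfolding sync_level_def r_def by metis+
  have "m \<le> length (outs T v r)" using outs_length[OF T(1) r(2)] w(3) by simp
  then have "sync_level U (length (outs T v r))" using sync_level_mono[OF U] by blast
  then have "steps U (outs T v r) (steps U (outs T u s) t) = steps U (outs T v r) (steps U (outs T u s') t')"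
    using st steps_closed[OF U(1)] unfolding sync_level_def by blast
  then show "steps (prod_transducer T U) w p = steps (prod_transducer T U) w q"
    by (simp add: st w(1) r(1) r_def[symmetric])
qed

lemma state_map_prod:
  assumes T: "transducer T" and U: "transducer U" and s: "s \<in> states T" and t: "t \<in> states U"
  shows "state_map (prod_transducer T U) (s, t) x = state_map U t (state_map T s x)"
proof (rule state_map_eqI[OF transducer_prod[OF T U]])
  fix k
  obtain z where "state_map T s x = outs T (prefix k x) s \<frown> z"
    using state_map_prefix_ex[OF T s] by blast
  then show "\<exists>z. state_map U t (state_map T s x) = outs (prod_transducer T U) (prefix k x) (s, t) \<frown> z"
    using state_map_conc[OF U t] by auto
qed (use s t in simp)

lemma
  assumes T: "sync_core T" "annotation T a" "realizes T a f"
    and U: "sync_core U" "annotation U b" "realizes U b g"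
  defines "C \<equiv> core (prod_transducer T U)" and "v \<equiv> \<lambda>(s, t). a s + b t"
  shows sync_core_prod: "sync_core C"
    and annotation_prod: "annotation C v"
    and realizes_prod: "realizes C v (g \<circ> f)"
proof -
  let ?D = "prod_transducer T U"
  note trT = sync_coreD(1)[OF T(1)] and trU = sync_coreD(1)[OF U(1)]
  note trD = transducer_prod[OF trT trU]
  obtain k m where "sync_level T k" "sync_level U m" using sync_coreD(2) T(1) U(1) by metis
  then obtain K where K: "sync_level ?D K" using sync_level_prod trT trU by blast
  note C = sync_level_core[OF trD K, folded C_def]
  show core: "sync_core C" by (rule C(3))
  show "annotation C v"
    unfolding annotation_def
  proof (intro allI ballI)
    fix w q assume "q \<in> states C"
    with C(1) obtain s t where q: "q = (s, t)" "s \<in> states T" "t \<in> states U" by auto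
    have "a (steps T w s) = a s + int (length (outs T w s)) - int (length w)"
      using T(2) q unfolding annotation_def by blast
    moreover have "b (steps U (outs T w s) t) =
        b t + int (length (outs U (outs T w s) t)) - int (length (outs T w s))"
      using U(2) q unfolding annotation_def by blast
    ultimately show "v (steps C w q) = v q + int (length (outs C w q)) - int (length w)"
      by (simp add: v_def C_def q)
  qed
  \<comment> \<open>When \<open>T\<close> is about to read position \<open>i\<close> of
    \<open>x\<close>, it has written \<open>f x\<close> up to just before
    \<open>i + a (past_state T x i)\<close>, and this is where \<open>U\<close> stands in
    \<open>f x\<close>.\<close>
  have past: "past_state C x i = (past_state T x i, past_state U (f x) (i + a (past_state T x i)))"
    for x i
  proof -
    let ?k = "i - int K"
    let ?s = "past_state T x ?k"
    let ?t = "past_state U (f x) (?k + a ?s)"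
    let ?w = "segment x ?k i"
    have st: "?s \<in> states T" "?t \<in> states U" using past_state_closed T(1) U(1) by blast+
    obtain q j where q: "q \<in> states C" using sync_coreE[OF core] by blast
    have "past_state C x i = steps ?D ?w q"
      using past_state_eq[OF sync_coreD(1)[OF core] C(2) q] by (simp add: C_def)
    also have "\<dots> = steps ?D ?w (?s, ?t)"
    proof -
      have "length ?w = K" "q \<in> states ?D" "(?s, ?t) \<in> states ?D" using q C(1) st by auto
      with K show ?thesis unfolding sync_level_def by blast
    qed
    also have "\<dots> = (past_state T x i, past_state U (f x) (i + a (past_state T x i)))"
      using past_state_steps[OF T(1), of ?k i x] realizes_segment[OF T, of ?k i x]
        past_state_steps[OF U(1), of "?k + a ?s" "i + a (past_state T x i)" "f x"]
        annotation_past_state[OF T(1,2), of ?k i x] by simp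
    finally show ?thesis .
  qed
  show "realizes C v (g \<circ> f)"
    unfolding realizes_def
  proof (intro allI)
    fix x i
    let ?s = "past_state T x i"
    let ?t = "past_state U (f x) (i + a ?s)"
    have st: "?s \<in> states T" "?t \<in> states U" using past_state_closed T(1) U(1) by blast+
    have "future (g (f x)) (i + a ?s + b ?t) = state_map U ?t (state_map T ?s (future x i))"
      using T(3) U(3) unfolding realizes_def by metis
    also have "\<dots> = state_map C (?s, ?t) (future x i)"
      using state_map_prod[OF trT trU st] by (simp add: C_def)
    finally show "future ((g \<circ> f) x) (i + v (past_state C x i)) =
        state_map C (past_state C x i) (future x i)"
      unfolding past by (simp add: v_def add.assoc)
  qed
qed

section \<open>The monoid of endomorphisms and products of annotated transducers\<close>

lemma monoid_End_shift: "monoid (End_shift :: ((int \<Rightarrow> 'a) \<Rightarrow> (int \<Rightarrow> 'a)) monoid)"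
proof (rule monoidI)
  fix f g :: "(int \<Rightarrow> 'a) \<Rightarrow> (int \<Rightarrow> 'a)"
  assume fg: "f \<in> carrier End_shift" "g \<in> carrier End_shift"
  then have "f \<circ> shift = shift \<circ> f" "g \<circ> shift = shift \<circ> g" by (simp_all add: End_shift_def)
  then have "(g \<circ> f) \<circ> shift = shift \<circ> (g \<circ> f)" by (metis comp_assoc)
  then show "f \<otimes>\<^bsub>End_shift\<^esub> g \<in> carrier End_shift"
    using fg continuous_map_compose by (auto simp: End_shift_def)
qed (auto simp: End_shift_def o_assoc)

lemma mult_End_shift [simp]: "f \<otimes>\<^bsub>End_shift\<^esub> g = g \<circ> f"
  and one_End_shift [simp]: "\<one>\<^bsub>End_shift\<^esub> = id"
  by (simp_all add: End_shift_def)

lemma comp_End_shift: "f \<in> carrier End_shift \<Longrightarrow> g \<in> carrier End_shift \<Longrightarrow> g \<circ> f \<in> carrier End_shift"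
  using monoid.m_closed[OF monoid_End_shift] by fastforce

lemma End_shift_constant:
  assumes "g \<in> carrier End_shift"
  shows "\<exists>c. g (\<lambda>_. b) = (\<lambda>_. c)"
proof -
  have "g (\<lambda>_. b) j = g (\<lambda>_. b) 0" for j
    using fun_cong[OF End_shift_commute[OF assms, of "- j" "\<lambda>_. b"], of 0] by (simp add: shift_by_def)
  then show ?thesis by blast
qed

lemma mult_annotated_realizes:
  fixes A :: "('a::{finite, linorder}, 's) annotated" and B :: "('a, 't) annotated"
  assumes A: "is_AL A" "realizes_annotated A f" "f \<in> carrier End_shift"
    and B: "is_AL B" "realizes_annotated B g" "g \<in> carrier End_shift"
  shows "is_AL (mult_annotated A B)" "realizes_annotated (mult_annotated A B) (g \<circ> f)"
proof -
  obtain T \<alpha> U \<beta> where AB: "A = (T, \<alpha>)" "B = (U, \<beta>)" by (metis surj_pair)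
  let ?a = "annotation_fun \<alpha>" and ?b = "annotation_fun \<beta>"
  have T: "sync_core T" "annotation T ?a" "realizes T ?a f"
    and U: "sync_core U" "annotation U ?b" "realizes U ?b g"
    using A B is_AL_realizable unfolding AB by auto
  define C where "C = core (prod_transducer T U)"
  define v where "v = (\<lambda>(s, t). ?a s + ?b t)"
  note C = sync_core_prod[OF T U, folded C_def] annotation_prod[OF T U, folded C_def v_def]
    realizes_prod[OF T U, folded C_def v_def]
  define \<gamma> where "\<gamma> = (if \<exists>b. is_Z (reduct C) [b] then None
    else Some (descend C (\<lambda>q. v q + int (length (Lambda C [] q)))))"
  note red = reduct_realizes[OF C comp_End_shift[OF A(3) B(3)], folded \<gamma>_def]
  have "mult_annotated A B = (reduct C, \<gamma>)"
  proof (cases "\<exists>b. is_Z (reduct C) [b]")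
    case True
    then show ?thesis
      by (simp add: AB Let_def \<gamma>_def C_def[symmetric] mult_transducer_def)
  next
    case False
    \<comment> \<open>If the product is no \<open>Z\<close> of a letter, then the composition is not
      constant, hence neither factor is; so both annotations are integer-valued and
      \<open>mult_annotated\<close> adds them.\<close>
    have nc: "\<nexists>c. g \<circ> f = (\<lambda>_ _. c)"
      using realizes_annotated_None(2)[OF red(1)] red(2) False by metis
    have "\<nexists>c. f = (\<lambda>_ _. c)"
    proof
      assume "\<exists>c. f = (\<lambda>_ _. c)"
      then obtain c where c: "f = (\<lambda>_ _. c)" by blast
      obtain d where "g (\<lambda>_. c) = (\<lambda>_. d)" using End_shift_constant[OF B(3)] by blast
      then have "g \<circ> f = (\<lambda>_ _. d)" by (simp add: c comp_def)
      with nc show False by blast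
    qed
    moreover have "\<nexists>c. g = (\<lambda>_ _. c)" using nc by (metis comp_apply ext)
    ultimately obtain a b where "\<alpha> = Some a" "\<beta> = Some b"
      using realizes_annotated_Some[of T \<alpha> f] realizes_annotated_Some[of U \<beta> g] A B
      unfolding AB by blast
    moreover from this
    have "v q + int (length (Lambda C [] q)) =
        (\<lambda>(s, t). a s + b t + int (length (Lambda C [] (s, t)))) q" for q
      by (simp add: v_def split_beta)
    ultimately show ?thesis
      using False by (simp add: AB Let_def \<gamma>_def C_def[symmetric] mult_transducer_def)
  qed
  then show "is_AL (mult_annotated A B)" "realizes_annotated (mult_annotated A B) (g \<circ> f)"
    using red by (simp_all del: is_AL.simps)
qed

section \<open>Synchronous transducers\<close>

lemma synchronous_length_outs:
  "transducer T \<Longrightarrow> synchronous T \<Longrightarrow> q \<in> states T \<Longrightarrow> length (outs T w q) = length w"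
  by (induction w arbitrary: q) (auto simp: synchronous_def dest: transducerD(3))

lemma synchronous_annotation:
  "transducer T \<Longrightarrow> synchronous T \<Longrightarrow> annotation T (\<lambda>_. i)"
  by (simp add: annotation_def synchronous_length_outs)

lemma End_shift_id: "id \<in> carrier End_shift"
  using monoid.one_closed[OF monoid_End_shift] by simp

lemma P_map_eq: "P_map T x i = hd (outl T (x i) (past_state T x i))"
  by (simp add: P_map_def past_state_def segment_def Let_def)

text \<open>Some endomorphism is realized with annotation 0, and its letter at \<open>i\<close> is
  the first letter written from the forced state. Identifying it with \<open>P_map\<close> gives
  continuity and shift commutation of the latter as well.\<close>

lemma
  fixes T :: "('a::finite, 's) transducer"
  assumes T: "sync_core T" "synchronous T"
  shows realizes_P_map: "realizes T (\<lambda>_. 0) (P_map T)"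
    and P_map_End_shift: "P_map T \<in> carrier End_shift"
proof -
  note tr = sync_coreD(1)[OF T(1)]
  obtain g where g: "g \<in> carrier End_shift" "realizes T (\<lambda>_. 0) g"
    using realizes_ex[OF T(1) synchronous_annotation[OF tr T(2)]] by blast
  have "g x i = P_map T x i" for x i
  proof -
    let ?q = "past_state T x i"
    have q: "?q \<in> states T" by (rule past_state_closed[OF T(1)])
    have "g x i = future (g x) (i + 0) 0" by (simp add: future_def)
    also have "\<dots> = state_map T ?q (future x i) 0" using g(2) unfolding realizes_def by metis
    also have "\<dots> = (outl T (x i) ?q \<frown> state_map T (step T (x i) ?q) (future x (i + 1))) 0"
      using state_map_future[OF T(1), of i "i + 1" x] past_state_steps[OF T(1), of i "i + 1" x] by simp
    also have "\<dots> = hd (outl T (x i) ?q)"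
      using T(2) q unfolding synchronous_def
      by (metis conc_fst hd_conv_nth length_0_conv less_one zero_neq_one)
    finally show ?thesis by (simp add: P_map_eq)
  qed
  then have "g = P_map T" by blast
  with g show "realizes T (\<lambda>_. 0) (P_map T)" "P_map T \<in> carrier End_shift" by blast+
qed

lemma realizes_shift_by:
  assumes r: "realizes T (\<lambda>_. 0) f" and f: "f \<in> carrier End_shift"
  shows "realizes T (\<lambda>_. i) (f \<circ> shift_by i)"
  unfolding realizes_def
proof (intro allI)
  fix x j
  have "future ((f \<circ> shift_by i) x) (j + i) = future (f x) (j + 0)"
    unfolding comp_apply End_shift_commute[OF f] by (simp add: future_def shift_by_def)
  also have "\<dots> = state_map T (past_state T x j) (future x j)"
    using r unfolding realizes_def by metis
  finally show "future ((f \<circ> shift_by i) x) (j + i) = state_map T (past_state T x j) (future x j)" .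
qed

lemma is_P_iff: "is_P T \<longleftrightarrow> sync_core T \<and> weakly_minimal T \<and> synchronous T"
  by (auto simp: is_P_def sync_core_def)

lemma trans_hom_weakly_minimal:
  assumes hom: "trans_hom G T U" and T: "transducer T" "weakly_minimal T"
  shows "weakly_minimal U"
  unfolding weakly_minimal_def
proof (intro ballI impI)
  fix p p' assume "p \<in> states U" "p' \<in> states U" and eq: "omega_equiv U p U p'"
  then obtain q q' where q: "q \<in> states T" "p = G q" "q' \<in> states T" "p' = G q'"
    using trans_hom_states[OF hom] by metis
  then have "omega_equiv T q T q'"
    using eq trans_hom_state_map[OF hom T(1)] by (simp add: omega_equiv_def)
  then show "p = p'" using q T(2) unfolding weakly_minimal_def by blast
qed

lemma trans_hom_synchronous:
  "trans_hom G T U \<Longrightarrow> synchronous T \<Longrightarrow> synchronous U"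
  unfolding trans_hom_def synchronous_def by (metis imageE)

text \<open>The classes contain only transducers with natural numbers as states, whereas quotients
  and reducts have sets of states as states.\<close>

lemma trans_hom_nat_ex:
  assumes T: "transducer T"
  shows "\<exists>G (U :: ('a, nat) transducer). inj_on G (states T) \<and> trans_hom G T U"
proof -
  obtain G :: "_ \<Rightarrow> nat" where G: "inj_on G (states T)"
    using finite_imp_inj_to_nat_seg[OF transducerD(1)[OF T]] by blast
  let ?H = "inv_into (states T) G"
  let ?U = "\<lparr>states = G ` states T, step = (\<lambda>x q. G (step T x (?H q))), outl = (\<lambda>x q. outl T x (?H q))\<rparr>"
  have "trans_hom G T ?U" using G by (simp add: trans_hom_def)
  with G show ?thesis by blast
qed

text \<open>
  The states are words of length \<open>m\<close>, although \<open>m - 1\<close> letters of the past would do, so that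
  \<open>m = 0\<close> is no special case.
\<close>

definition block_transducer :: "nat \<Rightarrow> ('a list \<Rightarrow> 'a) \<Rightarrow> ('a, 'a list) transducer" where
  "block_transducer m f = \<lparr>states = {w. length w = m}, step = (\<lambda>x w. drop 1 (w @ [x])),
     outl = (\<lambda>x w. [f (drop 1 (w @ [x]))])\<rparr>"

lemma block_transducer:
  fixes f :: "'a::finite list \<Rightarrow> 'a"
  shows "sync_core (block_transducer m f)" "synchronous (block_transducer m f)"
    "P_map (block_transducer m f) = sliding m f"
proof -
  let ?T = "block_transducer m f"
  have steps: "steps ?T w q = drop (length w) (q @ w)" for w q
  proof (induction w arbitrary: q)
    case (Cons x w)
    have "step ?T x q = drop 1 (q @ [x])" by (simp add: block_transducer_def)
    then show ?case by (cases q) (simp_all add: Cons)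
  qed simp
  show sync: "synchronous ?T" by (simp add: synchronous_def block_transducer_def)
  have lvl: "sync_level ?T m"
    unfolding sync_level_def steps by (auto simp: block_transducer_def)
  have "outs ?T w q \<noteq> []" if "w \<noteq> []" for w q
    using that by (cases w) (simp_all add: block_transducer_def)
  then have T: "transducer ?T"
    unfolding transducer_def using finite_lists_length_eq[of "UNIV :: 'a set" m]
    by (auto simp: block_transducer_def intro: exI[of _ "replicate m undefined"])
  show core: "sync_core ?T"
  proof (rule sync_coreI[OF T lvl])
    fix q assume q: "q \<in> states ?T"
    then have len: "length q = m" by (simp add: block_transducer_def)
    then have "forced ?T q = q" using forced_eq[of ?T q q] lvl q steps[of q q] by simp
    then show "\<exists>w. sync_level ?T (length w) \<and> q = forced ?T w" using lvl len by metis
  qed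
  have "past_state ?T x i = segment x (i - int m) i" for x i
    using past_state_eq[OF T lvl, of "replicate m undefined" x i] steps
    by (simp add: block_transducer_def)
  moreover have "drop 1 (segment x (i - int m) i @ [x i]) = map x [i - int m + 1..i]" for x :: "int \<Rightarrow> 'a" and i
  proof -
    have "segment x (i - int m) i @ [x i] = map x [i - int m..i]"
      using segment_append[of "i - int m" i "i + 1" x] by (simp add: segment_def)
    also have "\<dots> = x (i - int m) # map x [i - int m + 1..i]"
      by (subst upto_rec1) auto
    finally show ?thesis by simp
  qed
  ultimately show "P_map ?T = sliding m f"
    by (simp add: P_map_eq sliding_def fun_eq_iff block_transducer_def)
qed

text \<open>Surjectivity of the map from P to f: the block transducer is made weakly minimal and its
  states are renamed. Both homomorphisms preserve the realized endomorphism, and uniqueness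
  identifies it with \<open>P_map P\<close>.\<close>

lemma is_P_ex:
  fixes f :: "(int \<Rightarrow> 'a::finite) \<Rightarrow> (int \<Rightarrow> 'a)"
  assumes "f \<in> F_infinity"
  shows "\<exists>P :: ('a, nat) transducer. is_P P \<and> P_map P = f"
proof -
  obtain m F where f: "f = sliding m F" using assms unfolding F_infinity_def by blast
  let ?T = "block_transducer m F"
  note T = block_transducer[of m F]
  note tr = sync_coreD(1)[OF T(1)]
  have "outl ?T x p = outl ?T x q"
    if pq: "p \<in> states ?T" "q \<in> states ?T" "omega_equiv ?T p ?T q" for p q x
  proof -
    have "outl ?T x p \<frown> state_map ?T (step ?T x p) y = outl ?T x q \<frown> state_map ?T (step ?T x q) y" for y
      using state_map_conc[OF tr pq(1), of "[x]" y] state_map_conc[OF tr pq(2), of "[x]" y] pq(3)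
      by (simp add: omega_equiv_def)
    moreover have "length (outl ?T x p) = length (outl ?T x q)"
      using T(2) pq unfolding synchronous_def by simp
    ultimately show ?thesis by simp
  qed
  note hom1 = trans_hom_omega_quotient[OF tr this] and wm = weakly_minimal_omega_quotient[OF tr this]
  let ?Q = "omega_quotient ?T"
  have Q: "sync_core ?Q" "synchronous ?Q" "realizes ?Q (\<lambda>_. 0) f"
    using trans_hom_sync_core[OF hom1 T(1)] trans_hom_synchronous[OF hom1 T(2)]
      trans_hom_realizes[OF hom1 T(1) realizes_P_map[OF T(1,2)]] T(3) f by auto
  obtain G and P :: "('a, nat) transducer" where hom2: "trans_hom G ?Q P"
    using trans_hom_nat_ex[OF sync_coreD(1)[OF Q(1)]] by blast
  have P: "sync_core P" "synchronous P" "realizes P (\<lambda>_. 0) f" "weakly_minimal P"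
    using trans_hom_sync_core[OF hom2 Q(1)] trans_hom_synchronous[OF hom2 Q(2)]
      trans_hom_realizes[OF hom2 Q(1,3)] trans_hom_weakly_minimal[OF hom2 sync_coreD(1)[OF Q(1)] wm]
    by auto
  have "P_map P = f" by (rule realizes_unique[OF P(1) realizes_P_map[OF P(1,2)] P(3)])
  then show ?thesis using P unfolding is_P_iff by blast
qed

lemma F_infinity_shift_ex:
  fixes g :: "(int \<Rightarrow> 'a::finite) \<Rightarrow> (int \<Rightarrow> 'a)"
  assumes g: "g \<in> carrier End_shift"
  shows "\<exists>i f. f \<in> F_infinity \<and> g = f \<circ> shift_by i"
proof -
  obtain m :: nat where m: "\<And>x y j. (\<And>i. \<bar>i - j\<bar> \<le> int m \<Longrightarrow> x i = y i) \<Longrightarrow> g x j = g y j"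
    using End_shift_window[OF g] by metis
  \<comment> \<open>The window of \<open>g\<close> reaches \<open>m\<close> places into the future.
    After a delay by \<open>m\<close> it consists of the \<open>2 * m + 1\<close> letters that end
    at the current position, as sliding block maps require.\<close>
  let ?f = "g \<circ> shift_by (int m)"
  \<comment> \<open>This bi-infinite word carries \<open>w\<close> in the window of position 0;
    outside the window any letter will do.\<close>
  let ?z = "\<lambda>w l. if - 2 * int m \<le> l \<and> l \<le> 0 then w ! nat (l + 2 * int m) else undefined"
  define F where "F w = ?f (?z w) 0" for w
  have "?f x j = sliding (2 * m + 1) F x j" for x j
  proof -
    let ?w = "map x [j - int (2 * m + 1) + 1..j]"
    have comm: "?f (shift_by d x) = shift_by d (?f x)" for d
      using End_shift_commute[OF g, of d "shift_by (int m) x"] fun_cong[OF shift_by_add[of d "int m"], of x]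
        fun_cong[OF shift_by_add[of "int m" d], of x]
      by (simp add: add.commute)
    have "?f x j = ?f (shift_by (- j) x) 0" unfolding comm by (simp add: shift_by_def)
    also have "\<dots> = ?f (?z ?w) 0"
      unfolding comp_apply by (rule m) (auto simp: shift_by_def algebra_simps)
    finally show ?thesis by (simp only: F_def sliding_def)
  qed
  then have "?f = sliding (2 * m + 1) F" by blast
  then have "?f \<in> F_infinity" unfolding F_infinity_def by blast
  moreover have "g = ?f \<circ> shift_by (- int m)"
    by (simp add: comp_assoc shift_by_add)
  ultimately show ?thesis by blast
qed


section \<open>The isomorphism of monoids\<close>

definition realization_class ::
  "((int \<Rightarrow> 'a::linorder) \<Rightarrow> (int \<Rightarrow> 'a)) \<Rightarrow> ('a, nat) annotated set" where
  "realization_class g = {B. is_AL B \<and> realizes_annotated B g}"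

lemma annotated_class_realization:
  "is_AL A \<Longrightarrow> realizes_annotated A g \<Longrightarrow> annotated_class A = realization_class g"
  unfolding realization_class_def by (rule annotated_class_eq)

lemma shift_by_End_shift: "(shift_by i :: (int \<Rightarrow> 'a::finite) \<Rightarrow> _) \<in> carrier End_shift"
proof -
  have "finitary (\<lambda>x. shift_by i x j :: 'a)" for j
    unfolding finitary_def shift_by_def by (intro exI[of _ "{j - i}"]) simp
  then show ?thesis
    by (simp add: End_shift_iff shift_eq_shift_by shift_by_add add.commute)
qed

lemma shift_pow:
  "(shift :: (int \<Rightarrow> 'a::finite) \<Rightarrow> _) [^]\<^bsub>End_shift\<^esub> (i::int) = shift_by i"
proof -
  interpret E: monoid "End_shift :: ((int \<Rightarrow> 'a) \<Rightarrow> (int \<Rightarrow> 'a)) monoid"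
    by (rule monoid_End_shift)
  let ?s = "shift :: (int \<Rightarrow> 'a) \<Rightarrow> _"
  have pow: "?s [^]\<^bsub>End_shift\<^esub> n = shift_by (int n)" for n :: nat
    by (induction n) (simp_all add: shift_eq_shift_by shift_by_add)
  have "inv\<^bsub>End_shift\<^esub> (shift_by j) = (shift_by (- j) :: (int \<Rightarrow> 'a) \<Rightarrow> _)" for j
    by (rule E.inv_unique'[symmetric]) (simp_all add: shift_by_End_shift shift_by_add)
  then show ?thesis by (simp add: int_pow_def2 pow)
qed

lemma annotated_of_realizes:
  fixes P :: "('a::{finite, linorder}, 's) transducer"
  assumes P: "is_P P"
  shows "is_AL (annotated_of i P)" "realizes_annotated (annotated_of i P) (P_map P \<circ> shift_by i)"
proof -
  have P': "sync_core P" "synchronous P" using P by (simp_all add: is_P_iff)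
  note f = P_map_End_shift[OF P']
  show "is_AL (annotated_of i P)" "realizes_annotated (annotated_of i P) (P_map P \<circ> shift_by i)"
    unfolding annotated_of_def
    by (rule reduct_realizes[OF P'(1) synchronous_annotation[OF sync_coreD(1)[OF P'(1)] P'(2)]
          realizes_shift_by[OF realizes_P_map[OF P'] f] comp_End_shift[OF shift_by_End_shift f]])+
qed

lemma End_shift_decomposition:
  fixes g :: "(int \<Rightarrow> 'a::{finite, linorder}) \<Rightarrow> (int \<Rightarrow> 'a)"
  assumes "g \<in> carrier End_shift"
  shows "\<exists>i (P :: ('a, nat) transducer). is_P P \<and> P_map P \<in> F_infinity \<and> g = P_map P \<circ> shift_by i"
  using F_infinity_shift_ex[OF assms] is_P_ex by metis

text \<open>Well-definedness of \<open>phi\<close>: each decomposition of \<open>g\<close>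
  contributes the same class, and at least one decomposition exists, so the union is over a single
  set.\<close>

lemma phi_eq:
  fixes g :: "(int \<Rightarrow> 'a::{finite, linorder}) \<Rightarrow> (int \<Rightarrow> 'a)"
  assumes g: "g \<in> carrier End_shift"
  shows "phi g = realization_class g"
proof -
  let ?S = "{annotated_class (annotated_of i P) | i f (P :: ('a, nat) transducer).
     f \<in> F_infinity \<and> is_P P \<and> P_map P = f \<and>
     g = (shift [^]\<^bsub>End_shift\<^esub> i) \<otimes>\<^bsub>End_shift\<^esub> f}"
  have "X = realization_class g" if "X \<in> ?S" for X
    using that annotated_class_realization[OF annotated_of_realizes] by (auto simp: shift_pow)
  moreover have "?S \<noteq> {}" using End_shift_decomposition[OF g] by (auto simp: shift_pow)
  ultimately have "?S = {realization_class g}" by blast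
  then show ?thesis unfolding phi_def by simp
qed

text \<open>Any member determines \<open>g\<close>, so this yields injectivity; it also ensures that
  the union defining a product of classes is taken over at least one pair.\<close>

lemma realization_class_nonempty:
  fixes g :: "(int \<Rightarrow> 'a::{finite, linorder}) \<Rightarrow> (int \<Rightarrow> 'a)"
  assumes g: "g \<in> carrier End_shift"
  shows "realization_class g \<noteq> {}"
proof -
  obtain i and P :: "('a, nat) transducer" where P: "is_P P" "g = P_map P \<circ> shift_by i"
    using End_shift_decomposition[OF g] by blast
  obtain T \<alpha> where T: "annotated_of i P = (T, \<alpha>)" by (metis surj_pair)
  have A: "is_AL (T, \<alpha>)" "realizes T (annotation_fun \<alpha>) g"
    using annotated_of_realizes[OF P(1), of i] unfolding P(2) T by simp_all
  note core = is_AL_realizable(1)[OF A(1)] and ann = is_AL_realizable(2)[OF A(1)]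
  note tr = sync_coreD(1)[OF core]
  obtain G and U :: "('a, nat) transducer" where G: "inj_on G (states T)" "trans_hom G T U"
    using trans_hom_nat_ex[OF tr] by blast
  have "\<exists>\<beta>. is_AL (U, \<beta>) \<and> realizes_annotated (U, \<beta>) g"
  proof (cases \<alpha>)
    case None
    then obtain b where Z: "is_Z T [b]" using A(1) by auto
    then obtain s where s: "states T = {s}" "\<And>x. step T x s = s" "\<And>x. outl T x s = [b]"
      by (auto simp: is_Z_def)
    have "is_Z U [b]"
      using G(2) unfolding is_Z_def trans_hom_def s by (intro exI[of _ "G s"]) (auto simp: s)
    moreover have "realizes U (\<lambda>_. 0) g"
      by (rule trans_hom_realizes[OF G(2) core A(2)]) (simp add: None)
    ultimately show ?thesis
      using trans_hom_transducer[OF G(2) tr] by (intro exI[of _ None]) auto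
  next
    case (Some a)
    let ?b = "a \<circ> inv_into (states T) G"
    have b: "?b (G q) = annotation_fun \<alpha> q" if "q \<in> states T" for q
      using G(1) that by (simp add: Some)
    have "is_AL (U, Some ?b)"
      unfolding is_AL_Some_iff
      using A(1)[unfolded Some is_AL_Some_iff] trans_hom_sync_core[OF G(2) core]
        trans_hom_weakly_minimal[OF G(2) tr] trans_hom_full_response[OF G(2) tr]
        trans_hom_annotation[OF G(2) tr ann b] by blast
    moreover have "realizes U ?b g" by (rule trans_hom_realizes[OF G(2) core A(2) b])
    ultimately show ?thesis by (intro exI[of _ "Some ?b"]) (simp del: is_AL.simps)
  qed
  then show ?thesis unfolding realization_class_def by blast
qed

lemma realization_class_inj: "inj_on realization_class (carrier (End_shift :: ((int \<Rightarrow> 'a::{finite, linorder}) \<Rightarrow> _) monoid))"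
proof (rule inj_onI)
  fix g h :: "(int \<Rightarrow> 'a) \<Rightarrow> (int \<Rightarrow> 'a)"
  assume "g \<in> carrier End_shift" and eq: "realization_class g = realization_class h"
  then obtain A where "A \<in> realization_class g" using realization_class_nonempty by blast
  with eq show "g = h" using realizes_annotated_unique unfolding realization_class_def by blast
qed

lemma carrier_AL_tilde:
  "carrier AL_tilde = (realization_class :: ((int \<Rightarrow> 'a::{finite, linorder}) \<Rightarrow> _) \<Rightarrow> _) ` carrier End_shift"
proof (intro equalityI subsetI)
  fix X :: "('a, nat) annotated set" assume "X \<in> carrier AL_tilde"
  then obtain A :: "('a, nat) annotated" where "is_AL A" "X = annotated_class A"
    by (auto simp: AL_tilde_def)
  then show "X \<in> realization_class ` carrier End_shift"
    using is_AL_realizes_ex annotated_class_realization by blast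
next
  fix X assume "X \<in> (realization_class :: ((int \<Rightarrow> 'a) \<Rightarrow> _) \<Rightarrow> _) ` carrier End_shift"
  then obtain g :: "(int \<Rightarrow> 'a) \<Rightarrow> _" where g: "g \<in> carrier End_shift" "X = realization_class g" by blast
  then obtain A where "A \<in> realization_class g" using realization_class_nonempty by blast
  then have "is_AL A" "X = annotated_class A"
    using annotated_class_realization g(2) unfolding realization_class_def by blast+
  then show "X \<in> carrier AL_tilde" by (cases A) (auto simp: AL_tilde_def)
qed

lemma mult_realization_class:
  fixes f g :: "(int \<Rightarrow> 'a::{finite, linorder}) \<Rightarrow> (int \<Rightarrow> 'a)"
  assumes f: "f \<in> carrier End_shift" and g: "g \<in> carrier End_shift"
  shows "realization_class f \<otimes>\<^bsub>AL_tilde\<^esub> realization_class g = realization_class (g \<circ> f)"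
proof -
  have "annotated_class (mult_annotated A B) = realization_class (g \<circ> f)"
    if "A \<in> realization_class f" "B \<in> realization_class g" for A B
    using that mult_annotated_realizes[OF _ _ f _ _ g] annotated_class_realization
    unfolding realization_class_def by blast
  then show ?thesis
    using realization_class_nonempty[OF f] realization_class_nonempty[OF g] by (simp add: AL_tilde_def)
qed

lemma two_letters:
  assumes "CARD('a) \<ge> 2"
  obtains c d :: 'a where "c \<noteq> d"
proof -
  have "\<not> (\<forall>c d :: 'a. c = d)"
  proof
    assume "\<forall>c d :: 'a. c = d"
    then have "(UNIV :: 'a set) = {undefined}" by auto
    then have "CARD('a) = 1" by (metis is_singleton_def is_singleton_altdef)
    with assms show False by simp
  qed
  then show thesis using that by blast
qed

text \<open>Two letters are required for \<open>is_AL\<close>: over one letter the identity is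
  constant and responds incompletely. The statement about an arbitrary displacement \<open>b\<close>
  is what the comparison of bare transducers leads to in the study of units.\<close>

lemma
  fixes I :: "('a::linorder, nat) transducer"
  defines "I \<equiv> identity_transducer"
  shows states_identity: "states I = {0}"
    and state_map_identity: "state_map I 0 x = x"
    and realizes_identity: "realizes I (\<lambda>_. 0) id"
    and realizes_identity_shift: "realizes I b f \<Longrightarrow> f = shift_by (b 0)"
    and is_AL_identity: "CARD('a) \<ge> 2 \<Longrightarrow> is_AL (I, Some (\<lambda>_. 0))"
proof -
  have I: "states I = {0}" "step I x q = 0" "outl I x q = [x]" for x q
    by (simp_all add: I_def identity_transducer_def)
  have st: "steps I w 0 = 0" for w by (induction w) (auto simp: I)
  have ou: "outs I w 0 = w" for w by (induction w) (auto simp: I)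
  have T: "transducer I" unfolding transducer_def by (simp add: I ou)
  have lvl: "sync_level I 0" unfolding sync_level_def by (simp add: I)
  have core: "sync_core I"
    using forced_eq[of I "[]" 0] lvl
    by (intro sync_coreI[OF T lvl]) (auto simp: I intro!: exI[of _ "[]"])
  have sm: "state_map I 0 x = x" for x
  proof (rule state_map_eqI[OF T])
    show "\<exists>z. x = outs I (prefix k x) 0 \<frown> z" for k
      unfolding ou by (rule exI[of _ "suffix k x"]) simp
  qed (simp add: I)
  have past: "past_state I x i = 0" for x i using past_state_closed[OF core, of x i] I by simp
  show "states I = {0}" "state_map I 0 x = x" by (rule I, rule sm)
  show "realizes I (\<lambda>_. 0) id" unfolding realizes_def past sm by simp
  show "f = shift_by (b 0)" if "realizes I b f"
  proof (intro ext)
    fix x j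
    have "future (f x) ((j - b 0) + b 0) = future x (j - b 0)"
      using that unfolding realizes_def past sm by blast
    from fun_cong[OF this, of 0] show "f x j = shift_by (b 0) x j"
      by (simp add: future_def shift_by_def)
  qed
  assume "CARD('a) \<ge> 2"
  then obtain c d :: 'a where cd: "c \<noteq> d" by (rule two_letters)
  have "\<nexists>a. \<forall>x :: nat \<Rightarrow> 'a. x 0 = a"
  proof
    assume "\<exists>a. \<forall>x :: nat \<Rightarrow> 'a. x 0 = a"
    then obtain a where "\<And>x :: nat \<Rightarrow> 'a. x 0 = a" by blast
    from this[of "\<lambda>_. c"] this[of "\<lambda>_. d"] cd show False by simp
  qed
  then have "full_response I"
    unfolding full_response_def incomplete_response_iff by (simp add: I(1) sm)
  moreover have "annotation I (\<lambda>_. 0)" unfolding annotation_def by (simp add: I(1) ou)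
  moreover have "weakly_minimal I" unfolding weakly_minimal_def by (simp add: I(1))
  ultimately show "is_AL (I, Some (\<lambda>_. 0))" unfolding is_AL_Some_iff using core by blast
qed

lemma one_AL_tilde:
  assumes "CARD('a::{finite, linorder}) \<ge> 2"
  shows "\<one>\<^bsub>AL_tilde\<^esub> = realization_class (id :: (int \<Rightarrow> 'a) \<Rightarrow> _)"
proof -
  have "realizes_annotated (identity_transducer, Some (\<lambda>_. 0)) (id :: (int \<Rightarrow> 'a) \<Rightarrow> _)"
    using realizes_identity by simp
  from annotated_class_realization[OF is_AL_identity[OF assms] this]
  show ?thesis by (simp add: AL_tilde_def)
qed

lemma phi_hom:
  "(phi :: ((int \<Rightarrow> 'a::{finite, linorder}) \<Rightarrow> _) \<Rightarrow> _) \<in> hom End_shift AL_tilde"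
  by (rule homI) (simp_all add: phi_eq comp_End_shift mult_realization_class carrier_AL_tilde)

lemma monoid_AL_tilde:
  assumes "CARD('a::{finite, linorder}) \<ge> 2"
  shows "monoid (AL_tilde :: ('a, nat) annotated set monoid)"
proof -
  let ?phi = "phi :: ((int \<Rightarrow> 'a) \<Rightarrow> _) \<Rightarrow> _"
  have "?phi ` carrier End_shift = carrier AL_tilde" unfolding carrier_AL_tilde by (simp add: phi_eq)
  moreover have "?phi \<one>\<^bsub>End_shift\<^esub> = \<one>\<^bsub>AL_tilde\<^esub>"
    using one_AL_tilde[OF assms] phi_eq[OF End_shift_id] by simp
  ultimately show ?thesis
    using monoid.hom_imp_img_monoid[OF monoid_End_shift phi_hom[where 'a = 'a]] by simp
qed

section \<open>Units\<close>

lemma finitary_clopen: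
  assumes "finitary F"
  shows "openin discrete_power {x. F x}" "closedin discrete_power {x. F x}"
proof -
  have op: "openin discrete_power {x. F x = b}" for b
    using finitary_continuous_map[OF assms] unfolding continuous_map_def
    by (auto dest!: spec[of _ "{b}"])
  show "openin discrete_power {x. F x}" using op[of True] by simp
  have "topspace discrete_power - {x. F x} = {x. F x = False}" by auto
  then show "closedin discrete_power {x. F x}" using op[of False] by (simp add: closedin_def)
qed

text \<open>
  If \<open>g\<close> has the inverse \<open>h\<close> and \<open>q\<close> is the state forced by the past of \<open>x0\<close>, then \<open>y\<close> is in
  the image of \<open>q\<close> iff \<open>h\<close> recovers the past of \<open>x0\<close> from \<open>y\<close> preceded by the past of \<open>g x0\<close>;
  as \<open>h\<close> has a finite window, this is a condition on finitely many letters of \<open>y\<close>.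
\<close>

lemma is_O_invertible:
  fixes T :: "('a::{finite, linorder}, 's) transducer"
  assumes A: "is_AL (T, Some a)" and r: "realizes T a g"
    and h: "h \<in> carrier End_shift" "h \<circ> g = id" "g \<circ> h = id"
  shows "is_O T"
  unfolding is_O_def
proof (intro conjI ballI)
  show "is_M T" using A by (simp add: is_L_def)
  have T: "sync_core T" "annotation T a" using A[unfolded is_AL_Some_iff] by blast+
  have hg: "h (g x) = x" and gh: "g (h x) = x" for x using h(2,3) by (metis comp_apply id_apply)+
  obtain m :: nat where m: "\<And>x y j. (\<And>i. \<bar>i - j\<bar> \<le> int m \<Longrightarrow> x i = y i) \<Longrightarrow> h x j = h y j"
    using End_shift_window[OF h(1)] by metis
  fix q assume q: "q \<in> states T"
  then obtain x0 where x0: "past_state T x0 0 = q" using past_state_ex[OF T(1)] by blast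
  define V where "V = glue (a q) (g x0)"
  have V: "g (glue 0 x0 y) = V (state_map T q y)" for y
  proof
    fix j
    show "g (glue 0 x0 y) j = V (state_map T q y) j"
    proof (cases "j < a q")
      case True
      have "g (glue 0 x0 y) j = g x0 j"
        by (rule realizes_past[OF T r, of 0]) (use True x0 in simp_all)
      then show ?thesis using True by (simp add: V_def)
    next
      case False
      then show ?thesis
        using fun_cong[OF realizes_glue[OF r x0, of y], of "nat (j - a q)"]
        by (simp add: V_def glue_def future_def)
    qed
  qed
  show "inj (state_map T q)"
  proof (rule injI)
    fix y z assume "state_map T q y = state_map T q z"
    then have "g (glue 0 x0 y) = g (glue 0 x0 z)" by (simp add: V)
    then have "glue 0 x0 y = glue 0 x0 z" using hg by metis
    then show "y = z" by (metis future_glue)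
  qed
  \<comment> \<open>For \<open>j < - N\<close> the window of \<open>h\<close> at \<open>j\<close>
    lies to the left of \<open>a q\<close>, where \<open>V y\<close> agrees with
    \<open>g x0\<close>; there \<open>h\<close> recovers \<open>x0\<close> from any
    \<open>y\<close>, and only \<open>N\<close> positions remain to be tested.\<close>
  define N where "N = \<bar>a q\<bar> + int m"
  define F where "F y \<longleftrightarrow> (\<forall>j\<in>{- N..<0}. h (V y) j = x0 j)" for y
  have "range (state_map T q) = {y. F y}"
  proof (intro equalityI subsetI)
    fix y assume "y \<in> range (state_map T q)"
    then obtain z where "y = state_map T q z" by blast
    then have "h (V y) = glue 0 x0 z" using V hg by metis
    then show "y \<in> {y. F y}" by (simp add: F_def)
  next
    fix y assume "y \<in> {y. F y}"
    then have F: "\<forall>j\<in>{- N..<0}. h (V y) j = x0 j" by (simp add: F_def)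
    have "h (V y) j = x0 j" if "j < 0" for j
    proof (cases "- N \<le> j")
      case False
      have "h (V y) j = h (g x0) j"
        by (rule m) (use False in \<open>auto simp: V_def glue_def N_def\<close>)
      then show ?thesis by (simp add: hg)
    qed (use F that in simp)
    then have "glue 0 x0 (future (h (V y)) 0) = h (V y)" by (intro glue_id) simp
    then have "V y = V (state_map T q (future (h (V y)) 0))" using V gh by metis
    then have "y = state_map T q (future (h (V y)) 0)" unfolding V_def by (metis future_glue)
    then show "y \<in> range (state_map T q)" by blast
  qed
  moreover have "finitary F"
    unfolding finitary_def
  proof (intro exI[of _ "{..nat N}"] conjI allI impI)
    fix y z :: "nat \<Rightarrow> 'a" assume eq: "\<forall>i\<in>{..nat N}. y i = z i"
    have "h (V y) j = h (V z) j" if "j < 0" for j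
    proof (rule m)
      fix i assume "\<bar>i - j\<bar> \<le> int m"
      then have "nat (i - a q) \<le> nat N" using that unfolding N_def by linarith
      then show "V y i = V z i" using eq by (simp add: V_def glue_def)
    qed
    then show "F y = F z" by (auto simp: F_def)
  qed simp
  ultimately show "openin discrete_power (range (state_map T q))"
    "closedin discrete_power (range (state_map T q))"
    using finitary_clopen by metis+
qed

section \<open>Equality of transducers and transport of annotations\<close>

lemma same_transducer_sym: "same_transducer T U \<Longrightarrow> same_transducer U T"
proof -
  assume "same_transducer T U"
  then obtain G where G: "bij_betw G (states T) (states U)"
    "\<And>q. q \<in> states T \<Longrightarrow> omega_equiv T q U (G q)" unfolding same_transducer_def by blast
  let ?H = "inv_into (states T) G"
  have H: "bij_betw ?H (states U) (states T)" by (rule bij_betw_inv_into[OF G(1)])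
  moreover have "omega_equiv U q T (?H q)" if q: "q \<in> states U" for q
    using G(2)[OF bij_betwE[OF H, rule_format, OF q]] bij_betw_inv_into_right[OF G(1) q]
    by (simp add: omega_equiv_def)
  ultimately show "same_transducer U T" unfolding same_transducer_def by blast
qed

lemma same_transducer_trans:
  assumes "same_transducer T U" "same_transducer U W"
  shows "same_transducer T W"
proof -
  obtain G H where "bij_betw G (states T) (states U)" "bij_betw H (states U) (states W)"
    "\<forall>q\<in>states T. omega_equiv T q U (G q)" "\<forall>q\<in>states U. omega_equiv U q W (H q)"
    using assms unfolding same_transducer_def by blast
  then show ?thesis
    unfolding same_transducer_def omega_equiv_def
    by (intro exI[of _ "H \<circ> G"]) (auto intro: bij_betw_trans dest: bij_betwE)
qed

lemma same_transducer_refl: "same_transducer T T"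
  unfolding same_transducer_def omega_equiv_def by (intro exI[of _ id]) auto

lemma transducer_class_eq: "same_transducer T U \<Longrightarrow> transducer_class T = transducer_class U"
  unfolding transducer_class_def
  using same_transducer_trans[of T U] same_transducer_trans[OF same_transducer_sym, of T U] by blast

lemma same_annotated_same_transducer: "same_annotated (T, \<alpha>) (U, \<beta>) \<Longrightarrow> same_transducer T U"
  by (auto simp: same_transducer_def)

lemma is_MD: "is_M T \<Longrightarrow> sync_core T"
  by (simp add: is_M_def sync_core_def)

lemma is_Z_state_map_constant:
  assumes Z: "is_Z T x" and q: "q \<in> states T"
  shows "state_map T q y = state_map T q z"
proof -
  have s: "step T a q = q" "outl T a q = x" for a using Z q by (auto simp: is_Z_def)
  have "outs T u q = outs T w q" if "length u = length w" for u w
    using that by (induction rule: list_induct2) (simp_all add: s)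
  then have "outs T (map y [0..<k]) q = outs T (map z [0..<k]) q" for k
    by (metis length_map)
  then show ?thesis unfolding state_map_def by simp
qed

text \<open>A nonconstant state map rules out the alternative \<open>Z\<close> in the definition of
  minimality.\<close>

lemma is_M_full_response:
  assumes "is_M T" and q: "q \<in> states T" and sm: "state_map T q y \<noteq> state_map T q z"
  shows "full_response T" "weakly_minimal T"
  using assms is_Z_state_map_constant[OF _ q] unfolding is_M_def minimal_def full_response_def
  by blast+

text \<open>Products in \<open>O_tilde\<close> range over all representatives of bare transducers;
  this equips each of them with an annotation that realizes the same endomorphism.\<close>

lemma annotation_transport:
  assumes A: "is_AL (T, Some a)" "realizes T a g" and U: "is_M U" and same: "same_transducer T U"
  shows "\<exists>b. is_AL (U, Some b) \<and> realizes U b g"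
proof -
  have T: "sync_core T" "weakly_minimal T" "full_response T" "annotation T a"
    using A(1)[unfolded is_AL_Some_iff] by blast+
  note tr = sync_coreD(1)[OF T(1)] and trU = sync_coreD(1)[OF is_MD[OF U]]
  obtain G where G: "bij_betw G (states T) (states U)" "\<And>q. q \<in> states T \<Longrightarrow> omega_equiv T q U (G q)"
    using same unfolding same_transducer_def by blast
  obtain q k where q: "q \<in> states T" using sync_coreE[OF T(1)] by blast
  obtain y z where "state_map T q y 0 \<noteq> state_map T q z 0" by (rule full_responseE[OF T(3) q])
  then have "state_map U (G q) y \<noteq> state_map U (G q) z" "G q \<in> states U"
    using G(2)[OF q] q bij_betwE[OF G(1)] by (auto simp: omega_equiv_def)
  then have U': "full_response U" "weakly_minimal U" using is_M_full_response[OF U] by blast+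
  have hom: "trans_hom G T U"
    using G bij_betw_imp_surj_on[OF G(1)] by (intro trans_hom_omega_equiv tr trU T U') auto
  let ?b = "a \<circ> inv_into (states T) G"
  have b: "?b (G q) = a q" if "q \<in> states T" for q
    using bij_betw_inv_into_left[OF G(1) that] by simp
  have "is_AL (U, Some ?b)"
    unfolding is_AL_Some_iff using is_MD[OF U] U' trans_hom_annotation[OF hom tr T(4) b] by blast
  moreover have "realizes U ?b g" by (rule trans_hom_realizes[OF hom T(1) A(2) b])
  ultimately show ?thesis by blast
qed

section \<open>Annotations from the lengths of loops\<close>

text \<open>A potential argument: \<open>a q\<close> is the excess of output over input along a
  chosen path from \<open>t\<close>. Two paths to the same state are closed up by one common return
  path, and since loops have no excess, theirs agree.\<close>

lemma annotation_ex:
  assumes T: "strongly_connected T" "transducer T"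
    and loops: "\<And>w q. q \<in> states T \<Longrightarrow> steps T w q = q \<Longrightarrow> length (outs T w q) = length w"
  shows "\<exists>a. annotation T a"
proof -
  obtain t where t: "t \<in> states T" using transducerD(2)[OF T(2)] by blast
  obtain W where W: "\<And>q. q \<in> states T \<Longrightarrow> steps T (W q) t = q"
    using T(1) t unfolding strongly_connected_def by metis
  define a where "a = (\<lambda>q. int (length (outs T (W q) t)) - int (length (W q)))"
  have "a (steps T w q) = a q + int (length (outs T w q)) - int (length w)"
    if q: "q \<in> states T" for w q
  proof -
    let ?p = "steps T w q"
    have p: "?p \<in> states T" by (rule steps_closed[OF T(2) q])
    obtain r where "steps T r ?p = t" using T(1) t p unfolding strongly_connected_def by blast
    then have "length (outs T (W q @ w @ r) t) = length (W q @ w @ r)"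
      "length (outs T (W ?p @ r) t) = length (W ?p @ r)"
      using W[OF q] W[OF p] by (intro loops t; simp)+
    then show ?thesis using W[OF q] W[OF p] by (simp add: a_def)
  qed
  then show ?thesis unfolding annotation_def by blast
qed

text \<open>
  With \<open>s\<close> the state of \<open>T\<close> forced by a power of \<open>outs U w t\<close>, the word \<open>w\<close> labels a loop at
  the state \<open>(t, s)\<close> of the product, where it is mapped to itself up to a fixed prefix.
\<close>

lemma loops_of_left_inverse:
  fixes U :: "('a::{finite, linorder}, 's) transducer" and T :: "('a, 't) transducer"
  assumes card: "CARD('a) \<ge> 2" and U: "sync_core U"
    and T: "sync_core T"
    and loops: "\<And>w q. q \<in> states T \<Longrightarrow> steps T w q = q \<Longrightarrow> length (outs T w q) = length w"
    and same: "same_transducer (mult_transducer U T) identity_transducer"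
    and t: "t \<in> states U" and loop: "steps U w t = t"
  shows "length (outs U w t) = length w"
proof (cases "w = []")
  case False
  note trU = sync_coreD(1)[OF U] and trT = sync_coreD(1)[OF T]
  let ?D = "prod_transducer U T"
  define C where "C = core ?D"
  note trD = transducer_prod[OF trU trT]
  obtain k m where km: "sync_level U k" "sync_level T m" using sync_coreD(2) T U by metis
  then obtain K where K: "sync_level ?D K" using sync_level_prod trT trU by blast
  note C = sync_level_core[OF trD K, folded C_def]
  define v where "v = outs U w t"
  have v: "v \<noteq> []" using transducerD(4)[OF trU t False loop] by (simp add: v_def)
  let ?pow = "\<lambda>n u. concat (replicate n u)"
  have pow: "u \<noteq> [] \<Longrightarrow> n \<le> length (?pow n u)" for u :: "'a list" and n
    by (cases u) (simp_all add: length_concat sum_list_replicate)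
  obtain s0 where s0: "s0 \<in> states T" using transducerD(2)[OF trT] by blast
  define s where "s = steps T (?pow m v) s0"
  have s: "s \<in> states T" unfolding s_def by (rule steps_closed[OF trT s0])
  have "sync_level T (length (?pow m v))" using sync_level_mono[OF trT km(2) pow[OF v]] .
  then have "steps T (?pow m v) (steps T v s0) = s"
    using s0 steps_closed[OF trT s0] unfolding sync_level_def s_def by blast
  moreover have "?pow n v @ v = v @ ?pow n v" for n by (induction n) auto
  then have "steps T v s = steps T (?pow m v) (steps T v s0)"
    unfolding s_def by (metis steps_append)
  ultimately have s_loop: "steps T v s = s" by simp
  have D_loop: "steps ?D w (t, s) = (t, s)" by (simp add: loop s_loop v_def[symmetric])
  have powD: "steps ?D (?pow n w) (t, s) = (t, s)" for n
    by (induction n) (use D_loop in \<open>simp_all del: steps_prod\<close>)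
  \<comment> \<open>A sufficiently high power of \<open>w\<close> forces the loop state, which
    places it in the core, where the reduct gives information about it.\<close>
  have lvl: "sync_level ?D (length (?pow K w))" using sync_level_mono[OF trD K pow[OF False]] .
  have "forced ?D (?pow K w) = (t, s)"
    using forced_eq[OF lvl, of "(t, s)"] powD t s by simp
  then have q: "(t, s) \<in> states C" unfolding C_def core_def using lvl by force
  obtain G where G: "bij_betw G (states (reduct C)) {0}"
    "\<And>c. c \<in> states (reduct C) \<Longrightarrow> omega_equiv (reduct C) c identity_transducer (G c)"
    using same unfolding same_transducer_def mult_transducer_def C_def[symmetric] states_identity by blast
  have sm: "state_map (reduct C) c y = y" if "c \<in> states (reduct C)" for c and y :: "nat \<Rightarrow> 'a"
    using G(2)[OF that] bij_betwE[OF G(1), rule_format, OF that] state_map_identity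
    by (simp add: omega_equiv_def)
  obtain a b :: 'a where ab: "a \<noteq> b" using two_letters[OF card] .
  have fin: "\<not> infinite_case C"
  proof
    assume "infinite_case C"
    then have "is_Z (reduct C) (root_word C)" and st: "states (reduct C) = {states C}"
      by (auto simp: reduct_def Z_def is_Z_def)
    from is_Z_state_map_constant[OF this(1), of "states C" "\<lambda>_. a" "\<lambda>_. b"]
    show False using sm st ab by (simp add: fun_eq_iff)
  qed
  let ?L = "Lambda C [] (t, s)" and ?R = "complete_response C"
  note trC = sync_coreD(1)[OF C(3)]
  have R: "transducer ?R" "(t, s) \<in> states ?R"
    using transducer_complete_response[OF trC fin] q by (simp_all add: complete_response_def)
  have sm_q: "state_map C (t, s) y = ?L \<frown> y" for y
  proof -
    have "state_map ?R (t, s) y = state_map (reduct C) (kappa C (t, s)) y"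
      using trans_hom_state_map[OF trans_hom_reduct[OF trC fin] R] by simp
    also have "\<dots> = y" by (rule sm[OF trans_hom_in[OF trans_hom_reduct[OF trC fin] R(2)]])
    finally show ?thesis using state_map_complete_response[OF trC fin q] by simp
  qed
  have "steps C w (t, s) = (t, s)" "outs C w (t, s) = outs T v s"
    using D_loop by (simp_all add: C_def v_def)
  \<comment> \<open>Both sides are the image of \<open>w\<close> followed by \<open>y\<close>. As
    \<open>y\<close> is arbitrary, the words in front of it have equal length, so
    \<open>outs T v s\<close> is as long as \<open>w\<close>; and it is as long as \<open>v\<close>
    because \<open>v\<close> labels a loop of \<open>T\<close>.\<close>
  then have eq: "(?L @ w) \<frown> id y = (outs T v s @ ?L) \<frown> id y" for y
    using state_map_conc[OF trC q, of w y] by (simp add: sm_q)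
  have nc: "\<nexists>c. \<forall>y :: nat \<Rightarrow> 'a. id y 0 = c"
  proof
    assume "\<exists>c. \<forall>y :: nat \<Rightarrow> 'a. id y 0 = c"
    then obtain c where "\<And>y :: nat \<Rightarrow> 'a. y 0 = c" by auto
    from this[of "\<lambda>_. a"] this[of "\<lambda>_. b"] ab show False by simp
  qed
  have "length (?L @ w) = length (outs T v s @ ?L)"
    using full_response_outs_aux[OF eq nc] full_response_outs_aux[OF eq[symmetric] nc]
    by (rule le_antisym[rotated])
  then show ?thesis using loops[OF s s_loop] by (simp add: v_def)
qed simp

text \<open>Equality of bare transducers forgets the annotation. The composition is therefore
  realized by the identity transducer with some displacement of its only state, which is a power of
  the shift.\<close>

lemma realizes_shift_of_identity:
  fixes A :: "('a::{finite, linorder}, 's) annotated" and B :: "('a, 't) annotated"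
  assumes card: "CARD('a) \<ge> 2"
    and A: "is_AL A" "realizes_annotated A f" "f \<in> carrier End_shift"
    and B: "is_AL B" "realizes_annotated B g" "g \<in> carrier End_shift"
    and same: "same_transducer (mult_transducer (fst A) (fst B)) identity_transducer"
  shows "\<exists>d. g \<circ> f = shift_by d"
proof -
  let ?I = "identity_transducer :: ('a, nat) transducer"
  obtain M \<gamma> where M: "mult_annotated A B = (M, \<gamma>)" by (metis surj_pair)
  then have M_eq: "M = mult_transducer (fst A) (fst B)"
    by (cases A; cases B) (auto simp: Let_def)
  note red = mult_annotated_realizes[OF A B, unfolded M]
  obtain G where G: "bij_betw G (states M) {0}"
    "\<And>c. c \<in> states M \<Longrightarrow> omega_equiv M c ?I (G c)"
    using same unfolding M_eq[symmetric] same_transducer_def states_identity by blast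
  obtain a b :: 'a where ab: "a \<noteq> b" using two_letters[OF card] .
  have "\<gamma> \<noteq> None"
  proof
    assume "\<gamma> = None"
    with red(1) obtain d where Z: "is_Z M [d]" by auto
    then obtain q where q: "q \<in> states M" by (auto simp: is_Z_def)
    have "state_map M q y = y" for y
      using G(2)[OF q] bij_betwE[OF G(1), rule_format, OF q] state_map_identity
      by (simp add: omega_equiv_def)
    with is_Z_letter(4)[OF Z q] have "(\<lambda>_. a) = (\<lambda>_::nat. d)" "(\<lambda>_. b) = (\<lambda>_::nat. d)" by metis+
    with ab show False by (simp add: fun_eq_iff)
  qed
  then obtain c where c: "\<gamma> = Some c" by blast
  have "is_M ?I" using is_AL_identity[OF card] by (simp add: is_L_def)
  moreover have "realizes M c (g \<circ> f)" using red(2) c by simp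
  ultimately obtain e where "realizes ?I e (g \<circ> f)"
    using annotation_transport[OF red(1)[unfolded c]] same M_eq by blast
  from realizes_identity_shift[OF this] show ?thesis by blast
qed

lemma mult_O_tilde:
  "X \<otimes>\<^bsub>O_tilde\<^esub> Y = (\<Union>T\<in>X. \<Union>U\<in>Y. transducer_class (mult_transducer T U))"
  by (simp add: O_tilde_def M_monoid_def)

lemma one_O_tilde: "\<one>\<^bsub>O_tilde\<^esub> = transducer_class identity_transducer"
  by (simp add: O_tilde_def M_monoid_def)

text \<open>Every pair of representatives inherits annotations that realize \<open>f\<close> and
  \<open>g\<close>, so each of their products realizes the identity and has the class of the
  identity transducer.\<close>

lemma O_tilde_mult_inverse:
  fixes T U :: "('a::{finite, linorder}, nat) transducer"
  assumes card: "CARD('a) \<ge> 2"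
    and T: "is_AL (T, Some a)" "realizes T a f" "f \<in> carrier End_shift"
    and U: "is_AL (U, Some b)" "realizes U b g" "g \<in> carrier End_shift"
    and inv: "g \<circ> f = id"
  shows "transducer_class T \<otimes>\<^bsub>O_tilde\<^esub> transducer_class U = \<one>\<^bsub>O_tilde\<^esub>"
proof -
  let ?I = "identity_transducer :: ('a, nat) transducer"
  have "transducer_class (mult_transducer T' U') = transducer_class ?I"
    if T': "T' \<in> transducer_class T" and U': "U' \<in> transducer_class U" for T' U'
  proof -
    obtain a' where A: "is_AL (T', Some a')" "realizes T' a' f"
      using annotation_transport[OF T(1,2)] T' unfolding transducer_class_def by blast
    obtain b' where B: "is_AL (U', Some b')" "realizes U' b' g"
      using annotation_transport[OF U(1,2)] U' unfolding transducer_class_def by blast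
    obtain M \<gamma> where M: "mult_annotated (T', Some a') (U', Some b') = (M, \<gamma>)" by (metis surj_pair)
    have M_eq: "M = mult_transducer T' U'" using M by (auto simp: Let_def)
    have "is_AL (M, \<gamma>)" "realizes_annotated (M, \<gamma>) id"
      using mult_annotated_realizes[OF A(1) _ T(3) B(1) _ U(3)] A(2) B(2) M inv by auto
    from realizes_same_annotated[OF this(1) is_AL_identity[OF card] this(2)]
    have "same_annotated (M, \<gamma>) (?I, Some (\<lambda>_. 0))"
      using realizes_identity by (simp only: realizes_annotated_simps annotation_fun_simps)
    from transducer_class_eq[OF same_annotated_same_transducer[OF this]] M_eq show ?thesis by simp
  qed
  moreover have "T \<in> transducer_class T" "U \<in> transducer_class U"
    using T(1) U(1) same_transducer_refl by (auto simp: transducer_class_def is_L_def)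
  ultimately show ?thesis unfolding mult_O_tilde one_O_tilde by blast
qed

lemma Units_End_shift_iff:
  "g \<in> Units End_shift \<longleftrightarrow> g \<in> carrier End_shift \<and> (\<exists>h\<in>carrier End_shift. h \<circ> g = id \<and> g \<circ> h = id)"
  by (auto simp: Units_def)

lemma L_set_of_unit:
  fixes T :: "('a::{finite, linorder}, nat) transducer"
  assumes card: "CARD('a) \<ge> 2" and g: "g \<in> Units End_shift"
    and A: "is_AL (T, \<alpha>)" "realizes_annotated (T, \<alpha>) g"
  shows "transducer_class T \<in> L_set"
proof -
  obtain c d :: 'a where cd: "c \<noteq> d" using two_letters[OF card] .
  obtain h where h: "h \<in> carrier End_shift" "h \<circ> g = id" "g \<circ> h = id" and gE: "g \<in> carrier End_shift"
    using g unfolding Units_End_shift_iff by blast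
  have nc: "\<nexists>b. f = (\<lambda>_ _. b)" if "f' \<circ> f = id" for f f' :: "(int \<Rightarrow> 'a) \<Rightarrow> (int \<Rightarrow> 'a)"
  proof
    assume "\<exists>b. f = (\<lambda>_ _. b)"
    then obtain b where "f = (\<lambda>_ _. b)" by blast
    then have "(\<lambda>_. c) = (\<lambda>_::int. d)" using that by (metis comp_apply id_apply)
    with cd show False by (simp add: fun_eq_iff)
  qed
  obtain a where a: "\<alpha> = Some a" using realizes_annotated_Some[OF A nc[OF h(2)]] by blast
  obtain B where "B \<in> realization_class h" using realization_class_nonempty[OF h(1)] by blast
  then obtain U :: "('a, nat) transducer" and \<beta> where B: "is_AL (U, \<beta>)" "realizes_annotated (U, \<beta>) h"
    unfolding realization_class_def by (cases B) auto
  obtain b where b: "\<beta> = Some b" using realizes_annotated_Some[OF B nc[OF h(3)]] by blast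
  note T = A[unfolded a realizes_annotated_simps annotation_fun_simps]
    and U = B[unfolded b realizes_annotated_simps annotation_fun_simps]
  have "is_O T" "is_O U" using is_O_invertible T U h gE by blast+
  then have "transducer_class T \<in> carrier O_tilde" "transducer_class U \<in> carrier O_tilde"
    by (auto simp: O_tilde_def)
  then have "transducer_class T \<in> Units O_tilde"
    using O_tilde_mult_inverse[OF card T gE U h(1,2)] O_tilde_mult_inverse[OF card U h(1) T gE h(3)]
    unfolding Units_def by blast
  moreover have "transducer_class T \<in> carrier L_tilde" using T(1) by (auto simp: L_tilde_def)
  ultimately show ?thesis by (simp add: L_set_def)
qed

lemma unit_of_L_set:
  fixes T :: "('a::{finite, linorder}, nat) transducer"
  assumes card: "CARD('a) \<ge> 2" and A: "is_AL (T, \<alpha>)" "realizes_annotated (T, \<alpha>) g"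
    and g: "g \<in> carrier End_shift" and L: "transducer_class T \<in> L_set"
  shows "g \<in> Units End_shift"
proof -
  let ?I = "identity_transducer :: ('a, nat) transducer"
  obtain c d :: 'a where cd: "c \<noteq> d" using two_letters[OF card] .
  have ne: "(\<lambda>_::nat. c) \<noteq> (\<lambda>_. d)" using cd by (simp add: fun_eq_iff)
  from L obtain Y where TO: "transducer_class T \<in> carrier O_tilde" and Y: "Y \<in> carrier O_tilde"
    "transducer_class T \<otimes>\<^bsub>O_tilde\<^esub> Y = \<one>\<^bsub>O_tilde\<^esub>" "Y \<otimes>\<^bsub>O_tilde\<^esub> transducer_class T = \<one>\<^bsub>O_tilde\<^esub>"
    unfolding L_set_def Units_def by blast
  obtain T0 :: "('a, nat) transducer" where T0: "is_O T0" "transducer_class T = transducer_class T0"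
    using TO by (auto simp: O_tilde_def)
  obtain U0 :: "('a, nat) transducer" where U0: "is_O U0" "Y = transducer_class U0"
    using Y(1) by (auto simp: O_tilde_def)
  have "T0 \<in> transducer_class T"
    using T0 same_transducer_refl by (auto simp: transducer_class_def is_O_def)
  then have same0: "same_transducer T T0" by (simp add: transducer_class_def)
  \<comment> \<open>A constant state map cannot be injective on an alphabet with two letters, as
    membership in \<open>O_tilde\<close> demands.\<close>
  have "\<alpha> \<noteq> None"
  proof
    assume "\<alpha> = None"
    with A obtain b where Z: "is_Z T [b]" by auto
    then obtain q where q: "q \<in> states T" by (auto simp: is_Z_def)
    obtain G where G: "G q \<in> states T0" "omega_equiv T q T0 (G q)"
      using same0 q bij_betwE unfolding same_transducer_def by blast
    have "state_map T0 (G q) (\<lambda>_. c) = state_map T0 (G q) (\<lambda>_. d)"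
      using is_Z_state_map_constant[OF Z q] G(2) by (simp add: omega_equiv_def)
    moreover have "inj (state_map T0 (G q))" using T0(1) G(1) unfolding is_O_def by blast
    ultimately show False using ne by (simp add: inj_eq)
  qed
  then obtain a where a: "\<alpha> = Some a" by blast
  note T = A[unfolded a realizes_annotated_simps annotation_fun_simps]
  have I: "?I \<in> transducer_class ?I"
    using is_AL_identity[OF card] same_transducer_refl by (auto simp: transducer_class_def is_L_def)
  have "?I \<in> (\<Union>T\<in>transducer_class T. \<Union>U\<in>transducer_class U0. transducer_class (mult_transducer T U))"
    using Y(2) I unfolding U0(2) mult_O_tilde one_O_tilde by simp
  \<comment> \<open>The identity arises from one pair of representatives for each order of the
    factors. The pairs may differ; transporting annotations makes both speak of the same two
    endomorphisms.\<close>
  then obtain T1 U1 where TU1: "T1 \<in> transducer_class T" "U1 \<in> transducer_class U0"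
    "?I \<in> transducer_class (mult_transducer T1 U1)" by blast
  have "?I \<in> (\<Union>U\<in>transducer_class U0. \<Union>T\<in>transducer_class T. transducer_class (mult_transducer U T))"
    using Y(3) I unfolding U0(2) mult_O_tilde one_O_tilde by simp
  then obtain U2 T2 where TU2: "T2 \<in> transducer_class T" "U2 \<in> transducer_class U0"
    "?I \<in> transducer_class (mult_transducer U2 T2)" by blast
  note same1 = TU1(3)[unfolded transducer_class_def, simplified, THEN conjunct2]
    and same2 = TU2(3)[unfolded transducer_class_def, simplified, THEN conjunct2]
  obtain a1 a2 where T12: "is_AL (T1, Some a1)" "realizes T1 a1 g" "is_AL (T2, Some a2)" "realizes T2 a2 g"
    using annotation_transport[OF T] TU1(1) TU2(1) unfolding transducer_class_def by blast
  have U12: "is_M U1" "is_M U2" "same_transducer U0 U1" "same_transducer U0 U2"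
    using TU1(2) TU2(2) by (auto simp: transducer_class_def)
  have "full_response U2 \<and> weakly_minimal U2"
  proof -
    obtain q k where q: "q \<in> states U0"
      using U0(1) sync_coreE[OF is_MD] unfolding is_O_def by blast
    then have "state_map U0 q (\<lambda>_. c) \<noteq> state_map U0 q (\<lambda>_. d)"
      using U0(1) ne unfolding is_O_def by (metis injD)
    moreover obtain G where "G q \<in> states U2" "omega_equiv U0 q U2 (G q)"
      using U12(4) q bij_betwE unfolding same_transducer_def by blast
    ultimately show ?thesis
      using is_M_full_response[OF U12(2)] unfolding omega_equiv_def by metis
  qed
  moreover have T2: "sync_core T2" using T12(3)[unfolded is_AL_Some_iff] by blast
  have "length (outs T2 w q) = length w" if "q \<in> states T2" "steps T2 w q = q" for w q
    using T12(3) that by (auto simp: is_L_def)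
  \<comment> \<open>The inverse was only known to lie in \<open>O_tilde\<close>. As a left inverse
    of \<open>T2\<close> it preserves lengths on loops, and so an annotation and an endomorphism
    \<open>h\<close> can be constructed for it.\<close>
  note loops = loops_of_left_inverse[OF card is_MD[OF U12(2)] T2 this same2]
  obtain b2 where "annotation U2 b2"
    using annotation_ex[OF strongly_connected_sync_core sync_coreD(1)] is_MD[OF U12(2)] loops by blast
  ultimately have U2: "is_AL (U2, Some b2)"
    unfolding is_AL_Some_iff using is_MD[OF U12(2)] by blast
  obtain h where h: "h \<in> carrier End_shift" "realizes U2 b2 h"
    using is_AL_realizes_ex[OF U2] by auto
  have "same_transducer U2 U1" using U12(3,4) same_transducer_sym same_transducer_trans by blast
  then obtain b1 where U1: "is_AL (U1, Some b1)" "realizes U1 b1 h"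
    using annotation_transport[OF U2 h(2) U12(1)] by blast
  obtain i where i: "h \<circ> g = shift_by i"
    using realizes_shift_of_identity[OF card T12(1) _ g U1(1) _ h(1)] T12(2) U1(2) same1 by auto
  obtain j where j: "g \<circ> h = shift_by j"
    using realizes_shift_of_identity[OF card U2(1) _ h(1) T12(3) _ g] T12(4) h(2) same2 by auto
  \<comment> \<open>A shift applied before \<open>h\<close> turns it into a right inverse of
    \<open>g\<close>, a shift applied after \<open>h\<close> into a left inverse; having both, the
    two coincide.\<close>
  define h' where "h' = h \<circ> shift_by (- j)"
  have h': "h' \<in> carrier End_shift"
    unfolding h'_def by (rule comp_End_shift[OF shift_by_End_shift h(1)])
  have right: "g \<circ> h' = id"
    using j shift_by_add[of j "- j"] unfolding h'_def by (simp add: comp_assoc[symmetric])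
  have left: "(shift_by (- i) \<circ> h) \<circ> g = id"
    using i shift_by_add[of "- i" i] by (simp add: comp_assoc)
  have "h' = ((shift_by (- i) \<circ> h) \<circ> g) \<circ> h'" by (simp only: left id_comp)
  also have "\<dots> = (shift_by (- i) \<circ> h) \<circ> (g \<circ> h')" by (simp only: comp_assoc)
  also have "\<dots> = shift_by (- i) \<circ> h" by (simp only: right comp_id)
  finally have "h' \<circ> g = id" using left by simp
  with right h' g show ?thesis unfolding Units_End_shift_iff by blast
qed

text \<open>Showing \<open>AL\<close> as the image of the unit group gives its closure under
  products and inverses without a computation with transducers.\<close>

lemma carrier_AL:
  assumes card: "CARD('a::{finite, linorder}) \<ge> 2"
  shows "carrier AL = phi ` Units (End_shift :: ((int \<Rightarrow> 'a) \<Rightarrow> _) monoid)"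
proof (intro equalityI subsetI)
  fix X :: "('a, nat) annotated set" assume "X \<in> carrier AL"
  then obtain T :: "('a, nat) transducer" and \<alpha>
    where X: "X = annotated_class (T, \<alpha>)" "is_AL (T, \<alpha>)" "transducer_class T \<in> L_set"
    by (simp add: AL_def) blast
  obtain g where g: "g \<in> carrier End_shift" "realizes_annotated (T, \<alpha>) g"
    using is_AL_realizes_ex[OF X(2)] by blast
  then have "g \<in> Units End_shift" using unit_of_L_set[OF card X(2)] X(3) by blast
  moreover have "X = phi g"
    using annotated_class_realization[OF X(2) g(2)] phi_eq[OF g(1)] X(1) by simp
  ultimately show "X \<in> phi ` Units End_shift" by blast
next
  fix X assume "X \<in> phi ` Units (End_shift :: ((int \<Rightarrow> 'a) \<Rightarrow> _) monoid)"
  then obtain g :: "(int \<Rightarrow> 'a) \<Rightarrow> _" where g: "g \<in> Units End_shift" "X = phi g" by blast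
  then have gE: "g \<in> carrier End_shift" unfolding Units_End_shift_iff by blast
  obtain A where "A \<in> realization_class g" using realization_class_nonempty[OF gE] by blast
  then obtain T :: "('a, nat) transducer" and \<alpha>
    where A: "is_AL (T, \<alpha>)" "realizes_annotated (T, \<alpha>) g"
    unfolding realization_class_def by (cases A) auto
  have "X = annotated_class (T, \<alpha>)"
    using annotated_class_realization[OF A] phi_eq[OF gE] g(2) by simp
  then show "X \<in> carrier AL" using L_set_of_unit[OF card g(1) A] A(1) by (auto simp: AL_def)
qed

theorem theorem4p22:
  assumes "CARD('a::{finite, linorder}) \<ge> 2"
  shows "(\<forall>i f. \<forall>P :: ('a, nat) transducer.
            f \<in> F_infinity \<and> is_P P \<and> P_map P = f \<longrightarrow>
            phi ((shift [^]\<^bsub>End_shift\<^esub> i) \<otimes>\<^bsub>End_shift\<^esub> f) = annotated_class (annotated_of i P))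
       \<and> monoid (End_shift :: ((int \<Rightarrow> 'a) \<Rightarrow> (int \<Rightarrow> 'a)) monoid)
       \<and> monoid (AL_tilde :: ('a, nat) annotated set monoid)
       \<and> phi \<in> iso (End_shift :: ((int \<Rightarrow> 'a) \<Rightarrow> (int \<Rightarrow> 'a)) monoid) AL_tilde
       \<and> phi \<one>\<^bsub>End_shift :: ((int \<Rightarrow> 'a) \<Rightarrow> (int \<Rightarrow> 'a)) monoid\<^esub> = \<one>\<^bsub>AL_tilde\<^esub>
       \<and> group (Aut_shift :: ((int \<Rightarrow> 'a) \<Rightarrow> (int \<Rightarrow> 'a)) monoid)
       \<and> group (AL :: ('a, nat) annotated set monoid)
       \<and> phi \<in> iso (Aut_shift :: ((int \<Rightarrow> 'a) \<Rightarrow> (int \<Rightarrow> 'a)) monoid) AL"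
proof (intro conjI allI impI)
  fix i f and P :: "('a, nat) transducer"
  assume fP: "f \<in> F_infinity \<and> is_P P \<and> P_map P = f"
  then have "f \<in> carrier End_shift" using P_map_End_shift is_P_iff by blast
  then have "f \<circ> shift_by i \<in> carrier End_shift" by (rule comp_End_shift[OF shift_by_End_shift])
  then show "phi ((shift [^]\<^bsub>End_shift\<^esub> i) \<otimes>\<^bsub>End_shift\<^esub> f) = annotated_class (annotated_of i P)"
    using annotated_class_realization[OF annotated_of_realizes, of P i] fP
    by (simp add: shift_pow phi_eq)
next
  let ?phi = "phi :: ((int \<Rightarrow> 'a) \<Rightarrow> (int \<Rightarrow> 'a)) \<Rightarrow> _"
  let ?End = "End_shift :: ((int \<Rightarrow> 'a) \<Rightarrow> (int \<Rightarrow> 'a)) monoid"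
  show E: "monoid ?End" by (rule monoid_End_shift)
  show "monoid (AL_tilde :: ('a, nat) annotated set monoid)" by (rule monoid_AL_tilde[OF assms])
  have inj: "inj_on ?phi (carrier ?End)"
    using realization_class_inj phi_eq by (metis inj_on_cong)
  have "?phi ` carrier ?End = carrier AL_tilde" unfolding carrier_AL_tilde by (simp add: phi_eq)
  with inj show "?phi \<in> iso ?End AL_tilde"
    using phi_hom by (intro isoI) (auto simp: bij_betw_def)
  show one: "?phi \<one>\<^bsub>?End\<^esub> = \<one>\<^bsub>AL_tilde\<^esub>"
    using one_AL_tilde[OF assms] phi_eq[OF End_shift_id] by simp
  show Aut: "group (Aut_shift :: ((int \<Rightarrow> 'a) \<Rightarrow> (int \<Rightarrow> 'a)) monoid)"
    unfolding Aut_shift_def by (rule monoid.units_group[OF E])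
  have carrier_Aut: "carrier Aut_shift = Units ?End"
    by (simp add: Aut_shift_def units_of_def)
  have sub: "Units ?End \<subseteq> carrier ?End" by (auto simp: Units_def)
  have hom: "?phi \<in> hom Aut_shift AL"
  proof (rule homI)
    fix g h :: "(int \<Rightarrow> 'a) \<Rightarrow> (int \<Rightarrow> 'a)"
    assume gh: "g \<in> carrier Aut_shift" "h \<in> carrier Aut_shift"
    then show "phi g \<in> carrier AL" unfolding carrier_AL[OF assms] carrier_Aut by blast
    have "phi (g \<otimes>\<^bsub>End_shift\<^esub> h) = phi g \<otimes>\<^bsub>AL_tilde\<^esub> phi h"
      using gh sub phi_hom unfolding carrier_Aut hom_def by blast
    then show "phi (g \<otimes>\<^bsub>Aut_shift\<^esub> h) = phi g \<otimes>\<^bsub>AL\<^esub> phi h"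
      by (simp add: Aut_shift_def units_of_def AL_def)
  qed
  have img: "?phi ` carrier Aut_shift = carrier AL" unfolding carrier_AL[OF assms] carrier_Aut ..
  have "?phi \<one>\<^bsub>Aut_shift\<^esub> = \<one>\<^bsub>AL\<^esub>" using one by (simp add: Aut_shift_def units_of_def AL_def)
  with img show "group (AL :: ('a, nat) annotated set monoid)"
    using group.hom_imp_img_group[OF Aut hom] by simp
  show "?phi \<in> iso Aut_shift AL"
    using hom img inj_on_subset[OF inj sub] unfolding carrier_Aut[symmetric]
    by (intro isoI) (auto simp: bij_betw_def)
qed


end
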